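(* Suppose the measured outputs satisfy $\theta_0,\theta_\ell\in H^1(0,T)$. Then the Tikhonov functional $$J(F)=\frac12\int_0^T[u_x(0,t;F)-\theta_0(t)]^2dt+\frac12\int_0^T[u_x(\ell,t;F)-\theta_\ell(t)]^2dt,\qquad F\in\mathcal F,$$ is Fréchet differentiable, and its Fréchet gradient is given by $$J'(F)(x,t)=\varphi(x,t;F)\quad\text{for a.e. }(x,t)\in\Omega_T,\ F\in\mathcal F,$$ where $u(\cdot,\cdot;F)$ is the weak solution of the forward problem with load $F$ and $\varphi(\cdot,\cdot;F)$ is the weak solution of the adjoint problem (both stated in the context).
   Context: Let $\ell,T>0$ and $\Omega_T=(0,\ell)\times(0,T)$. The coefficients satisfy $\rho_A,\mu,T_r,r,\kappa\in L^\infty(0,\ell)$ and there are constants with, for $x\in(0,\ell)$, $0<\rho_0\le\rho_A(x)\le\rho_1$, $0\le T_{r0}\le T_r(x)\le T_{r1}$, $0<r_0\le r(x)\le r_1$, $0\le\mu_0\le\mu(x)\le\mu_1$, $0<\kappa_0\le\kappa(x)\le\kappa_1$. Let $\mathcal V^2(0,\ell)=\{v\in H^2(0,\ell): v(0)=v(\ell)=0\}$. The set of admissible loads is $\mathcal F=\{F\in L^2(\Omega_T):\Vert F\Vert^2_{L^2(\Omega_T)}\le C_F\}$, with $C_F>0$ a fixed constant; increments $\delta F$ are such that $F,F+\delta F\in\mathcal F$, and the gradient is taken with respect to the $L^2(\Omega_T)$ inner product. Forward problem with load $F$: $\rho_A(x)u_{tt}+\mu(x)u_t-(T_r(x)u_x)_x+(r(x)u_{xx}+\kappa(x)u_{xxt})_{xx}=F(x,t)$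 in $\Omega_T$; $u(x,0)=u_t(x,0)=0$ for $x\in(0,\ell)$; $u(0,t)=u(\ell,t)=0$ and $(r u_{xx}+\kappa u_{xxt})|_{x=0}=(r u_{xx}+\kappa u_{xxt})|_{x=\ell}=0$ for $t\in[0,T]$. Adjoint problem: $\rho_A(x)\varphi_{tt}-\mu(x)\varphi_t-(T_r(x)\varphi_x)_x+(r(x)\varphi_{xx}-\kappa(x)\varphi_{xxt})_{xx}=0$ in $\Omega_T$; $\varphi(x,T)=\varphi_t(x,T)=0$; $\varphi(0,t)=\varphi(\ell,t)=0$; $-(r\varphi_{xx}-\kappa\varphi_{xxt})|_{x=0}=p(t)$, $(r\varphi_{xx}-\kappa\varphi_{xxt})|_{x=\ell}=q(t)$, with $p(t)=u_x(0,t;F)-\theta_0(t)$, $q(t)=u_x(\ell,t;F)-\theta_\ell(t)$. Weak solutions $w$ ($w=u$ or $\varphi$) lie in $L^2(0,T;\mathcal V^2(0,\ell))$ with $w_t\in L^2(0,T;L^2(0,\ell))$, $w_{tt}\in L^2(0,T;H^{-2}(0,\ell))$, in the usual variational sense. For $u$: $u(\cdot,0)=0$ and for all $v\in H^1(0,T;\mathcal V^2(0,\ell))$ with $v(\cdot,T)=0$, $\int_0^T\int_0^\ell[-\rho_A u_tv_t+\mu u_tv+T_ru_xv_x+ru_{xx}v_{xx}-\kappa u_{xx}v_{xxt}]\,dx\,dt=\int_0^T\int_0^\ell Fv\,dx\,dt$. For $\varphi$: $\varphi(\cdot,T)=0$ and for all $v\in H^1(0,T;\mathcal V^2(0,\ell))$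 with $v(\cdot,0)=0$, $\int_0^T\int_0^\ell[-\rho_A\varphi_tv_t-\mu\varphi_tv+T_r\varphi_xv_x+r\varphi_{xx}v_{xx}+\kappa\varphi_{xx}v_{xxt}]\,dx\,dt=\int_0^T[p(t)v_x(0,t)+q(t)v_x(\ell,t)]\,dt$. *)

theory Defs
  imports "HOL-Analysis.Analysis"
begin

section \<open>Lebesgue and Sobolev spaces on an interval\<close>

text \<open>Elements of the spaces below are represented by functions; two functions that agree almost
  everywhere on the domain represent the same element. The
  representatives are Borel measurable on the domain, which is no restriction.\<close>

definition L2_on :: "'a::euclidean_space set \<Rightarrow> ('a \<Rightarrow> real) set" where
  "L2_on S = {f. set_borel_measurable lborel S f \<and> set_integrable lborel S (\<lambda>x. (f x)\<^sup>2)}"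

definition L2_inner :: "'a::euclidean_space set \<Rightarrow> ('a \<Rightarrow> real) \<Rightarrow> ('a \<Rightarrow> real) \<Rightarrow> real" where
  "L2_inner S f g = (LINT x:S|lborel. f x * g x)"

definition L2_norm :: "'a::euclidean_space set \<Rightarrow> ('a \<Rightarrow> real) \<Rightarrow> real" where
  "L2_norm S f = sqrt (L2_inner S f f)"

definition Linf_on :: "'a::euclidean_space set \<Rightarrow> ('a \<Rightarrow> real) set" where
  "Linf_on S = {f. set_borel_measurable lborel S f \<and> (\<exists>C. AE x\<in>S in lborel. \<bar>f x\<bar> \<le> C)}"

text \<open>Continuously differentiable functions with compact support in \<open>(a, b)\<close>.\<close>

definition C1c :: "real \<Rightarrow> real \<Rightarrow> (real \<Rightarrow> real) set" where
  "C1c a b = {\<psi>. (\<forall>x. \<psi> differentiable at x) \<and> continuous_on UNIV (deriv \<psi>) \<and>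
     (\<exists>c d. a < c \<and> d < b \<and> (\<forall>x. x \<notin> {c..d} \<longrightarrow> \<psi> x = 0))}"

text \<open>\<open>f\<close> belongs to \<open>H\<^sup>1(a, b)\<close> and \<open>g\<close> is its weak derivative. As usual on an interval,
  testing with \<open>C\<^sup>1\<close> functions of compact support is the same as testing with smooth ones.\<close>

definition has_weak_deriv :: "real \<Rightarrow> real \<Rightarrow> (real \<Rightarrow> real) \<Rightarrow> (real \<Rightarrow> real) \<Rightarrow> bool" where
  "has_weak_deriv a b f g \<longleftrightarrow> f \<in> L2_on {a<..<b} \<and> g \<in> L2_on {a<..<b} \<and>
     (\<forall>\<psi>\<in>C1c a b. (LINT x:{a<..<b}|lborel. f x * deriv \<psi> x)
                 = - (LINT x:{a<..<b}|lborel. g x * \<psi> x))"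

definition weak_deriv :: "real \<Rightarrow> real \<Rightarrow> (real \<Rightarrow> real) \<Rightarrow> real \<Rightarrow> real" where
  "weak_deriv a b f = (SOME g. has_weak_deriv a b f g)"

definition H1_on :: "real \<Rightarrow> real \<Rightarrow> (real \<Rightarrow> real) set" where
  "H1_on a b = {f. \<exists>g. has_weak_deriv a b f g}"

definition H2_on :: "real \<Rightarrow> real \<Rightarrow> (real \<Rightarrow> real) set" where
  "H2_on a b = {f. \<exists>g h. has_weak_deriv a b f g \<and> has_weak_deriv a b g h}"

definition H2_norm :: "real \<Rightarrow> real \<Rightarrow> (real \<Rightarrow> real) \<Rightarrow> real" where
  "H2_norm a b f = sqrt ((L2_norm {a<..<b} f)\<^sup>2 + (L2_norm {a<..<b} (weak_deriv a b f))\<^sup>2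
     + (L2_norm {a<..<b} (weak_deriv a b (weak_deriv a b f)))\<^sup>2)"

text \<open>The value at \<open>c \<in> [a, b]\<close> of the continuous representative, and its derivative there;
  meaningful for \<open>H\<^sup>1\<close> and \<open>H\<^sup>2\<close> functions, respectively.\<close>

definition point_value :: "real \<Rightarrow> real \<Rightarrow> (real \<Rightarrow> real) \<Rightarrow> real \<Rightarrow> real" where
  "point_value a b f c = (THE y. \<exists>g. continuous_on {a..b} g \<and>
     (AE x\<in>{a<..<b} in lborel. g x = f x) \<and> y = g c)"

definition point_slope :: "real \<Rightarrow> real \<Rightarrow> (real \<Rightarrow> real) \<Rightarrow> real \<Rightarrow> real" where
  "point_slope a b f c = point_value a b (weak_deriv a b f) c"

definition V2 :: "real \<Rightarrow> (real \<Rightarrow> real) set" where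
  "V2 l = {v \<in> H2_on 0 l. point_value 0 l v 0 = 0 \<and> point_value 0 l v l = 0}"

definition H20 :: "real \<Rightarrow> (real \<Rightarrow> real) set" where
  "H20 l = {v \<in> V2 l. point_slope 0 l v 0 = 0 \<and> point_slope 0 l v l = 0}"

section \<open>Spaces of functions of space and time\<close>

definition cyl :: "real \<Rightarrow> real \<Rightarrow> (real \<times> real) set" where
  "cyl l T = {0<..<l} \<times> {0<..<T}"

text \<open>A map \<open>u\<close> from \<open>(0, T)\<close> to functions on \<open>(0, l)\<close> is written as a function of the pair
  \<open>(x, t)\<close>; in this form \<open>L\<^sup>2(0, T; L\<^sup>2(0, l))\<close> is \<open>L2_on (cyl l T)\<close>. The next predicate says
  \<open>u \<in> L\<^sup>2(0, T; V2 l)\<close>, with \<open>ux\<close> and \<open>uxx\<close> the weak spatial derivatives of \<open>u\<close>.\<close>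

definition L2_V2 :: "real \<Rightarrow> real \<Rightarrow> (real \<times> real \<Rightarrow> real) \<Rightarrow> (real \<times> real \<Rightarrow> real)
    \<Rightarrow> (real \<times> real \<Rightarrow> real) \<Rightarrow> bool" where
  "L2_V2 l T u ux uxx \<longleftrightarrow>
     u \<in> L2_on (cyl l T) \<and> ux \<in> L2_on (cyl l T) \<and> uxx \<in> L2_on (cyl l T) \<and>
     (AE t\<in>{0<..<T} in lborel. (\<lambda>x. u (x, t)) \<in> V2 l \<and>
        has_weak_deriv 0 l (\<lambda>x. u (x, t)) (\<lambda>x. ux (x, t)) \<and>
        has_weak_deriv 0 l (\<lambda>x. ux (x, t)) (\<lambda>x. uxx (x, t)))"

text \<open>\<open>ut\<close> is the weak time derivative of \<open>u\<close>, both in \<open>L\<^sup>2(0, T; L\<^sup>2(0, l))\<close>: the identity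
  \<open>\<integral> u \<psi>' dt = - \<integral> ut \<psi> dt\<close> of \<open>L\<^sup>2(0, l)\<close>-valued integrals, whose values are computed
  pointwise in \<open>x\<close>.\<close>

definition has_weak_time_deriv :: "real \<Rightarrow> real \<Rightarrow> (real \<times> real \<Rightarrow> real)
    \<Rightarrow> (real \<times> real \<Rightarrow> real) \<Rightarrow> bool" where
  "has_weak_time_deriv l T u ut \<longleftrightarrow> u \<in> L2_on (cyl l T) \<and> ut \<in> L2_on (cyl l T) \<and>
     (\<forall>\<psi>\<in>C1c 0 T. AE x\<in>{0<..<l} in lborel.
        (LINT t:{0<..<T}|lborel. u (x, t) * deriv \<psi> t)
          = - (LINT t:{0<..<T}|lborel. ut (x, t) * \<psi> t))"

text \<open>\<open>u(\<cdot>, c) = 0\<close> for the representative of \<open>u\<close> in \<open>C([0, T]; L\<^sup>2(0, l))\<close>.\<close>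

definition vanishes_at_time :: "real \<Rightarrow> real \<Rightarrow> (real \<times> real \<Rightarrow> real) \<Rightarrow> real \<Rightarrow> bool" where
  "vanishes_at_time l T u c \<longleftrightarrow> (\<exists>w. (AE p\<in>cyl l T in lborel. w p = u p) \<and>
     (\<forall>t\<in>{0..T}. (\<lambda>x. w (x, t)) \<in> L2_on {0<..<l}) \<and>
     (\<forall>s\<in>{0..T}. ((\<lambda>t. L2_norm {0<..<l} (\<lambda>x. w (x, t) - w (x, s))) \<longlongrightarrow> 0) (at s within {0..T})) \<and>
     (AE x\<in>{0<..<l} in lborel. w (x, c) = 0))"

text \<open>\<open>W \<in> L\<^sup>2(0, T; H\<^sup>-\<^sup>2(0, l))\<close>, where \<open>H\<^sup>-\<^sup>2\<close> is the dual of \<open>H20 l\<close>, the space usually written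
  \<open>H\<^sup>2\<close> with subscript \<open>0\<close>. As this space is
  separable, weak measurability suffices, and it makes the dual norm of \<open>W t\<close> measurable in \<open>t\<close>;
  that norm is square integrable iff it is dominated by some \<open>c \<in> L\<^sup>2(0, T)\<close>.\<close>

definition L2_Hminus2 :: "real \<Rightarrow> real \<Rightarrow> (real \<Rightarrow> (real \<Rightarrow> real) \<Rightarrow> real) set" where
  "L2_Hminus2 l T = {W.
     (\<forall>v\<in>H20 l. set_borel_measurable lborel {0<..<T} (\<lambda>t. W t v)) \<and>
     (AE t\<in>{0<..<T} in lborel. \<forall>v\<in>H20 l. \<forall>w\<in>H20 l. \<forall>a b.
        W t (\<lambda>x. a * v x + b * w x) = a * W t v + b * W t w) \<and>
     (\<exists>c\<in>L2_on {0<..<T}. AE t\<in>{0<..<T} in lborel. \<forall>v\<in>H20 l. \<bar>W t v\<bar> \<le> c t * H2_norm 0 l v)}"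

text \<open>The weak time derivative of \<open>w\<close> is in \<open>L\<^sup>2(0, T; H\<^sup>-\<^sup>2(0, l))\<close>.\<close>

definition time_deriv_in_L2_Hminus2 :: "real \<Rightarrow> real \<Rightarrow> (real \<times> real \<Rightarrow> real) \<Rightarrow> bool" where
  "time_deriv_in_L2_Hminus2 l T w \<longleftrightarrow> (\<exists>W\<in>L2_Hminus2 l T. \<forall>v\<in>H20 l. \<forall>\<psi>\<in>C1c 0 T.
     (LINT (x, t):cyl l T|lborel. w (x, t) * v x * deriv \<psi> t)
       = - (LINT t:{0<..<T}|lborel. W t v * \<psi> t))"

text \<open>\<open>v \<in> H\<^sup>1(0, T; V2 l)\<close>; the remaining arguments are the weak derivatives
  \<open>v\<^sub>x, v\<^sub>x\<^sub>x, v\<^sub>t, v\<^sub>x\<^sub>t, v\<^sub>x\<^sub>x\<^sub>t\<close>.\<close>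

definition H1_V2 :: "real \<Rightarrow> real \<Rightarrow> (real \<times> real \<Rightarrow> real) \<Rightarrow> (real \<times> real \<Rightarrow> real)
    \<Rightarrow> (real \<times> real \<Rightarrow> real) \<Rightarrow> (real \<times> real \<Rightarrow> real) \<Rightarrow> (real \<times> real \<Rightarrow> real)
    \<Rightarrow> (real \<times> real \<Rightarrow> real) \<Rightarrow> bool" where
  "H1_V2 l T v vx vxx vt vxt vxxt \<longleftrightarrow>
     L2_V2 l T v vx vxx \<and> L2_V2 l T vt vxt vxxt \<and> has_weak_time_deriv l T v vt"

section \<open>Forward and adjoint problems\<close>

text \<open>Integrals of \<open>t \<mapsto> point_slope 0 l (\<lambda>x. v (x, t)) c\<close> are taken with respect to \<open>lebesgue\<close>: that
  function is determined only for almost every \<open>t\<close>, so it need not be Borel measurable, and with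
  \<open>lborel\<close> the integral could degenerate to \<open>0\<close>.\<close>

definition forward_weak_solution :: "real \<Rightarrow> real \<Rightarrow> (real \<Rightarrow> real) \<Rightarrow> (real \<Rightarrow> real)
    \<Rightarrow> (real \<Rightarrow> real) \<Rightarrow> (real \<Rightarrow> real) \<Rightarrow> (real \<Rightarrow> real)
    \<Rightarrow> (real \<times> real \<Rightarrow> real) \<Rightarrow> (real \<times> real \<Rightarrow> real) \<Rightarrow> bool" where
  "forward_weak_solution l T \<rho> \<mu> Tr r \<kappa> F u \<longleftrightarrow>
     (\<exists>ux uxx ut. L2_V2 l T u ux uxx \<and> has_weak_time_deriv l T u ut \<and>
        time_deriv_in_L2_Hminus2 l T ut \<and> vanishes_at_time l T u 0 \<and>
        (\<forall>v vx vxx vt vxt vxxt. H1_V2 l T v vx vxx vt vxt vxxt \<and> vanishes_at_time l T v T \<longrightarrow>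
           (LINT (x, t):cyl l T|lborel.
               - \<rho> x * ut (x, t) * vt (x, t) + \<mu> x * ut (x, t) * v (x, t)
               + Tr x * ux (x, t) * vx (x, t) + r x * uxx (x, t) * vxx (x, t)
               - \<kappa> x * uxx (x, t) * vxxt (x, t))
           = (LINT (x, t):cyl l T|lborel. F (x, t) * v (x, t))))"

definition adjoint_weak_solution :: "real \<Rightarrow> real \<Rightarrow> (real \<Rightarrow> real) \<Rightarrow> (real \<Rightarrow> real)
    \<Rightarrow> (real \<Rightarrow> real) \<Rightarrow> (real \<Rightarrow> real) \<Rightarrow> (real \<Rightarrow> real)
    \<Rightarrow> (real \<Rightarrow> real) \<Rightarrow> (real \<Rightarrow> real) \<Rightarrow> (real \<times> real \<Rightarrow> real) \<Rightarrow> bool" where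
  "adjoint_weak_solution l T \<rho> \<mu> Tr r \<kappa> p q \<phi> \<longleftrightarrow>
     (\<exists>\<phi>x \<phi>xx \<phi>t. L2_V2 l T \<phi> \<phi>x \<phi>xx \<and> has_weak_time_deriv l T \<phi> \<phi>t \<and>
        time_deriv_in_L2_Hminus2 l T \<phi>t \<and> vanishes_at_time l T \<phi> T \<and>
        (\<forall>v vx vxx vt vxt vxxt. H1_V2 l T v vx vxx vt vxt vxxt \<and> vanishes_at_time l T v 0 \<longrightarrow>
           (LINT (x, t):cyl l T|lborel.
               - \<rho> x * \<phi>t (x, t) * vt (x, t) - \<mu> x * \<phi>t (x, t) * v (x, t)
               + Tr x * \<phi>x (x, t) * vx (x, t) + r x * \<phi>xx (x, t) * vxx (x, t)
               + \<kappa> x * \<phi>xx (x, t) * vxxt (x, t))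
           = (LINT t:{0<..<T}|lebesgue. p t * point_slope 0 l (\<lambda>x. v (x, t)) 0
               + q t * point_slope 0 l (\<lambda>x. v (x, t)) l)))"

section \<open>The Tikhonov functional and its Frechet gradient\<close>

definition admissible_loads :: "real \<Rightarrow> real \<Rightarrow> real \<Rightarrow> (real \<times> real \<Rightarrow> real) set" where
  "admissible_loads l T CF = {F \<in> L2_on (cyl l T). (L2_norm (cyl l T) F)\<^sup>2 \<le> CF}"

text \<open>\<open>u\<close> is the map from loads to solutions, and \<open>c\<close> is the position of the sensor.\<close>

definition output_misfit :: "real \<Rightarrow> ((real \<times> real \<Rightarrow> real) \<Rightarrow> real \<times> real \<Rightarrow> real)
    \<Rightarrow> (real \<Rightarrow> real) \<Rightarrow> real \<Rightarrow> (real \<times> real \<Rightarrow> real) \<Rightarrow> real \<Rightarrow> real" where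
  "output_misfit l u \<theta> c F t = point_slope 0 l (\<lambda>x. u F (x, t)) c - \<theta> t"

definition tikhonov :: "real \<Rightarrow> real \<Rightarrow> ((real \<times> real \<Rightarrow> real) \<Rightarrow> real \<times> real \<Rightarrow> real)
    \<Rightarrow> (real \<Rightarrow> real) \<Rightarrow> (real \<Rightarrow> real) \<Rightarrow> (real \<times> real \<Rightarrow> real) \<Rightarrow> real" where
  "tikhonov l T u \<theta>0 \<theta>l F =
     1/2 * (LINT t:{0<..<T}|lebesgue. (output_misfit l u \<theta>0 0 F t)\<^sup>2)
     + 1/2 * (LINT t:{0<..<T}|lebesgue. (output_misfit l u \<theta>l l F t)\<^sup>2)"

text \<open>\<open>D\<close> is a bounded linear functional on \<open>L\<^sup>2(S)\<close> and is the Frechet derivative at \<open>F\<close> of the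
  functional \<open>J\<close> on \<open>\<F> \<subseteq> L\<^sup>2(S)\<close>, the increments \<open>h\<close> being those with \<open>F + h \<in> \<F>\<close>.\<close>

definition has_frechet_deriv :: "'a::euclidean_space set \<Rightarrow> ('a \<Rightarrow> real) set
    \<Rightarrow> (('a \<Rightarrow> real) \<Rightarrow> real) \<Rightarrow> ('a \<Rightarrow> real) \<Rightarrow> (('a \<Rightarrow> real) \<Rightarrow> real) \<Rightarrow> bool" where
  "has_frechet_deriv S \<F> J F D \<longleftrightarrow>
     (\<forall>g\<in>L2_on S. \<forall>h\<in>L2_on S. \<forall>a b. D (\<lambda>x. a * g x + b * h x) = a * D g + b * D h) \<and>
     (\<exists>C. \<forall>h\<in>L2_on S. \<bar>D h\<bar> \<le> C * L2_norm S h) \<and>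
     (\<forall>\<epsilon>>0. \<exists>\<delta>>0. \<forall>h\<in>L2_on S. (\<lambda>x. F x + h x) \<in> \<F> \<and> L2_norm S h < \<delta> \<longrightarrow>
        \<bar>J (\<lambda>x. F x + h x) - J F - D h\<bar> \<le> \<epsilon> * L2_norm S h)"

definition frechet_differentiable_at :: "'a::euclidean_space set \<Rightarrow> ('a \<Rightarrow> real) set
    \<Rightarrow> (('a \<Rightarrow> real) \<Rightarrow> real) \<Rightarrow> ('a \<Rightarrow> real) \<Rightarrow> bool" where
  "frechet_differentiable_at S \<F> J F \<longleftrightarrow> (\<exists>D. has_frechet_deriv S \<F> J F D)"

definition is_frechet_gradient :: "'a::euclidean_space set \<Rightarrow> ('a \<Rightarrow> real) set
    \<Rightarrow> (('a \<Rightarrow> real) \<Rightarrow> real) \<Rightarrow> ('a \<Rightarrow> real) \<Rightarrow> ('a \<Rightarrow> real) \<Rightarrow> bool" where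
  "is_frechet_gradient S \<F> J F g \<longleftrightarrow> g \<in> L2_on S \<and> has_frechet_deriv S \<F> J F (L2_inner S g)"

end

theory Submission
  imports Defs
begin

text \<open>The functional \<open>J\<close> is quadratic, and with \<open>\<delta>u = u(F + h) - u(F)\<close>
  \<open>J(F + h) - J(F) = \<integral> (p \<delta>u\<^sub>x(0, t) + q \<delta>u\<^sub>x(l, t)) dt + 1/2 \<integral> (\<delta>u\<^sub>x(0, t)\<^sup>2 + \<delta>u\<^sub>x(l, t)\<^sup>2) dt\<close>.
  The last term is \<open>O(\<parallel>h\<parallel>\<^sup>2)\<close> by an energy estimate: the test function \<open>v = \<integral>\<^sub>t\<^sup>T \<delta>u\<close> turns the
  damping term into \<open>\<integral>\<integral> \<kappa> \<delta>u\<^sub>x\<^sub>x\<^sup>2\<close> and makes all other terms on the left nonnegative, because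
  \<open>\<integral>\<^sub>0\<^sup>T a(t) \<integral>\<^sub>t\<^sup>T a(s) ds dt = 1/2 (\<integral>\<^sub>0\<^sup>T a)\<^sup>2\<close>. The first term equals \<open>\<integral>\<integral> h \<phi>\<close>. Neither \<open>\<phi>\<close> nor
  \<open>\<delta>u\<close> is an admissible test function, so the forward problem is tested with a time average
  \<open>K \<phi>\<close> and the adjoint problem with \<open>K\<^sup>* \<delta>u\<close>. As the coefficients do not depend on time, all
  terms on the left cancel, and \<open>\<integral>\<integral> h K \<phi> = \<integral> (K p \<delta>u\<^sub>x(0, t) + K q \<delta>u\<^sub>x(l, t)) dt\<close>. When the averaging
  length tends to \<open>0\<close>, the left side converges since \<open>\<phi>\<^sub>t \<in> L\<^sup>2\<close>, and the right side since the
  slope of \<open>\<delta>u\<close> at an end point is an average of \<open>\<delta>u\<close>, which has a time derivative in \<open>L\<^sup>2\<close>, plus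
  a term bounded by a small multiple of the norm of \<open>\<delta>u\<^sub>x\<^sub>x\<close>.\<close>

section \<open>Square-integrable functions\<close>

text \<open>The obstacle is regularity in time: a test function needs
  \<open>v\<^sub>x\<^sub>x\<^sub>t\<close> in \<open>L\<^sup>2\<close>, while a solution has only
  \<open>u\<^sub>x\<^sub>x\<close> and \<open>u\<^sub>t\<close> there. Everything spatial is
  therefore expressed by the second derivative through the Dirichlet Green function; a state becomes
  the pair of \<open>u\<^sub>x\<^sub>x\<close> and \<open>u\<^sub>t\<close>, and each weak problem
  an identity of inner products with an arbitrary \<open>g\<close> in \<open>L\<^sup>2\<close>. What
  remains are integral operators with bounded kernels: Fubini gives their adjoints, and those in x
  commute with those in t. The average K is exponential because it is a resolvent: with J the
  integral from t to T, \<open>J K = K J = J - h K\<close> holds exactly on the bounded interval,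
  without extending anything beyond it. Hence \<open>L = (1 - K) / h\<close> satisfies
  \<open>J L = L J = K\<close>, so averages of solutions are test functions with the required end
  condition, and nonnegativity of J makes K a contraction uniformly in h. Slopes at the ends are
  bounded functionals of \<open>u\<^sub>x\<^sub>x\<close>, but not of u, so the time regularity of u
  reaches them only through the interpolation.\<close>

definition L2 :: "'a measure \<Rightarrow> ('a \<Rightarrow> real) set" where
  "L2 M = {f \<in> borel_measurable M. integrable M (\<lambda>x. (f x)\<^sup>2)}"

definition ip :: "'a measure \<Rightarrow> ('a \<Rightarrow> real) \<Rightarrow> ('a \<Rightarrow> real) \<Rightarrow> real" where
  "ip M f g = (\<integral>x. f x * g x \<partial>M)"

text \<open>A seminorm on functions rather than on classes: norm zero gives vanishing almost
  everywhere only, and representatives are exchanged by \<open>ip_cong_AE\<close>.\<close>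

definition nrm :: "'a measure \<Rightarrow> ('a \<Rightarrow> real) \<Rightarrow> real" where
  "nrm M f = sqrt (ip M f f)"

lemma L2_measurable [measurable_dest]: "f \<in> L2 M \<Longrightarrow> f \<in> borel_measurable M"
  by (simp add: L2_def)

lemma L2_integrable_square: "f \<in> L2 M \<Longrightarrow> integrable M (\<lambda>x. (f x)\<^sup>2)"
  by (simp add: L2_def)

lemma L2_integrable_mult:
  assumes "f \<in> L2 M" "g \<in> L2 M"
  shows "integrable M (\<lambda>x. f x * g x)"
proof (rule Bochner_Integration.integrable_bound)
  show "integrable M (\<lambda>x. (f x)\<^sup>2 + (g x)\<^sup>2)"
    using assms by (simp add: L2_def)
  have "\<bar>a * b\<bar> \<le> a\<^sup>2 + b\<^sup>2" for a b :: real
  proof -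
    have "2 * \<bar>a\<bar> * \<bar>b\<bar> \<le> \<bar>a\<bar>\<^sup>2 + \<bar>b\<bar>\<^sup>2" by (rule sum_squares_bound)
    moreover have "0 \<le> \<bar>a\<bar> * \<bar>b\<bar>" by simp
    ultimately have "\<bar>a\<bar> * \<bar>b\<bar> \<le> \<bar>a\<bar>\<^sup>2 + \<bar>b\<bar>\<^sup>2" by linarith
    then show ?thesis by (simp add: abs_mult)
  qed
  then show "AE x in M. norm (f x * g x) \<le> norm ((f x)\<^sup>2 + (g x)\<^sup>2)"
    by auto
qed (use assms in measurable)

lemma L2_bounded_mult:
  assumes "f \<in> L2 M" and [measurable]: "k \<in> borel_measurable M" and "AE x in M. \<bar>k x\<bar> \<le> C"
  shows "(\<lambda>x. k x * f x) \<in> L2 M"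
  unfolding L2_def
proof (intro CollectI conjI)
  note [measurable] = L2_measurable[OF assms(1)]
  show "(\<lambda>x. k x * f x) \<in> borel_measurable M" by measurable
  show "integrable M (\<lambda>x. (k x * f x)\<^sup>2)"
  proof (rule Bochner_Integration.integrable_bound)
    show "integrable M (\<lambda>x. C\<^sup>2 * (f x)\<^sup>2)"
      using assms(1) by (simp add: L2_def)
    show "AE x in M. norm ((k x * f x)\<^sup>2) \<le> norm (C\<^sup>2 * (f x)\<^sup>2)"
      using assms(3) 
    proof eventually_elim
      case (elim x)
      then have "(k x)\<^sup>2 \<le> C\<^sup>2" by (simp add: abs_le_square_iff[symmetric])
      then show ?case by (simp add: power_mult_distrib mult_right_mono)
    qed
  qed measurable
qed

lemma L2_add:
  assumes "f \<in> L2 M" "g \<in> L2 M"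
  shows "(\<lambda>x. f x + g x) \<in> L2 M"
proof -
  have "integrable M (\<lambda>x. (f x)\<^sup>2 + (g x)\<^sup>2 + 2 * (f x * g x))"
    using assms L2_integrable_mult[OF assms] by (simp add: L2_def)
  then show ?thesis
    using assms by (auto simp: L2_def power2_sum mult.assoc)
qed

lemma L2_cmult: "f \<in> L2 M \<Longrightarrow> (\<lambda>x. c * f x) \<in> L2 M"
  by (rule L2_bounded_mult[where C="\<bar>c\<bar>"]) auto

lemma L2_minus: "f \<in> L2 M \<Longrightarrow> (\<lambda>x. - f x) \<in> L2 M"
  using L2_cmult[of f M "-1"] by simp

lemma L2_diff: "f \<in> L2 M \<Longrightarrow> g \<in> L2 M \<Longrightarrow> (\<lambda>x. f x - g x) \<in> L2 M"
  using L2_add[of f M "\<lambda>x. - g x"] L2_minus[of g M] by simp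

lemma L2_zero: "(\<lambda>x. 0) \<in> L2 M"
  by (simp add: L2_def)

lemma ip_commute: "ip M f g = ip M g f"
  by (simp add: ip_def mult.commute)

lemma ip_add_left:
  "f \<in> L2 M \<Longrightarrow> g \<in> L2 M \<Longrightarrow> h \<in> L2 M \<Longrightarrow> ip M (\<lambda>x. f x + g x) h = ip M f h + ip M g h"
  by (simp add: ip_def distrib_right L2_integrable_mult)

lemma ip_diff_left:
  "f \<in> L2 M \<Longrightarrow> g \<in> L2 M \<Longrightarrow> h \<in> L2 M \<Longrightarrow> ip M (\<lambda>x. f x - g x) h = ip M f h - ip M g h"
  by (simp add: ip_def left_diff_distrib L2_integrable_mult)

lemma ip_add_right:
  "f \<in> L2 M \<Longrightarrow> g \<in> L2 M \<Longrightarrow> h \<in> L2 M \<Longrightarrow> ip M h (\<lambda>x. f x + g x) = ip M h f + ip M h g"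
  by (simp add: ip_def distrib_left L2_integrable_mult)

lemma ip_diff_right:
  "f \<in> L2 M \<Longrightarrow> g \<in> L2 M \<Longrightarrow> h \<in> L2 M \<Longrightarrow> ip M h (\<lambda>x. f x - g x) = ip M h f - ip M h g"
  by (simp add: ip_def right_diff_distrib L2_integrable_mult)

lemma ip_cmult_left: "ip M (\<lambda>x. c * f x) g = c * ip M f g"
  by (simp add: ip_def mult.assoc)

lemma ip_cmult_right: "ip M f (\<lambda>x. c * g x) = c * ip M f g"
  by (simp add: ip_def mult.left_commute)

lemma ip_minus_left: "ip M (\<lambda>x. - f x) g = - ip M f g"
  using ip_cmult_left[of M "-1" f g] by simp

lemma ip_minus_right: "ip M f (\<lambda>x. - g x) = - ip M f g"
  using ip_cmult_right[of M f "-1" g] by simp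

lemma ip_cong_AE:
  assumes "f \<in> borel_measurable M" "f' \<in> borel_measurable M"
    "g \<in> borel_measurable M" "g' \<in> borel_measurable M"
    "AE x in M. f x = f' x" "AE x in M. g x = g' x"
  shows "ip M f g = ip M f' g'"
  unfolding ip_def using assms by (intro integral_cong_AE) auto

lemma ip_self_nonneg [simp]: "0 \<le> ip M f f"
  by (simp add: ip_def)

lemma nrm_nonneg [simp]: "0 \<le> nrm M f"
  by (simp add: nrm_def)

lemma nrm_square: "(nrm M f)\<^sup>2 = ip M f f"
  by (simp add: nrm_def)

text \<open>Nonnegativity of the squared norm of \<open>f - s g\<close> as a quadratic in
  \<open>s\<close>, evaluated at its minimiser; a vanishing leading coefficient is treated
  apart.\<close>

lemma Cauchy_Schwarz_ip:
  assumes f: "f \<in> L2 M" and g: "g \<in> L2 M"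
  shows "\<bar>ip M f g\<bar> \<le> nrm M f * nrm M g"
proof -
  let ?a = "ip M g g" and ?b = "ip M f g" and ?c = "ip M f f"
  have q: "0 \<le> ?c - 2 * s * ?b + s\<^sup>2 * ?a" for s
  proof -
    have sg: "(\<lambda>x. s * g x) \<in> L2 M" using g by (rule L2_cmult)
    have "0 \<le> ip M (\<lambda>x. f x - s * g x) (\<lambda>x. f x - s * g x)" by simp
    also have "\<dots> = ip M f f - 2 * s * ip M f g + s\<^sup>2 * ip M g g"
      using f g sg by (simp add: ip_diff_left ip_diff_right L2_diff ip_cmult_left ip_cmult_right
          ip_commute[of M g f] power2_eq_square algebra_simps)
    finally show ?thesis .
  qed
  have "?b\<^sup>2 \<le> ?c * ?a"
  proof (cases "?a = 0")
    case True
    have "?b = 0"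
    proof (rule ccontr)
      assume "?b \<noteq> 0"
      \<comment> \<open>With \<open>?a = 0\<close> the expression is affine in \<open>s\<close>, and
        at this \<open>s\<close> it equals -1.\<close>
      then show False using q[of "(?c + 1) / (2 * ?b)"] True by (simp add: field_simps)
    qed
    then show ?thesis using True by simp
  next
    case False
    then have a: "0 < ?a" using ip_self_nonneg[of M g] by linarith
    have "0 \<le> (?c - 2 * (?b / ?a) * ?b + (?b / ?a)\<^sup>2 * ?a) * ?a"
      using q[of "?b / ?a"] a by (intro mult_nonneg_nonneg) auto
    also have "\<dots> = ?c * ?a - ?b\<^sup>2"
      using a by (simp add: power2_eq_square field_simps)
    finally show ?thesis by simp
  qed
  then have "\<bar>?b\<bar> \<le> sqrt (?c * ?a)"
    using real_le_rsqrt[of "\<bar>?b\<bar>" "?c * ?a"] by simp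
  then show ?thesis by (simp add: nrm_def real_sqrt_mult)
qed

lemma nrm_triangle:
  assumes "f \<in> L2 M" "g \<in> L2 M"
  shows "nrm M (\<lambda>x. f x + g x) \<le> nrm M f + nrm M g"
proof -
  have "(nrm M (\<lambda>x. f x + g x))\<^sup>2 \<le> (nrm M f + nrm M g)\<^sup>2"
    using assms Cauchy_Schwarz_ip[OF assms]
    by (simp add: nrm_square power2_sum ip_add_left ip_add_right L2_add ip_commute[of M g f])
  then show ?thesis by (rule power2_le_imp_le) simp
qed

lemma nrm_cmult: "nrm M (\<lambda>x. c * f x) = \<bar>c\<bar> * nrm M f"
proof -
  have "ip M (\<lambda>x. c * f x) (\<lambda>x. c * f x) = c\<^sup>2 * ip M f f"
    by (simp add: ip_cmult_left ip_cmult_right power2_eq_square)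
  then show ?thesis by (simp add: nrm_def real_sqrt_mult)
qed

lemma nrm_eq_0_AE:
  assumes "f \<in> L2 M" "nrm M f = 0"
  shows "AE x in M. f x = 0"
proof -
  have "(\<integral>x. (f x)\<^sup>2 \<partial>M) = 0"
    using assms(2) by (simp add: nrm_def ip_def power2_eq_square)
  then have "AE x in M. (f x)\<^sup>2 = 0"
    using integral_nonneg_eq_0_iff_AE[OF L2_integrable_square[OF assms(1)]] by simp
  then show ?thesis by simp
qed

lemma (in finite_measure) L2_const: "(\<lambda>x. c) \<in> L2 M"
  by (simp add: L2_def)

lemma (in finite_measure) L2_bounded:
  "k \<in> borel_measurable M \<Longrightarrow> AE x in M. \<bar>k x\<bar> \<le> C \<Longrightarrow> k \<in> L2 M"
  using L2_bounded_mult[OF L2_const[of 1], of k C] by simp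

lemma (in finite_measure) L2_integrable:
  "f \<in> L2 M \<Longrightarrow> integrable M f"
  using L2_integrable_mult[OF _ L2_const[of 1], of f] by simp

lemma (in finite_measure) integrable_mult_bounded:
  fixes f k :: "'a \<Rightarrow> real"
  assumes "integrable M f" "k \<in> borel_measurable M" "\<And>x. x \<in> space M \<Longrightarrow> \<bar>k x\<bar> \<le> C"
  shows "integrable M (\<lambda>x. k x * f x)"
proof (rule Bochner_Integration.integrable_bound)
  show "integrable M (\<lambda>x. C * f x)" using assms(1) by simp
  show "AE x in M. norm (k x * f x) \<le> norm (C * f x)"
    using assms(3) by (intro AE_I2) (force simp: abs_mult intro: mult_right_mono)
qed (use assms in measurable)

section \<open>Integral operators with bounded kernels\<close>

lemma integrable_pair_mult:
  fixes f :: "'a \<Rightarrow> real" and g :: "'b \<Rightarrow> real"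
  assumes "sigma_finite_measure M" "sigma_finite_measure N" "integrable M f" "integrable N g"
  shows "integrable (M \<Otimes>\<^sub>M N) (\<lambda>(x, y). f x * g y)"
proof -
  interpret M: sigma_finite_measure M by fact
  interpret N: sigma_finite_measure N by fact
  interpret pair_sigma_finite M N ..
  note [measurable] = borel_measurable_integrable[OF assms(3)] borel_measurable_integrable[OF assms(4)]
  show ?thesis
  proof (rule Fubini_integrable)
    show "(\<lambda>(x, y). f x * g y) \<in> borel_measurable (M \<Otimes>\<^sub>M N)" by measurable
    show "integrable M (\<lambda>x. \<integral>y. norm (case (x, y) of (x, y) \<Rightarrow> f x * g y) \<partial>N)"
      using assms by (simp add: abs_mult)
    show "AE x in M. integrable N (\<lambda>y. case (x, y) of (x, y) \<Rightarrow> f x * g y)"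
      using assms by simp
  qed
qed

definition kop :: "'b measure \<Rightarrow> ('a \<Rightarrow> 'b \<Rightarrow> real) \<Rightarrow> ('b \<Rightarrow> real) \<Rightarrow> 'a \<Rightarrow> real" where
  "kop M k f x = (\<integral>y. k x y * f y \<partial>M)"

text \<open>The bound holds at every point rather than almost everywhere, so each single kernel
  section is bounded and operator values at individual points can be estimated.\<close>

definition bker :: "'a measure \<Rightarrow> 'b measure \<Rightarrow> ('a \<Rightarrow> 'b \<Rightarrow> real) \<Rightarrow> real \<Rightarrow> bool" where
  "bker N M k C \<longleftrightarrow> case_prod k \<in> borel_measurable (N \<Otimes>\<^sub>M M) \<and>
     (\<forall>x\<in>space N. \<forall>y\<in>space M. \<bar>k x y\<bar> \<le> C)"

definition kcomp :: "'b measure \<Rightarrow> ('a \<Rightarrow> 'b \<Rightarrow> real) \<Rightarrow> ('b \<Rightarrow> 'c \<Rightarrow> real) \<Rightarrow> 'a \<Rightarrow> 'c \<Rightarrow> real" where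
  "kcomp M k m x z = (\<integral>y. k x y * m y z \<partial>M)"

lemma bker_measurable [measurable_dest]:
  "bker N M k C \<Longrightarrow> case_prod k \<in> borel_measurable (N \<Otimes>\<^sub>M M)"
  by (simp add: bker_def)

lemma bker_bound: "bker N M k C \<Longrightarrow> x \<in> space N \<Longrightarrow> y \<in> space M \<Longrightarrow> \<bar>k x y\<bar> \<le> C"
  by (simp add: bker_def)

lemma bker_section:
  "bker N M k C \<Longrightarrow> x \<in> space N \<Longrightarrow> k x \<in> borel_measurable M"
  using measurable_compose[OF measurable_Pair1'[of x N M] bker_measurable[of N M k C]] by simp

lemma bker_transpose: "bker N M k C \<Longrightarrow> bker M N (\<lambda>y x. k x y) C"
  unfolding bker_def by (subst measurable_pair_swap_iff) (auto simp: split_beta')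

lemma kop_cmult: "kop M k (\<lambda>y. c * f y) x = c * kop M k f x"
  by (simp add: kop_def mult.left_commute)

lemma kop_cong_AE:
  assumes "AE y in M. f y = g y" "f \<in> borel_measurable M" "g \<in> borel_measurable M"
    "k x \<in> borel_measurable M"
  shows "kop M k f x = kop M k g x"
  unfolding kop_def using assms by (intro integral_cong_AE) auto

lemma kop_measurable:
  assumes "sigma_finite_measure M" and [measurable]: "case_prod k \<in> borel_measurable (N \<Otimes>\<^sub>M M)"
    "f \<in> borel_measurable M"
  shows "kop M k f \<in> borel_measurable N"
proof -
  interpret sigma_finite_measure M by fact
  show ?thesis unfolding kop_def by measurable
qed

context finite_measure
begin

lemma kop_integrable:
  assumes "bker N M k C" "x \<in> space N" "integrable M f"
  shows "integrable M (\<lambda>y. k x y * f y)"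
  using bker_section[OF assms(1,2)] bker_bound[OF assms(1,2)] assms(3)
  by (intro integrable_mult_bounded[where C=C]) auto

lemma kop_add:
  assumes "bker N M k C" "x \<in> space N" "integrable M f" "integrable M g"
  shows "kop M k (\<lambda>y. f y + g y) x = kop M k f x + kop M k g x"
  using kop_integrable[OF assms(1-3)] kop_integrable[OF assms(1,2,4)]
  by (simp add: kop_def distrib_left)

lemma kop_diff:
  assumes "bker N M k C" "x \<in> space N" "integrable M f" "integrable M g"
  shows "kop M k (\<lambda>y. f y - g y) x = kop M k f x - kop M k g x"
  using kop_integrable[OF assms(1-3)] kop_integrable[OF assms(1,2,4)]
  by (simp add: kop_def right_diff_distrib)

lemma kop_diff_kernel:
  assumes "bker N M k C" "bker N M m D" "x \<in> space N" "integrable M f"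
  shows "kop M (\<lambda>x y. k x y - c * m x y) f x = kop M k f x - c * kop M m f x"
  using kop_integrable[OF assms(1,3,4)] kop_integrable[OF assms(2,3,4)]
  by (simp add: kop_def left_diff_distrib mult.assoc)

lemma bker_L2:
  assumes "bker N M k C" "x \<in> space N"
  shows "k x \<in> L2 M"
  using bker_section[OF assms] bker_bound[OF assms] by (intro L2_bounded[where C=C] AE_I2) auto

text \<open>Cauchy-Schwarz on the kernel section, whose squared norm is at most
  \<open>C\<^sup>2\<close> times the total mass.\<close>

lemma kop_square_le:
  assumes k: "bker N M k C" "x \<in> space N" and f: "f \<in> L2 M"
  shows "(kop M k f x)\<^sup>2 \<le> C\<^sup>2 * measure M (space M) * (\<integral>y. (f y)\<^sup>2 \<partial>M)"
proof -
  have kx: "k x \<in> L2 M" using bker_L2[OF k] .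
  have "(kop M k f x)\<^sup>2 \<le> (nrm M (k x) * nrm M f)\<^sup>2"
    using Cauchy_Schwarz_ip[OF kx f] by (intro abs_le_square_iff[THEN iffD1]) (simp add: kop_def ip_def)
  also have "\<dots> = ip M (k x) (k x) * ip M f f"
    by (simp add: power_mult_distrib nrm_square)
  also have "\<dots> \<le> (C\<^sup>2 * measure M (space M)) * ip M f f"
  proof (rule mult_right_mono)
    have "ip M (k x) (k x) \<le> (\<integral>y. C\<^sup>2 \<partial>M)"
      unfolding ip_def
    proof (rule integral_mono)
      show "integrable M (\<lambda>y. k x y * k x y)" using L2_integrable_mult[OF kx kx] .
      fix y assume "y \<in> space M"
      then have "\<bar>k x y\<bar> \<le> C" using bker_bound[OF k] by simp
      then show "k x y * k x y \<le> C\<^sup>2"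
        by (metis abs_le_square_iff abs_of_nonneg abs_ge_zero order_trans power2_eq_square)
    qed simp
    then show "ip M (k x) (k x) \<le> C\<^sup>2 * measure M (space M)" by (simp add: mult.commute)
  qed simp
  finally show ?thesis by (simp add: ip_def power2_eq_square)
qed

lemma kop_L2:
  assumes "finite_measure N" and k: "bker N M k C" and f: "f \<in> L2 M"
  shows "kop M k f \<in> L2 N"
proof -
  interpret N: finite_measure N by fact
  have m: "kop M k f \<in> borel_measurable N"
    by (intro kop_measurable bker_measurable[OF k] L2_measurable[OF f] sigma_finite_measure_axioms)
  have "integrable N (\<lambda>x. (kop M k f x)\<^sup>2)"
    using kop_square_le[OF k _ f] m
    by (intro N.integrable_const_bound[where B="C\<^sup>2 * measure M (space M) * (\<integral>y. (f y)\<^sup>2 \<partial>M)"] AE_I2) auto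
  with m show ?thesis by (simp add: L2_def)
qed

end

text \<open>Fubini for \<open>k x y * g x * f y\<close>, integrable because \<open>k\<close> is
  bounded. Adjoints, compositions of operators and integration by parts are all obtained as
  instances.\<close>

lemma kernel_swap:
  fixes f :: "'a \<Rightarrow> real" and g :: "'b \<Rightarrow> real"
  assumes "finite_measure N" "finite_measure M" and k: "bker N M k C"
    and f: "integrable M f" and g: "integrable N g"
  shows "(\<integral>x. kop M k f x * g x \<partial>N) = (\<integral>y. f y * kop N (\<lambda>y x. k x y) g y \<partial>M)"
proof -
  interpret N: finite_measure N by fact
  interpret M: finite_measure M by fact
  interpret P: pair_sigma_finite N M ..
  interpret P: finite_measure "N \<Otimes>\<^sub>M M"
    by (intro finite_measure_pair_measure N.finite_measure_axioms M.finite_measure_axioms)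
  note [measurable] = bker_measurable[OF k]
  have "integrable (N \<Otimes>\<^sub>M M) (\<lambda>(x, y). g x * f y)"
    by (intro integrable_pair_mult f g N.sigma_finite_measure_axioms M.sigma_finite_measure_axioms)
  then have "integrable (N \<Otimes>\<^sub>M M) (\<lambda>p. (case_prod k) p * (case p of (x, y) \<Rightarrow> g x * f y))"
    using bker_bound[OF k]
    by (intro P.integrable_mult_bounded[where C=C]) (auto simp: space_pair_measure)
  then have "(\<integral>y. \<integral>x. k x y * (g x * f y) \<partial>N \<partial>M) = (\<integral>x. \<integral>y. k x y * (g x * f y) \<partial>M \<partial>N)"
    by (intro P.Fubini_integral) (simp add: split_beta')
  moreover have "(\<integral>y. k x y * (g x * f y) \<partial>M) = kop M k f x * g x" for x
    unfolding kop_def by (subst integral_mult_left_zero[symmetric]) (simp add: mult_ac)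
  moreover have "(\<integral>x. k x y * (g x * f y) \<partial>N) = f y * kop N (\<lambda>y x. k x y) g y" for y
    unfolding kop_def by (subst integral_mult_right_zero[symmetric]) (simp add: mult_ac)
  ultimately show ?thesis by simp
qed

text \<open>The outer kernel section plays the part of \<open>g\<close> in
  \<open>kernel_swap\<close>, so integrability of this one section suffices.\<close>

lemma kop_kop:
  assumes "finite_measure N" "finite_measure M" and k: "integrable N (k x)"
    and m: "bker N M m D" and f: "integrable M f"
  shows "kop N k (kop M m f) x = kop M (kcomp N k m) f x"
  using kernel_swap[OF assms(1,2) m f k] by (simp add: kop_def kcomp_def mult.commute)

section \<open>Operators acting in one variable of a product space\<close>

definition tk :: "'b measure \<Rightarrow> ('b \<Rightarrow> 'b \<Rightarrow> real) \<Rightarrow> ('a \<times> 'b \<Rightarrow> real) \<Rightarrow> 'a \<times> 'b \<Rightarrow> real" where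
  "tk B m f = (\<lambda>(x, t). kop B m (\<lambda>s. f (x, s)) t)"

definition sk :: "'a measure \<Rightarrow> ('a \<Rightarrow> 'a \<Rightarrow> real) \<Rightarrow> ('a \<times> 'b \<Rightarrow> real) \<Rightarrow> 'a \<times> 'b \<Rightarrow> real" where
  "sk A k f = (\<lambda>(x, t). kop A k (\<lambda>y. f (y, t)) x)"

lemma sk_swap: "sk A k f (x, t) = tk A k (\<lambda>(t, x). f (x, t)) (t, x)"
  by (simp add: sk_def tk_def)

text \<open>Symmetric in the two factors: interpreting it with the factors exchanged transfers facts
  about operators in the second variable to the first.\<close>

locale finite_pair = A: finite_measure A + B: finite_measure B
  for A :: "'a measure" and B :: "'b measure"
begin

abbreviation PM where "PM \<equiv> A \<Otimes>\<^sub>M B"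

sublocale P: finite_measure "PM"
  by (intro finite_measure_pair_measure A.finite_measure_axioms B.finite_measure_axioms)

sublocale AB: pair_sigma_finite A B ..

lemma L2_pair_mult:
  assumes "f \<in> L2 A" "g \<in> L2 B"
  shows "(\<lambda>(x, t). f x * g t) \<in> L2 PM"
proof -
  note [measurable] = L2_measurable[OF assms(1)] L2_measurable[OF assms(2)]
  have "integrable PM (\<lambda>(x, t). (f x)\<^sup>2 * (g t)\<^sup>2)"
    by (intro integrable_pair_mult L2_integrable_square assms A.sigma_finite_measure_axioms
        B.sigma_finite_measure_axioms)
  then show ?thesis by (simp add: L2_def split_beta' power_mult_distrib)
qed

lemma L2_swap:
  assumes "f \<in> L2 PM"
  shows "(\<lambda>(t, x). f (x, t)) \<in> L2 (B \<Otimes>\<^sub>M A)"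
  using assms AB.integrable_product_swap[OF L2_integrable_square[OF assms]]
  by (auto simp: L2_def split_beta')

lemma AE_section:
  assumes "f \<in> L2 PM"
  shows "AE x in A. (\<lambda>t. f (x, t)) \<in> L2 B"
proof -
  note [measurable] = L2_measurable[OF assms]
  have "AE x in A. integrable B (\<lambda>t. (f (x, t))\<^sup>2)"
    using AB.AE_integrable_fst'[OF L2_integrable_square[OF assms]] .
  then show ?thesis
    by (rule AE_mp) (auto simp: L2_def intro!: AE_I2)
qed

lemma AE_pair_fst:
  assumes "AE p in PM. Q p"
  shows "AE x in A. AE t in B. Q (x, t)"
  using AB.AE_pair[OF assms] .

text \<open>The exceptional set lies in a null strip \<open>N \<times> space B\<close>. Asking for
  all \<open>t\<close> instead of almost all makes this work for a \<open>Q\<close> of which no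
  measurability is known.\<close>

lemma AE_fst_pair:
  assumes "AE x in A. \<forall>t\<in>space B. Q (x, t)" 
  shows "AE p in PM. Q p"
proof -
  obtain N where N: "N \<in> null_sets A" "{x \<in> space A. \<not> (\<forall>t\<in>space B. Q (x, t))} \<subseteq> N"
    using assms by (auto simp: eventually_ae_filter)
  have "N \<times> space B \<in> null_sets PM"
    using N(1) by (auto simp: null_sets_def B.emeasure_pair_measure_Times)
  moreover have "{p \<in> space PM. \<not> Q p} \<subseteq> N \<times> space B"
    using N(2) by (auto simp: space_pair_measure)
  ultimately show ?thesis by (rule AE_I'[of _ _ _])
qed

lemma tk_measurable:
  assumes [measurable]: "case_prod m \<in> borel_measurable (B \<Otimes>\<^sub>M B)" "f \<in> borel_measurable PM"
  shows "tk B m f \<in> borel_measurable PM"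
  unfolding tk_def kop_def by measurable

text \<open>\<open>kop_square_le\<close> bounds the square at \<open>(x, t)\<close> by a quantity
  independent of \<open>t\<close>; integrating over \<open>t\<close> adds a second factor of the
  mass of \<open>B\<close>, whence the operator norm \<open>C\<close> times that mass.\<close>

lemma tk_L2_nrm:
  assumes m: "bker B B m C" and f: "f \<in> L2 PM" and "0 \<le> C"
  shows "tk B m f \<in> L2 PM"
    and "nrm PM (tk B m f) \<le> C * measure B (space B) * nrm PM f"
proof -
  note [measurable] = L2_measurable[OF f] tk_measurable[OF bker_measurable[OF m] L2_measurable[OF f]]
  let ?b = "measure B (space B)"
  let ?q = "\<lambda>x. \<integral>s. (f (x, s))\<^sup>2 \<partial>B"
  have q: "integrable A ?q" "(\<integral>x. ?q x \<partial>A) = ip PM f f"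
    using AB.integrable_fst'[OF L2_integrable_square[OF f]]
      AB.integral_fst'[OF L2_integrable_square[OF f]]
    by (auto simp: ip_def power2_eq_square)
  have q2: "integrable PM (\<lambda>(x, t). (C\<^sup>2 * ?b * ?q x) * 1)"
    by (intro integrable_pair_mult A.sigma_finite_measure_axioms B.sigma_finite_measure_axioms
        integrable_mult_right q) simp
  have le: "AE p in PM. (tk B m f p)\<^sup>2 \<le> C\<^sup>2 * ?b * ?q (fst p)"
    by (rule AE_fst_pair, use AE_section[OF f] in eventually_elim)
       (use B.kop_square_le[OF m] in \<open>auto simp: tk_def\<close>)
  have i: "integrable PM (\<lambda>p. (tk B m f p)\<^sup>2)"
  proof (rule Bochner_Integration.integrable_bound)
    show "integrable PM (\<lambda>p. C\<^sup>2 * ?b * ?q (fst p))"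
      using q2 by (simp add: split_beta')
    show "AE p in PM. norm ((tk B m f p)\<^sup>2) \<le> norm (C\<^sup>2 * ?b * ?q (fst p))"
      using le by eventually_elim simp
  qed measurable
  then show "tk B m f \<in> L2 PM" by (simp add: L2_def)
  have "ip PM (tk B m f) (tk B m f) \<le> (\<integral>p. C\<^sup>2 * ?b * ?q (fst p) \<partial>PM)"
    unfolding ip_def power2_eq_square[symmetric] using i q2 le
    by (intro integral_mono_AE) (auto simp: split_beta')
  also have "\<dots> = (\<integral>x. \<integral>t. C\<^sup>2 * ?b * ?q x \<partial>B \<partial>A)"
    using AB.integral_fst'[of "\<lambda>p. C\<^sup>2 * ?b * ?q (fst p)"] q2 by (auto simp: split_beta')
  also have "\<dots> = (C * ?b)\<^sup>2 * ip PM f f"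
    using q(2) by (simp add: power_mult_distrib power2_eq_square mult_ac)
  finally have "(nrm PM (tk B m f))\<^sup>2 \<le> (C * ?b * nrm PM f)\<^sup>2"
    by (simp add: nrm_square power_mult_distrib)
  then show "nrm PM (tk B m f) \<le> C * ?b * nrm PM f"
    by (rule power2_le_imp_le) (simp add: assms)
qed

lemma tk_lift:
  assumes f: "f \<in> L2 PM"
    and "\<And>x t. x \<in> space A \<Longrightarrow> t \<in> space B \<Longrightarrow> (\<lambda>s. f (x, s)) \<in> L2 B \<Longrightarrow> Q (x, t)"
  shows "AE p in PM. Q p"
  by (rule AE_fst_pair, use AE_section[OF f] AE_space[of A] in eventually_elim)
     (use assms(2) in auto)

lemma tk_add:
  assumes m: "bker B B m C" and f: "f \<in> L2 PM" and g: "g \<in> L2 PM"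
  shows "AE p in PM. tk B m (\<lambda>p. f p + g p) p = tk B m f p + tk B m g p"
proof (rule AE_fst_pair, use AE_section[OF f] AE_section[OF g] in eventually_elim)
  case (elim x)
  then show ?case using B.kop_add[OF m] by (auto simp: tk_def B.L2_integrable)
qed

lemma tk_diff:
  assumes m: "bker B B m C" and f: "f \<in> L2 PM" and g: "g \<in> L2 PM"
  shows "AE p in PM. tk B m (\<lambda>p. f p - g p) p = tk B m f p - tk B m g p"
proof (rule AE_fst_pair, use AE_section[OF f] AE_section[OF g] in eventually_elim)
  case (elim x)
  then show ?case using B.kop_diff[OF m] by (auto simp: tk_def B.L2_integrable)
qed

lemma tk_cmult: "tk B m (\<lambda>p. c * f p) p = c * tk B m f p"
  by (cases p) (simp add: tk_def kop_cmult)

lemma tk_minus: "tk B m (\<lambda>p. - f p) p = - tk B m f p"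
  using tk_cmult[of m "-1" f p] by simp

lemma tk_cong_AE:
  assumes m: "bker B B m C" and [measurable]: "f \<in> borel_measurable PM" "g \<in> borel_measurable PM"
    and "AE p in PM. f p = g p"
  shows "AE p in PM. tk B m f p = tk B m g p"
proof (rule AE_fst_pair, use AE_pair_fst[OF assms(4)] AE_space[of A] in eventually_elim)
  case (elim x)
  then show ?case
    using bker_section[OF m] by (auto simp: tk_def intro!: kop_cong_AE)
qed

lemma tk_comp:
  assumes m: "bker B B m C" and k: "bker B B k D" and f: "f \<in> L2 PM"
  shows "AE p in PM. tk B m (tk B k f) p = tk B (kcomp B m k) f p"
proof (rule tk_lift[OF f])
  fix x t assume "t \<in> space B" "(\<lambda>s. f (x, s)) \<in> L2 B"
  then have "kop B m (kop B k (\<lambda>s. f (x, s))) t = kop B (kcomp B m k) (\<lambda>s. f (x, s)) t"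
    by (intro kop_kop[OF B.finite_measure_axioms B.finite_measure_axioms _ k] B.L2_integrable B.bker_L2[OF m])
  then show "tk B m (tk B k f) (x, t) = tk B (kcomp B m k) f (x, t)" by (simp add: tk_def)
qed

lemma tk_kernel_cong:
  assumes "\<And>t s. t \<in> space B \<Longrightarrow> s \<in> space B \<Longrightarrow> m t s = k t s" "p \<in> space PM"
  shows "tk B m f p = tk B k f p"
  using assms by (auto simp: tk_def kop_def space_pair_measure intro!: Bochner_Integration.integral_cong)

lemma tk_diff_kernel:
  assumes m: "bker B B m C" and k: "bker B B k D" and f: "f \<in> L2 PM"
  shows "AE p in PM. tk B (\<lambda>t s. m t s - c * k t s) f p = tk B m f p - c * tk B k f p"
  using B.kop_diff_kernel[OF m k] by (intro tk_lift[OF f]) (auto simp: tk_def B.L2_integrable)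

lemma ip_fst:
  assumes "f \<in> L2 PM" "g \<in> L2 PM"
  shows "ip PM f g = (\<integral>x. ip B (\<lambda>t. f (x, t)) (\<lambda>t. g (x, t)) \<partial>A)"
  unfolding ip_def using AB.integral_fst'[OF L2_integrable_mult[OF assms]] by simp

lemma ip_snd:
  assumes "f \<in> L2 PM" "g \<in> L2 PM"
  shows "ip PM f g = (\<integral>t. ip A (\<lambda>x. f (x, t)) (\<lambda>x. g (x, t)) \<partial>B)"
  unfolding ip_def using AB.integral_snd[of "\<lambda>x t. f (x, t) * g (x, t)"] L2_integrable_mult[OF assms]
  by (simp add: split_beta')

lemma ip_swap: "ip (B \<Otimes>\<^sub>M A) (\<lambda>(t, x). f (x, t)) (\<lambda>(t, x). g (x, t)) = ip PM f g"
  if "f \<in> L2 PM" "g \<in> L2 PM"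
  unfolding ip_def using AB.integral_product_swap[of "\<lambda>p. f p * g p"]
    borel_measurable_integrable[OF L2_integrable_mult[OF that]] by (simp add: split_beta')

lemma tk_adjoint:
  assumes m: "bker B B m C" and f: "f \<in> L2 PM" and g: "g \<in> L2 PM" and "0 \<le> C"
  shows "ip PM (tk B m f) g = ip PM f (tk B (\<lambda>s t. m t s) g)"
proof -
  note mf = tk_L2_nrm(1)[OF m f \<open>0 \<le> C\<close>]
  note mg = tk_L2_nrm(1)[OF bker_transpose[OF m] g \<open>0 \<le> C\<close>]
  show ?thesis
    unfolding ip_fst[OF mf g] ip_fst[OF f mg]
  proof (rule integral_cong_AE)
    note [measurable] = L2_measurable[OF f] L2_measurable[OF g] L2_measurable[OF mf] L2_measurable[OF mg]
    show "(\<lambda>x. ip B (\<lambda>t. tk B m f (x, t)) (\<lambda>t. g (x, t))) \<in> borel_measurable A"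
      "(\<lambda>x. ip B (\<lambda>t. f (x, t)) (\<lambda>t. tk B (\<lambda>s t. m t s) g (x, t))) \<in> borel_measurable A"
      unfolding ip_def by measurable
    show "AE x in A. ip B (\<lambda>t. tk B m f (x, t)) (\<lambda>t. g (x, t)) =
        ip B (\<lambda>t. f (x, t)) (\<lambda>t. tk B (\<lambda>s t. m t s) g (x, t))"
      using AE_section[OF f] AE_section[OF g]
    proof eventually_elim
      case (elim x)
      then show ?case
        using kernel_swap[OF B.finite_measure_axioms B.finite_measure_axioms m, of "\<lambda>t. f (x, t)" "\<lambda>t. g (x, t)"]
        by (simp add: ip_def tk_def B.L2_integrable)
    qed
  qed
qed

lemma sk_cmult: "sk A k (\<lambda>p. c * f p) p = c * sk A k f p"
  by (cases p) (simp add: sk_def kop_cmult)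

lemma sk_minus: "sk A k (\<lambda>p. - f p) p = - sk A k f p"
  using sk_cmult[of k "-1" f p] by simp

text \<open>Fubini for the product kernel \<open>k x y * m t s\<close> against \<open>f\<close>. As
  \<open>f\<close> is integrable over the whole product, equality holds at every point and not
  merely almost everywhere.\<close>

lemma tk_sk_commute:
  assumes m: "bker B B m C" and k: "bker A A k D" and f: "f \<in> L2 PM"
    and p: "p \<in> space PM"
  shows "tk B m (sk A k f) p = sk A k (tk B m f) p"
proof -
  obtain x t where xt: "p = (x, t)" "x \<in> space A" "t \<in> space B"
    using p by (auto simp: space_pair_measure)
  note [measurable] = bker_section[OF m xt(3)] bker_section[OF k xt(2)]
  have b: "\<bar>k x y * m t s\<bar> \<le> D * C" if "y \<in> space A" "s \<in> space B" for y s
    unfolding abs_mult using bker_bound[OF k xt(2) that(1)] bker_bound[OF m xt(3) that(2)]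
    by (intro mult_mono) auto
  have "integrable PM (\<lambda>q. (k x (fst q) * m t (snd q)) * f q)"
    using b by (intro P.integrable_mult_bounded[where C="D * C"] P.L2_integrable f)
      (auto simp: space_pair_measure)
  then have "(\<integral>s. \<integral>y. k x y * m t s * f (y, s) \<partial>A \<partial>B) = (\<integral>y. \<integral>s. k x y * m t s * f (y, s) \<partial>B \<partial>A)"
    by (intro AB.Fubini_integral) (simp add: split_beta')
  moreover have "(\<integral>y. k x y * m t s * f (y, s) \<partial>A) = m t s * (\<integral>y. k x y * f (y, s) \<partial>A)" for s
    by (subst integral_mult_right_zero[symmetric]) (simp add: mult_ac)
  moreover have "(\<integral>s. k x y * m t s * f (y, s) \<partial>B) = k x y * (\<integral>s. m t s * f (y, s) \<partial>B)" for y
    by (subst integral_mult_right_zero[symmetric]) (simp add: mult_ac)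
  ultimately show ?thesis by (simp add: xt tk_def sk_def kop_def)
qed

end

context finite_pair
begin

lemma AE_swap:
  assumes "AE p in B \<Otimes>\<^sub>M A. Q p"
  shows "AE p in PM. Q (snd p, fst p)"
proof -
  interpret BA: pair_sigma_finite B A ..
  have "AE p in distr PM (B \<Otimes>\<^sub>M A) (\<lambda>(x, y). (y, x)). Q p"
    by (subst BA.distr_pair_swap[symmetric]) (rule assms)
  then show ?thesis
    by (drule_tac AE_distrD[rotated]) (auto simp: split_beta')
qed

interpretation sw: finite_pair B A ..

lemma AE_section':
  assumes "f \<in> L2 PM"
  shows "AE t in B. (\<lambda>x. f (x, t)) \<in> L2 A"
  using sw.AE_section[OF L2_swap[OF assms]] by simp

lemma AE_pair_snd:
  assumes "AE p in PM. Q p"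
  shows "AE t in B. AE x in A. Q (x, t)"
  using sw.AE_pair_fst[OF sw.AE_swap[OF assms]] by simp

lemma sk_eq: "sk A k f = (\<lambda>(x, t). tk A k (\<lambda>(t, x). f (x, t)) (t, x))"
  by (simp add: sk_swap fun_eq_iff)

lemma sk_L2_nrm:
  assumes m: "bker A A m C" and f: "f \<in> L2 PM" and "0 \<le> C"
  shows "sk A m f \<in> L2 PM"
    and "nrm PM (sk A m f) \<le> C * measure A (space A) * nrm PM f"
proof -
  note L = L2_swap[OF f]
  note T = sw.tk_L2_nrm[OF m L \<open>0 \<le> C\<close>]
  show "sk A m f \<in> L2 PM"
    using sw.L2_swap[OF T(1)] by (simp add: sk_eq)
  show "nrm PM (sk A m f) \<le> C * measure A (space A) * nrm PM f"
    using T(2) ip_swap[OF f f] sw.ip_swap[OF T(1) T(1)] by (simp add: nrm_def sk_eq)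
qed

lemma sk_diff:
  assumes m: "bker A A m C" and f: "f \<in> L2 PM" and g: "g \<in> L2 PM"
  shows "AE p in PM. sk A m (\<lambda>p. f p - g p) p = sk A m f p - sk A m g p"
  using AE_swap[OF sw.tk_diff[OF m L2_swap[OF f] L2_swap[OF g]]]
  by (simp add: sk_eq split_beta')

end

section \<open>Primitives and weak derivatives on an interval\<close>

abbreviation iv :: "real \<Rightarrow> real \<Rightarrow> real measure" where
  "iv a b \<equiv> restrict_space lborel {a<..<b}"

lemma finite_measure_iv: "finite_measure (iv a b)"
  by (rule finite_measureI) (cases "a \<le> b"; simp add: emeasure_restrict_space)

lemma measure_iv: "a \<le> b \<Longrightarrow> measure (iv a b) (space (iv a b)) = b - a"
  by (simp add: measure_restrict_space)

lemma AE_iv: "(AE x in iv a b. Q x) \<longleftrightarrow> (AE x\<in>{a<..<b} in lborel. Q x)"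
  by (rule AE_restrict_space_iff) simp

lemma AE_iv_neq: "AE x in iv a b. x \<noteq> c"
  unfolding AE_iv using AE_lborel_singleton[of c] by eventually_elim simp

lemma integral_iv: "(\<integral>x. f x \<partial>iv a b) = (LINT x:{a<..<b}|lborel. f x)" for f :: "real \<Rightarrow> real"
  by (simp add: integral_restrict_space set_lebesgue_integral_def)

lemma borel_measurable_iv: "f \<in> borel_measurable borel \<Longrightarrow> f \<in> borel_measurable (iv a b)"
  by (simp add: measurable_restrict_space1)

lemma id_measurable_iv: "(\<lambda>x. x) \<in> borel_measurable (iv a b)"
  by (rule borel_measurable_iv) simp

lemma L2_on_eq_L2:
  assumes "S \<in> sets borel"
  shows "L2_on S = L2 (restrict_space lborel S)"
proof -
  have S: "S \<inter> space lborel \<in> sets lborel" using assms by simp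
  show ?thesis
    unfolding L2_on_def L2_def set_borel_measurable_def set_integrable_def
      borel_measurable_restrict_space_iff[OF S] integrable_restrict_space[OF S] by simp
qed

lemma L2_inner_eq_ip:
  assumes "S \<in> sets borel"
  shows "L2_inner S = ip (restrict_space lborel S)"
  using assms by (simp add: L2_inner_def ip_def fun_eq_iff set_lebesgue_integral_def integral_restrict_space)

lemma L2_norm_eq_nrm:
  assumes "S \<in> sets borel"
  shows "L2_norm S = nrm (restrict_space lborel S)"
  by (simp add: L2_norm_def nrm_def fun_eq_iff L2_inner_eq_ip[OF assms])

lemmas L2_iv = L2_on_eq_L2[of "{a<..<b}" for a b :: real, simplified]

text \<open>Identifies the plane measure on the cylinder with a product of interval measures, which
  makes \<open>finite_pair\<close> applicable. The sigma-algebras are compared by showing the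
  identity map measurable in both directions.\<close>

lemma restrict_space_pair:
  assumes "sigma_finite_measure M" "sigma_finite_measure N" and [measurable]: "S \<in> sets M" "R \<in> sets N"
  shows "restrict_space M S \<Otimes>\<^sub>M restrict_space N R = restrict_space (M \<Otimes>\<^sub>M N) (S \<times> R)"
proof (rule pair_measure_eqI)
  interpret M: sigma_finite_measure M by fact
  interpret N: sigma_finite_measure N by fact
  show "sigma_finite_measure (restrict_space M S)" "sigma_finite_measure (restrict_space N R)"
    using assms by (auto intro!: sigma_finite_measure_restrict_space)
  have SR [simp]: "S \<times> R \<in> sets (M \<Otimes>\<^sub>M N)" by simp
  have sp: "space (restrict_space M S \<Otimes>\<^sub>M restrict_space N R) = S \<times> R"
    using sets.sets_into_space[OF assms(3)] sets.sets_into_space[OF assms(4)]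
    by (auto simp: space_pair_measure space_restrict_space)
  have 1: "(\<lambda>x. x) \<in> restrict_space M S \<Otimes>\<^sub>M restrict_space N R \<rightarrow>\<^sub>M restrict_space (M \<Otimes>\<^sub>M N) (S \<times> R)"
  proof (rule measurable_restrict_space2)
    show "(\<lambda>x. x) \<in> space (restrict_space M S \<Otimes>\<^sub>M restrict_space N R) \<rightarrow> S \<times> R"
      using sp by auto
    have "(\<lambda>p. (fst p, snd p)) \<in> restrict_space M S \<Otimes>\<^sub>M restrict_space N R \<rightarrow>\<^sub>M M \<Otimes>\<^sub>M N"
      by (intro measurable_Pair measurable_compose[OF measurable_fst] measurable_compose[OF measurable_snd]
          measurable_restrict_space1) auto
    then show "(\<lambda>x. x) \<in> restrict_space M S \<Otimes>\<^sub>M restrict_space N R \<rightarrow>\<^sub>M M \<Otimes>\<^sub>M N" by simp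
  qed
  have 2: "(\<lambda>p. (fst p, snd p)) \<in> restrict_space (M \<Otimes>\<^sub>M N) (S \<times> R) \<rightarrow>\<^sub>M restrict_space M S \<Otimes>\<^sub>M restrict_space N R"
    by (intro measurable_Pair measurable_restrict_space2 measurable_restrict_space1)
       (auto simp: space_restrict_space)
  show "sets (restrict_space M S \<Otimes>\<^sub>M restrict_space N R) = sets (restrict_space (M \<Otimes>\<^sub>M N) (S \<times> R))"
  proof (intro set_eqI iffI)
    fix X assume X: "X \<in> sets (restrict_space M S \<Otimes>\<^sub>M restrict_space N R)"
    have "X \<subseteq> S \<times> R" using sets.sets_into_space[OF X] sp by simp
    then show "X \<in> sets (restrict_space (M \<Otimes>\<^sub>M N) (S \<times> R))"
      using measurable_sets[OF 2 X] by (simp add: Int_absorb2 vimage_def)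
  next
    fix X assume X: "X \<in> sets (restrict_space (M \<Otimes>\<^sub>M N) (S \<times> R))"
    have "X \<subseteq> S \<times> R" using sets.sets_into_space[OF X] by simp
    then show "X \<in> sets (restrict_space M S \<Otimes>\<^sub>M restrict_space N R)"
      using measurable_sets[OF 1 X] sp by (simp add: Int_absorb2 vimage_def)
  qed
  fix A B assume "A \<in> sets (restrict_space M S)" "B \<in> sets (restrict_space N R)"
  then have "A \<in> sets M" "B \<in> sets N" "A \<subseteq> S" "B \<subseteq> R"
    by (auto simp: sets_restrict_space_iff)
  moreover from this have "A \<times> B \<subseteq> S \<times> R" by auto
  ultimately show "emeasure (restrict_space M S) A * emeasure (restrict_space N R) B =
      emeasure (restrict_space (M \<Otimes>\<^sub>M N) (S \<times> R)) (A \<times> B)"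
    by (simp add: emeasure_restrict_space N.emeasure_pair_measure_Times)
qed

lemma restrict_cyl: "restrict_space lborel (cyl l T) = iv 0 l \<Otimes>\<^sub>M iv 0 T"
  unfolding cyl_def
  by (subst restrict_space_pair) (auto simp: lborel_prod intro: lborel.sigma_finite_measure_axioms)

lemma cyl_borel [simp]: "cyl l T \<in> sets borel"
  unfolding cyl_def by (intro borel_open open_Times) auto

lemmas L2_cyl = L2_on_eq_L2[OF cyl_borel, unfolded restrict_cyl]
lemmas ip_cyl = L2_inner_eq_ip[OF cyl_borel, unfolded restrict_cyl]
lemmas nrm_cyl = L2_norm_eq_nrm[OF cyl_borel, unfolded restrict_cyl]

lemma AE_cyl: "(AE p\<in>cyl l T in lborel. Q p) \<longleftrightarrow> (AE p in iv 0 l \<Otimes>\<^sub>M iv 0 T. Q p)"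
  unfolding restrict_cyl[symmetric] by (subst AE_restrict_space_iff) auto

lemma integral_cyl: "(LINT p:cyl l T|lborel. f p) = (\<integral>p. f p \<partial>(iv 0 l \<Otimes>\<^sub>M iv 0 T))"
  for f :: "real \<times> real \<Rightarrow> real"
  unfolding restrict_cyl[symmetric] by (subst integral_restrict_space) (auto simp: set_lebesgue_integral_def)

lemma bker_iv:
  assumes "case_prod k \<in> borel_measurable (borel \<Otimes>\<^sub>M borel)"
    and "\<And>x y. x \<in> {a<..<b} \<Longrightarrow> y \<in> {c<..<d} \<Longrightarrow> \<bar>k x y\<bar> \<le> C"
  shows "bker (iv a b) (iv c d) k C"
  unfolding bker_def
proof (intro conjI ballI)
  note [measurable] = assms(1)
  have "(\<lambda>p. case_prod k (fst p, snd p)) \<in> borel_measurable (iv a b \<Otimes>\<^sub>M iv c d)"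
    by (rule measurable_compose[OF _ assms(1)])
      (intro measurable_Pair measurable_compose[OF measurable_fst] measurable_compose[OF measurable_snd]
        id_measurable_iv)
  then show "case_prod k \<in> borel_measurable (iv a b \<Otimes>\<^sub>M iv c d)" by simp
qed (use assms(2) in auto)

section \<open>Volterra kernels and primitives\<close>

definition below :: "real \<Rightarrow> real \<Rightarrow> real" where
  "below x y = (if y < x then 1 else 0)"

text \<open>\<open>kop (iv a b) below f\<close> is the primitive of \<open>f\<close> from
  \<open>a\<close>, and \<open>kop (iv a b) above f\<close> the integral up to \<open>b\<close>.
  Both inequalities are strict, which makes the kernels exact transposes; the diagonal is
  null.\<close>

definition above :: "real \<Rightarrow> real \<Rightarrow> real" where
  "above x y = (if x < y then 1 else 0)"

lemma above_eq_transpose: "above = (\<lambda>x y. below y x)"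
  by (simp add: above_def below_def fun_eq_iff)

lemma below_measurable [measurable]: "case_prod below \<in> borel_measurable (borel \<Otimes>\<^sub>M borel)"
  unfolding below_def by measurable

lemma above_measurable [measurable]: "case_prod above \<in> borel_measurable (borel \<Otimes>\<^sub>M borel)"
  unfolding above_def by measurable

lemma bker_below: "bker (iv a b) (iv c d) below 1"
  by (rule bker_iv) (auto simp: below_def)

lemma bker_above: "bker (iv a b) (iv c d) above 1"
  by (rule bker_iv) (auto simp: above_def)

lemma below_section [measurable]: "below x \<in> borel_measurable (iv a b)"
proof (rule borel_measurable_iv)
  show "below x \<in> borel_measurable borel" unfolding below_def[abs_def] by measurable
qed

lemma integrable_below:
  assumes "integrable (iv a b) f"
  shows "integrable (iv a b) (\<lambda>y. below x y * f y)"
proof -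
  interpret finite_measure "iv a b" by (rule finite_measure_iv)
  show ?thesis by (rule integrable_mult_bounded[OF assms below_section, where C=1]) (simp add: below_def)
qed

text \<open>Dominated convergence: along \<open>X n\<close> tending to \<open>x\<close> the kernel
  is eventually constant at every \<open>y \<noteq> x\<close>. The argument ranges over the whole
  line, so continuity includes the end points of the interval.\<close>

lemma continuous_on_kop_below:
  assumes "integrable (iv a b) f"
  shows "continuous_on S (kop (iv a b) below f)"
proof -
  have "((\<lambda>n. kop (iv a b) below f (X n)) \<longlonglongrightarrow> kop (iv a b) below f x)" if "X \<longlonglongrightarrow> x" for X x
    unfolding kop_def
  proof (rule integral_dominated_convergence[where w="\<lambda>y. norm (f y)"])
    show "AE y in iv a b. (\<lambda>n. below (X n) y * f y) \<longlonglongrightarrow> below x y * f y"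
      using AE_iv_neq[where c=x]
    proof eventually_elim
      case (elim y)
      have "eventually (\<lambda>n. below (X n) y * f y = below x y * f y) sequentially"
      proof (cases "y < x")
        case True
        then have "eventually (\<lambda>n. y < X n) sequentially" using that by (simp add: order_tendstoD)
        then show ?thesis by eventually_elim (use True in \<open>simp add: below_def\<close>)
      next
        case False
        then have "eventually (\<lambda>n. X n < y) sequentially" using that elim by (simp add: order_tendstoD)
        then show ?thesis by eventually_elim (use False in \<open>simp add: below_def\<close>)
      qed
      then show ?case by (rule tendsto_eventually)
    qed
    show "AE y in iv a b. norm (below (X n) y * f y) \<le> norm (f y)" for n
      by (auto simp: below_def)
  qed (use assms integrable_below[OF assms] in auto)
  then show ?thesis
    by (intro continuous_at_imp_continuous_on ballI)
       (auto simp: continuous_at_sequentially o_def)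
qed

lemma kop_below_left: "x \<le> a \<Longrightarrow> kop (iv a b) below f x = 0"
  unfolding kop_def by (rule integral_eq_zero_AE) (auto simp: AE_iv below_def)

lemma kop_below_right: "b \<le> x \<Longrightarrow> kop (iv a b) below f x = (\<integral>y. f y \<partial>iv a b)"
  unfolding kop_def by (rule Bochner_Integration.integral_cong) (auto simp: below_def)

lemma kop_below_diff:
  assumes "integrable (iv a b) f" "p \<le> q"
  shows "(\<integral>y. indicator {p<..<q} y * f y \<partial>iv a b) = kop (iv a b) below f q - kop (iv a b) below f p"
proof -
  have "(\<integral>y. indicator {p<..<q} y * f y \<partial>iv a b) = (\<integral>y. below q y * f y - below p y * f y \<partial>iv a b)"
  proof (rule integral_cong_AE)
    have [measurable]: "f \<in> borel_measurable (iv a b)" using assms(1) by simp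
    have [measurable]: "(indicator {p<..<q} :: real \<Rightarrow> real) \<in> borel_measurable (iv a b)"
      by (rule borel_measurable_iv) simp
    show "(\<lambda>y. indicator {p<..<q} y * f y) \<in> borel_measurable (iv a b)" by measurable
    show "(\<lambda>y. below q y * f y - below p y * f y) \<in> borel_measurable (iv a b)" by measurable
    show "AE y in iv a b. indicator {p<..<q} y * f y = below q y * f y - below p y * f y"
      using AE_iv_neq[where c=p] by eventually_elim (use assms(2) in \<open>auto simp: below_def indicator_def\<close>)
  qed
  then show ?thesis
    using integrable_below[OF assms(1)] by (simp add: kop_def)
qed

text \<open>The measures whose densities are the positive and the negative part of \<open>f\<close>
  have equal mass on every half line, so they coincide and so do the densities. Only rational points
  are compared, because the lemma is to be fed by countably many test functions.\<close>

lemma AE_eq_0_of_primitive: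
  assumes f: "integrable (iv a b) f" and "a < b"
    and eq: "\<And>p q. p \<in> \<rat> \<Longrightarrow> q \<in> \<rat> \<Longrightarrow> a < p \<Longrightarrow> p < q \<Longrightarrow> q < b \<Longrightarrow>
      kop (iv a b) below f p = kop (iv a b) below f q"
  shows "AE x in iv a b. f x = 0"
proof -
  let ?Z = "kop (iv a b) below f"
  note cont = continuous_on_kop_below[OF f]
  \<comment> \<open>The rational approximants stay inside \<open>(a, b)\<close> even when
    \<open>x\<close> is an end point; this connects the constant value of the primitive with its
    value 0 at \<open>a\<close>.\<close>
  have tend: "\<exists>X. (\<forall>n. X n \<in> \<rat> \<and> a < X n \<and> X n < b) \<and> X \<longlonglongrightarrow> x" if "x \<in> {a..b}" for x
  proof -
    have "\<exists>r\<in>\<rat>. max a (x - 1 / Suc n) < r \<and> r < min b (x + 1 / Suc n)" for n :: nat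
    proof (rule Rats_dense_in_real)
      define e where "e = 1 / real (Suc n)"
      have "0 < e" by (simp add: e_def)
      then show "max a (x - 1 / Suc n) < min b (x + 1 / Suc n)"
        using that \<open>a < b\<close> unfolding e_def[symmetric] by auto
    qed
    then obtain X where X: "\<And>n. X n \<in> \<rat>" "\<And>n. max a (x - 1 / Suc n) < X n" "\<And>n. X n < min b (x + 1 / Suc n)"
      by metis
    have "(\<lambda>n. X n - x) \<longlonglongrightarrow> 0"
      using X(2,3) by (intro LIMSEQ_norm_0) (fastforce simp: abs_less_iff algebra_simps)
    then show ?thesis using X LIM_zero_iff[of X x] by (intro exI[of _ X]) auto
  qed
  obtain r0 where r0: "r0 \<in> \<rat>" "a < r0" "r0 < b" using \<open>a < b\<close> Rats_dense_in_real by blast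
  have rat: "?Z q = ?Z r0" if "q \<in> \<rat>" "a < q" "q < b" for q
    using eq[of q r0] eq[of r0 q] that r0 by (cases q r0 rule: linorder_cases) auto
  have Zc: "?Z x = ?Z r0" if x: "x \<in> {a..b}" for x
  proof -
    obtain X where X: "\<forall>n. X n \<in> \<rat> \<and> a < X n \<and> X n < b" "X \<longlonglongrightarrow> x" using tend[OF x] by blast
    have "(\<lambda>n. ?Z (X n)) \<longlonglongrightarrow> ?Z x"
      using continuous_on_tendsto_compose[OF cont[of UNIV] X(2)] by simp
    moreover have "(\<lambda>n. ?Z (X n)) = (\<lambda>n. ?Z r0)" using X(1) rat by auto
    ultimately show ?thesis using LIMSEQ_unique by (metis tendsto_const)
  qed
  have Z0: "?Z x = 0" for x
  proof -
    have 0: "?Z y = 0" if "y \<in> {a..b}" for y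
      using Zc[OF that] Zc[of a] kop_below_left[of a a b f] \<open>a < b\<close> by auto
    consider "x < a" | "x \<in> {a..b}" | "x > b" by fastforce
    then show ?thesis
      using 0 kop_below_left[of x a b f] kop_below_right[of b x a f] kop_below_right[of b b a f] \<open>a < b\<close>
      by cases auto
  qed
  have i0: "(\<integral>y. f y \<partial>iv a b) = 0" using kop_below_right[of b b a f] Z0[of b] by simp
  let ?g = "\<lambda>y. indicator {a<..<b} y * f y"
  have gi: "integrable lborel ?g" using f by (simp add: integrable_restrict_space)
  then have [measurable]: "?g \<in> borel_measurable borel" by auto
  \<comment> \<open>\<open>ennreal\<close> sends negative numbers to 0, so these densities are the
    positive and the negative part of \<open>?g\<close>.\<close>
  let ?P = "density lborel (\<lambda>y. ennreal (?g y))" and ?N = "density lborel (\<lambda>y. ennreal (- ?g y))"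
  have tail: "(\<integral>y. indicator {x<..} y * ?g y \<partial>lborel) = 0" for x
  proof -
    have "(\<integral>y. indicator {x<..} y * ?g y \<partial>lborel) = (\<integral>y. f y - below x y * f y \<partial>iv a b)"
    proof -
      have "integrable (iv a b) (\<lambda>y. f y - below x y * f y)" using f integrable_below[OF f] by simp
      then have m: "(\<lambda>y. indicator {a<..<b} y *\<^sub>R (f y - below x y * f y)) \<in> borel_measurable lborel"
        by (subst (asm) integrable_restrict_space) auto
      have "AE y in lborel. indicator {x<..} y * ?g y = indicator {a<..<b} y *\<^sub>R (f y - below x y * f y)"
        using AE_lborel_singleton[of x] by eventually_elim (auto simp: below_def split: split_indicator)
      then show ?thesis
        using m by (subst integral_restrict_space, simp) (rule integral_cong_AE, auto)
    qed
    also have "\<dots> = 0" using f integrable_below[OF f] i0 Z0 by (simp add: kop_def)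
    finally show ?thesis .
  qed
  have gi': "integrable lborel (\<lambda>y. indicator {x<..} y * ?g y)" for x
    using integrable_mult_indicator[OF _ gi, of "{x<..}"] by simp
  have em: "emeasure ?P {x<..} = (\<integral>\<^sup>+y. ennreal (indicator {x<..} y * ?g y) \<partial>lborel)"
    "emeasure ?N {x<..} = (\<integral>\<^sup>+y. ennreal (- (indicator {x<..} y * ?g y)) \<partial>lborel)" for x
    by (subst emeasure_density; auto intro!: nn_integral_cong split: split_indicator)+
  have fin: "(\<integral>\<^sup>+y. ennreal (indicator {x<..} y * ?g y) \<partial>lborel) < \<infinity>"
    "(\<integral>\<^sup>+y. ennreal (- (indicator {x<..} y * ?g y)) \<partial>lborel) < \<infinity>" for x
    using gi'[of x] by (auto simp: real_integrable_def top.not_eq_extremum)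
  have "?P = ?N"
  proof (rule measure_eqI_lessThan)
    show "emeasure ?P {x<..} < \<infinity>" for x using em fin by simp
    show "emeasure ?P {x<..} = emeasure ?N {x<..}" for x
      using tail[of x] ennreal_enn2real[OF fin(1)[of x, unfolded infinity_ennreal_def]]
        ennreal_enn2real[OF fin(2)[of x, unfolded infinity_ennreal_def]]
      unfolding em real_lebesgue_integral_def[OF gi'] by (metis eq_iff_diff_eq_0)
  qed auto
  then have "AE y in lborel. ennreal (?g y) = ennreal (- ?g y)"
    by (intro sigma_finite_measure.density_unique[OF lborel.sigma_finite_measure_axioms]) auto
  then show ?thesis
    unfolding AE_iv
  proof eventually_elim
    case (elim y)
    then show ?case
      by (cases "f y" "0::real" rule: linorder_cases) (auto simp: ennreal_neg)
  qed
qed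

section \<open>Test functions and the lemma of du Bois-Reymond\<close>

lemma continuous_antiderivative:
  fixes f :: "real \<Rightarrow> real"
  assumes "continuous_on UNIV f"
  obtains F where "\<And>x. (F has_real_derivative f x) (at x)"
proof -
  have "\<exists>F. \<forall>x. -\<infinity> < ereal x \<longrightarrow> ereal x < \<infinity> \<longrightarrow> (F has_vector_derivative f x) (at x)"
    using assms by (intro einterval_antiderivative) (auto simp: continuous_on_eq_continuous_at)
  then show ?thesis using that by (auto simp: has_real_derivative_iff_has_vector_derivative)
qed

text \<open>An antiderivative is constant on either side of \<open>[c, d]\<close>; the vanishing
  integral makes the two constants equal, and subtracting \<open>F c\<close> turns both into
  0.\<close>

lemma C1c_antiderivative:
  fixes f :: "real \<Rightarrow> real"
  assumes f: "continuous_on UNIV f" and cd: "a < c" "c \<le> d" "d < b"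
    and z: "\<And>x. x \<notin> {c..d} \<Longrightarrow> f x = 0" and int: "(\<integral>x. f x \<partial>iv a b) = 0"
  obtains \<psi> where "\<psi> \<in> C1c a b" "deriv \<psi> = f"
proof -
  obtain F where F: "\<And>x. (F has_real_derivative f x) (at x)"
    using continuous_antiderivative[OF f] by blast
  let ?\<psi> = "\<lambda>x. F x - F c"
  have D: "(?\<psi> has_real_derivative f x) (at x)" for x
    using F by (auto intro!: derivative_eq_intros)
  then have deriv: "deriv ?\<psi> = f" by (auto simp: fun_eq_iff intro!: DERIV_imp_deriv)
  have left: "F x = F c" if "x < c" for x
  proof (rule DERIV_isconst_end[OF that, symmetric])
    show "continuous_on {x..c} F"
      using F by (auto intro!: DERIV_continuous continuous_at_imp_continuous_on)
    show "\<And>y. x < y \<Longrightarrow> y < c \<Longrightarrow> (F has_real_derivative 0) (at y)" using F z by (metis atLeastAtMost_iff not_le)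
  qed
  have right: "F x = F d" if "d < x" for x
  proof (rule DERIV_isconst_end[OF that])
    show "continuous_on {d..x} F"
      using F by (auto intro!: DERIV_continuous continuous_at_imp_continuous_on)
    show "\<And>y. d < y \<Longrightarrow> y < x \<Longrightarrow> (F has_real_derivative 0) (at y)" using F z by (metis atLeastAtMost_iff not_le)
  qed
  have "F d - F c = (\<integral>x. f x * indicator {c..d} x \<partial>lborel)"
    using f F cd by (intro integral_FTC_Icc_real[symmetric]) (auto simp: continuous_on_eq_continuous_at)
  also have "\<dots> = (\<integral>x. f x \<partial>iv a b)"
    unfolding integral_restrict_space[of "{a<..<b}" lborel, simplified]
    using cd z by (intro Bochner_Integration.integral_cong) (auto split: split_indicator)
  finally have "F d = F c" using int by simp
  then have out: "?\<psi> x = 0" if "x \<notin> {c..d}" for x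
    using left[of x] right[of x] that by (cases "x < c") auto
  have "?\<psi> \<in> C1c a b"
    unfolding C1c_def
  proof (intro CollectI conjI)
    show "\<forall>x. ?\<psi> differentiable at x" using D real_differentiable_def by blast
    show "continuous_on UNIV (deriv ?\<psi>)" unfolding deriv by (rule f)
    show "\<exists>c' d'. a < c' \<and> d' < b \<and> (\<forall>x. x \<notin> {c'..d'} \<longrightarrow> ?\<psi> x = 0)" using cd out by blast
  qed
  then show ?thesis using deriv that by blast
qed

text \<open>A continuous approximation of the indicator of \<open>(p, q)\<close> with ramps of slope
  \<open>n\<close>. It vanishes outside \<open>(p, q)\<close>, so for \<open>a < p\<close> and
  \<open>q < b\<close> its support is compact in \<open>(a, b)\<close>.\<close>

definition trap :: "real \<Rightarrow> real \<Rightarrow> nat \<Rightarrow> real \<Rightarrow> real" where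
  "trap p q n x = max 0 (min 1 (real n * min (x - p) (q - x)))"

definition trap_int :: "real \<Rightarrow> real \<Rightarrow> real \<Rightarrow> real \<Rightarrow> nat \<Rightarrow> real" where
  "trap_int a b p q n = (\<integral>x. trap p q n x \<partial>iv a b)"

text \<open>A bump on the middle third of the interval: away from the ends, and independent of
  \<open>p\<close>, \<open>q\<close> and \<open>n\<close>.\<close>

definition trap_ref :: "real \<Rightarrow> real \<Rightarrow> real \<Rightarrow> real" where
  "trap_ref a b = trap ((2 * a + b) / 3) ((a + 2 * b) / 3) 1"

text \<open>A multiple of a fixed bump is subtracted from the trapezium to make the integral vanish, so
  that the result is the derivative of a test function.\<close>

definition dtest :: "real \<Rightarrow> real \<Rightarrow> real \<Rightarrow> real \<Rightarrow> nat \<Rightarrow> real \<Rightarrow> real" where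
  "dtest a b p q n x = trap p q n x - trap_int a b p q n / (\<integral>x. trap_ref a b x \<partial>iv a b) * trap_ref a b x"

lemma trap_bounds: "0 \<le> trap p q n x" "trap p q n x \<le> 1"
  by (auto simp: trap_def)

lemma trap_outside: "x \<notin> {p<..<q} \<Longrightarrow> trap p q n x = 0"
proof -
  assume "x \<notin> {p<..<q}"
  then have "real n * min (x - p) (q - x) \<le> 0" by (auto simp: mult_le_0_iff min_le_iff_disj)
  then show ?thesis by (simp add: trap_def)
qed

lemma trap_pos: "x \<in> {p<..<q} \<Longrightarrow> 0 < n \<Longrightarrow> 0 < trap p q n x"
  by (auto simp: trap_def less_max_iff_disj)

lemma continuous_on_trap: "continuous_on S (trap p q n)"
  unfolding trap_def[abs_def] by (intro continuous_intros)

lemma trap_tendsto: "(\<lambda>n. trap p q n x) \<longlonglongrightarrow> indicator {p<..<q} x"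
proof (cases "x \<in> {p<..<q}")
  case True
  then have m: "0 < min (x - p) (q - x)" by simp
  obtain N :: nat where N: "1 / min (x - p) (q - x) < N" using reals_Archimedean2 by blast
  have "trap p q n x = 1" if "n \<ge> N" for n
  proof -
    have "1 < real N * min (x - p) (q - x)" using N m by (simp add: divide_less_eq)
    also have "\<dots> \<le> real n * min (x - p) (q - x)" using that m by (intro mult_right_mono) auto
    finally show ?thesis by (simp add: trap_def)
  qed
  then have "eventually (\<lambda>n. trap p q n x = 1) sequentially"
    by (auto simp: eventually_sequentially)
  then show ?thesis using True by (intro tendsto_eventually) simp
qed (auto simp: trap_outside)

lemma trap_measurable: "trap p q n \<in> borel_measurable (iv a b)"
  using continuous_on_trap by (intro borel_measurable_iv borel_measurable_continuous_onI)

lemma integrable_trap_mult: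
  assumes "integrable (iv a b) f"
  shows "integrable (iv a b) (\<lambda>x. trap p q n x * f x)"
proof -
  interpret finite_measure "iv a b" by (rule finite_measure_iv)
  show ?thesis
    using trap_bounds by (intro integrable_mult_bounded[OF assms trap_measurable, where C=1]) simp
qed

lemma integrable_trap: "integrable (iv a b) (trap p q n)"
proof -
  interpret finite_measure "iv a b" by (rule finite_measure_iv)
  show ?thesis using integrable_trap_mult[of a b "\<lambda>_. 1" p q n] by simp
qed

lemma trap_ref_pos:
  assumes "a < b"
  shows "0 < (\<integral>x. trap_ref a b x \<partial>iv a b)"
proof -
  let ?p = "(2 * a + b) / 3" and ?q = "(a + 2 * b) / 3"
  have "(\<integral>x. trap ?p ?q 1 x \<partial>iv a b) \<noteq> 0"
  proof
    assume "(\<integral>x. trap ?p ?q 1 x \<partial>iv a b) = 0"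
    then have "AE x in iv a b. trap ?p ?q 1 x = 0"
      using integral_nonneg_eq_0_iff_AE[OF integrable_trap] trap_bounds(1) by simp
    then have "AE x in lborel. x \<notin> {?p<..<?q}"
      unfolding AE_iv
    proof eventually_elim
      case (elim x)
      moreover have "?p > a" "?q < b" using assms by auto
      ultimately show ?case using trap_pos[of x ?p ?q 1] by (cases "x \<in> {?p<..<?q}") auto
    qed
    then have "emeasure lborel {?p<..<?q} = 0"
      by (subst (asm) AE_iff_measurable[of "{?p<..<?q}"]) auto
    then show False using assms by (simp add: ennreal_eq_0_iff)
  qed
  moreover have "0 \<le> (\<integral>x. trap ?p ?q 1 x \<partial>iv a b)"
    by (rule Bochner_Integration.integral_nonneg) (rule trap_bounds)
  ultimately show ?thesis by (simp add: trap_ref_def)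
qed

lemma dtest_C1c:
  assumes "a < p" "p < q" "q < b"
  shows "\<exists>\<psi>\<in>C1c a b. deriv \<psi> = dtest a b p q n"
proof -
  let ?p = "(2 * a + b) / 3" and ?q = "(a + 2 * b) / 3"
  have ab: "a < b" using assms by simp
  have 1: "continuous_on UNIV (dtest a b p q n)"
    unfolding dtest_def[abs_def] trap_ref_def by (intro continuous_intros continuous_on_trap)
  have 2: "a < min p ?p" "min p ?p \<le> max q ?q" "max q ?q < b" using assms by auto
  have 3: "dtest a b p q n x = 0" if "x \<notin> {min p ?p..max q ?q}" for x
  proof -
    have "{p<..<q} \<subseteq> {min p ?p..max q ?q}" "{?p<..<?q} \<subseteq> {min p ?p..max q ?q}"
      by (rule subsetI; unfold atLeastAtMost_iff greaterThanLessThan_iff min_le_iff_disj le_max_iff_disj; simp)+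
    then have "x \<notin> {p<..<q}" "x \<notin> {?p<..<?q}" using that by blast+
    then show ?thesis by (simp add: dtest_def trap_ref_def trap_outside)
  qed
  have 4: "(\<integral>x. dtest a b p q n x \<partial>iv a b) = 0"
    using integrable_trap[of a b p q n] integrable_trap[of a b ?p ?q 1] trap_ref_pos[OF ab]
    by (simp add: dtest_def trap_ref_def trap_int_def)
  show ?thesis by (rule C1c_antiderivative[OF 1 2 3 4]) auto
qed

text \<open>Countably many test functions suffice, so that the lemma applies to almost every section of
  a function of two variables.\<close>

lemma du_Bois_Reymond:
  assumes "a < b" and z: "integrable (iv a b) z"
    and test: "\<And>p q n. p \<in> \<rat> \<Longrightarrow> q \<in> \<rat> \<Longrightarrow> a < p \<Longrightarrow> p < q \<Longrightarrow> q < b \<Longrightarrow>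
      (\<integral>x. z x * dtest a b p q n x \<partial>iv a b) = 0"
  shows "\<exists>c. AE x in iv a b. z x = c"
proof -
  interpret finite_measure "iv a b" by (rule finite_measure_iv)
  let ?J = "\<integral>x. trap_ref a b x \<partial>iv a b"
  \<comment> \<open>With this constant, testing \<open>z\<close> against \<open>dtest\<close> is the
    same as testing \<open>z - c\<close> against \<open>trap\<close>.\<close>
  define c where "c = (\<integral>x. trap_ref a b x * z x \<partial>iv a b) / ?J"
  let ?w = "\<lambda>x. z x - c"
  have w: "integrable (iv a b) ?w" using z by simp
  have 0: "(\<integral>x. trap p q n x * ?w x \<partial>iv a b) = 0"
    if "p \<in> \<rat>" "q \<in> \<rat>" "a < p" "p < q" "q < b" for p q n
  proof -
    have "0 = (\<integral>x. trap p q n x * z x - trap_int a b p q n / ?J * (trap_ref a b x * z x) \<partial>iv a b)"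
      unfolding test[OF that, of n, symmetric]
      by (rule Bochner_Integration.integral_cong) (simp_all add: dtest_def algebra_simps)
    also have "\<dots> = (\<integral>x. trap p q n x * z x \<partial>iv a b) - trap_int a b p q n * c"
      using integrable_trap_mult[OF z] by (simp add: c_def trap_ref_def)
    also have "\<dots> = (\<integral>x. trap p q n x * ?w x \<partial>iv a b)"
      using integrable_trap_mult[OF z] integrable_trap by (simp add: trap_int_def right_diff_distrib)
    finally show ?thesis by simp
  qed
  have "AE x in iv a b. ?w x = 0"
  proof (rule AE_eq_0_of_primitive[OF w \<open>a < b\<close>])
    fix p q assume pq: "p \<in> \<rat>" "q \<in> \<rat>" "a < p" "p < q" "q < b"
    \<comment> \<open>In the limit the trapezia become the indicator of \<open>(p, q)\<close>, so
      the primitive of \<open>z - c\<close> takes equal values at \<open>p\<close> and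
      \<open>q\<close>.\<close>
    have "(\<lambda>n. \<integral>x. trap p q n x * ?w x \<partial>iv a b) \<longlonglongrightarrow> (\<integral>x. indicator {p<..<q} x * ?w x \<partial>iv a b)"
    proof (rule integral_dominated_convergence[where w="\<lambda>x. norm (?w x)"])
      have [measurable]: "(indicator {p<..<q} :: real \<Rightarrow> real) \<in> borel_measurable (iv a b)"
        by (rule borel_measurable_iv) simp
      show "(\<lambda>x. indicator {p<..<q} x * ?w x) \<in> borel_measurable (iv a b)"
        using borel_measurable_integrable[OF w] by measurable
      show "AE x in iv a b. norm (trap p q n x * ?w x) \<le> norm (?w x)" for n
      proof (rule AE_I2)
        fix x
        have "trap p q n x * \<bar>?w x\<bar> \<le> 1 * \<bar>?w x\<bar>" by (intro mult_right_mono trap_bounds) simp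
        then show "norm (trap p q n x * ?w x) \<le> norm (?w x)"
          using trap_bounds(1)[of p q n x] by (simp add: abs_mult)
      qed
      show "AE x in iv a b. (\<lambda>n. trap p q n x * ?w x) \<longlonglongrightarrow> indicator {p<..<q} x * ?w x"
        by (intro AE_I2 tendsto_intros trap_tendsto)
      show "integrable (iv a b) (\<lambda>x. norm (?w x))" by (rule integrable_norm[OF w])
      show "(\<lambda>x. trap p q n x * ?w x) \<in> borel_measurable (iv a b)" for n
        by (rule borel_measurable_integrable[OF integrable_trap_mult[OF w]])
    qed
    then have "(\<integral>x. indicator {p<..<q} x * ?w x \<partial>iv a b) = 0"
      unfolding 0[OF pq] by (simp add: LIMSEQ_const_iff)
    then show "kop (iv a b) below ?w p = kop (iv a b) below ?w q"
      using kop_below_diff[OF w, of p q] pq by simp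
  qed
  then have "AE x in iv a b. z x = c" by eventually_elim simp
  then show ?thesis by (rule exI)
qed

lemma C1c_props:
  assumes "\<psi> \<in> C1c a b"
  shows "(\<psi> has_real_derivative deriv \<psi> x) (at x)" "continuous_on UNIV (deriv \<psi>)" "\<psi> b = 0"
    "continuous_on UNIV \<psi>" "\<psi> a = 0"
proof -
  show d: "(\<psi> has_real_derivative deriv \<psi> x) (at x)" for x
    using assms by (simp add: C1c_def DERIV_deriv_iff_real_differentiable)
  show "continuous_on UNIV (deriv \<psi>)" "\<psi> b = 0" "\<psi> a = 0"
    using assms by (auto simp: C1c_def)
  show "continuous_on UNIV \<psi>"
    using d by (auto intro!: DERIV_continuous continuous_at_imp_continuous_on)
qed

lemma continuous_bounded_iv:
  fixes f :: "real \<Rightarrow> real"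
  assumes "continuous_on UNIV f"
  obtains C where "\<And>x. x \<in> {a<..<b} \<Longrightarrow> \<bar>f x\<bar> \<le> C"
proof -
  have "compact (f ` {a..b})"
    using assms by (intro compact_continuous_image continuous_on_subset[OF assms]) auto
  then obtain C where "\<forall>y\<in>f ` {a..b}. norm y \<le> C"
    using compact_imp_bounded bounded_iff by blast
  then show ?thesis using that[of C] by fastforce
qed

lemma integrable_continuous_mult_iv:
  fixes f g :: "real \<Rightarrow> real"
  assumes "continuous_on UNIV f" "integrable (iv a b) g"
  shows "integrable (iv a b) (\<lambda>x. f x * g x)"
proof -
  interpret finite_measure "iv a b" by (rule finite_measure_iv)
  obtain C where "\<And>x. x \<in> {a<..<b} \<Longrightarrow> \<bar>f x\<bar> \<le> C" using continuous_bounded_iv[OF assms(1)] by blast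
  then show ?thesis
    using assms by (intro integrable_mult_bounded[where C=C] borel_measurable_iv borel_measurable_continuous_onI) auto
qed

lemma kop_above_deriv:
  assumes \<psi>: "\<psi> \<in> C1c a b" and y: "y \<in> {a..<b}"
  shows "kop (iv a b) above (deriv \<psi>) y = - \<psi> y"
proof -
  have "kop (iv a b) above (deriv \<psi>) y = (\<integral>x. deriv \<psi> x * indicator {y..b} x \<partial>lborel)"
    unfolding kop_def integral_restrict_space[of "{a<..<b}" lborel, simplified]
  proof (rule integral_cong_AE)
    have [measurable]: "deriv \<psi> \<in> borel_measurable borel"
      using C1c_props(2)[OF \<psi>] by (intro borel_measurable_continuous_onI)
    show "(\<lambda>x. indicator {a<..<b} x *\<^sub>R (above y x * deriv \<psi> x)) \<in> borel_measurable lborel"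
    proof -
      have [measurable]: "above y \<in> borel_measurable borel" unfolding above_def[abs_def] by measurable
      show ?thesis by measurable
    qed
    show "(\<lambda>x. deriv \<psi> x * indicator {y..b} x) \<in> borel_measurable lborel"
      by measurable
    show "AE x in lborel. indicator {a<..<b} x *\<^sub>R (above y x * deriv \<psi> x) = deriv \<psi> x * indicator {y..b} x"
      using AE_lborel_singleton[of y] AE_lborel_singleton[of b]
      by eventually_elim (use y in \<open>auto simp: above_def split: split_indicator\<close>)
  qed
  also have "\<dots> = \<psi> b - \<psi> y"
    using y C1c_props[OF \<psi>] by (intro integral_FTC_Icc_real) (auto simp: continuous_on_eq_continuous_at)
  finally show ?thesis using C1c_props(3)[OF \<psi>] by simp
qed

text \<open>The kernel swap moves the integration from \<open>g\<close> to
  \<open>deriv \<psi>\<close>, where it becomes the integral up to \<open>b\<close>, that is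
  \<open>- \<psi>\<close>, since \<open>\<psi> b = 0\<close>.\<close>

lemma primitive_by_parts:
  assumes \<psi>: "\<psi> \<in> C1c a b" and g: "integrable (iv a b) g"
  shows "(\<integral>x. kop (iv a b) below g x * deriv \<psi> x \<partial>iv a b) = - (\<integral>x. g x * \<psi> x \<partial>iv a b)"
proof -
  interpret finite_measure "iv a b" by (rule finite_measure_iv)
  have "integrable (iv a b) (deriv \<psi>)"
    using integrable_continuous_mult_iv[OF C1c_props(2)[OF \<psi>], of a b "\<lambda>_. 1"] by simp
  then have "(\<integral>x. kop (iv a b) below g x * deriv \<psi> x \<partial>iv a b) = (\<integral>y. g y * kop (iv a b) above (deriv \<psi>) y \<partial>iv a b)"
    unfolding above_eq_transpose
    by (intro kernel_swap[OF _ _ bker_below g] finite_measure_iv)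
  also have "\<dots> = (\<integral>y. - (g y * \<psi> y) \<partial>iv a b)"
    using kop_above_deriv[OF \<psi>] by (intro Bochner_Integration.integral_cong) auto
  finally show ?thesis by simp
qed

lemma L2_kop_below: "f \<in> L2 (iv a b) \<Longrightarrow> kop (iv a b) below f \<in> L2 (iv c d)"
  using finite_measure.kop_L2[OF finite_measure_iv finite_measure_iv bker_below] .

lemma C1c_deriv_integral:
  assumes "\<psi> \<in> C1c a b"
  shows "(\<integral>x. deriv \<psi> x \<partial>iv a b) = 0"
proof (cases "a < b")
  case True
  have "(\<integral>x. deriv \<psi> x \<partial>iv a b) = kop (iv a b) above (deriv \<psi>) a"
    unfolding kop_def by (intro Bochner_Integration.integral_cong) (auto simp: above_def)
  also have "\<dots> = 0"
    using kop_above_deriv[OF assms, of a] C1c_props(5)[OF assms] True by simp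
  finally show ?thesis .
qed (simp add: integral_restrict_space)

text \<open>The difference of \<open>f\<close> and the primitive of \<open>g\<close> is orthogonal
  to all derivatives of test functions, hence constant. Below, spatial weak derivatives are handled
  through this representation.\<close>

lemma has_weak_deriv_iff:
  assumes "a < b"
  shows "has_weak_deriv a b f g \<longleftrightarrow> f \<in> L2 (iv a b) \<and> g \<in> L2 (iv a b) \<and>
    (\<exists>c. AE x in iv a b. f x = c + kop (iv a b) below g x)" (is "?L \<longleftrightarrow> ?R")
proof -
  interpret finite_measure "iv a b" by (rule finite_measure_iv)
  have wd: "?L \<longleftrightarrow> f \<in> L2 (iv a b) \<and> g \<in> L2 (iv a b) \<and>
     (\<forall>\<psi>\<in>C1c a b. (\<integral>x. f x * deriv \<psi> x \<partial>iv a b) = - (\<integral>x. g x * \<psi> x \<partial>iv a b))"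
    by (simp add: has_weak_deriv_def L2_iv integral_iv)
  let ?G = "kop (iv a b) below g"
  show ?thesis
  proof
    assume ?L
    then have f: "f \<in> L2 (iv a b)" and g: "g \<in> L2 (iv a b)"
      and t: "\<And>\<psi>. \<psi> \<in> C1c a b \<Longrightarrow> (\<integral>x. f x * deriv \<psi> x \<partial>iv a b) = - (\<integral>x. g x * \<psi> x \<partial>iv a b)"
      using wd by auto
    have fi: "integrable (iv a b) f" and Gi: "integrable (iv a b) ?G"
      using f L2_kop_below[OF g] by (auto simp: L2_integrable)
    have "\<exists>c. AE x in iv a b. f x - ?G x = c"
    proof (rule du_Bois_Reymond[OF \<open>a < b\<close>])
      show "integrable (iv a b) (\<lambda>x. f x - ?G x)" using fi Gi by simp
      fix p q :: real and n assume pq: "a < p" "p < q" "q < b"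
      obtain \<psi> where \<psi>: "\<psi> \<in> C1c a b" "deriv \<psi> = dtest a b p q n"
        using dtest_C1c[OF pq] by blast
      have i: "integrable (iv a b) (\<lambda>x. f x * deriv \<psi> x)" "integrable (iv a b) (\<lambda>x. ?G x * deriv \<psi> x)"
        using integrable_continuous_mult_iv[OF C1c_props(2)[OF \<psi>(1)] fi]
          integrable_continuous_mult_iv[OF C1c_props(2)[OF \<psi>(1)] Gi] by (simp_all add: mult.commute)
      then show "(\<integral>x. (f x - ?G x) * dtest a b p q n x \<partial>iv a b) = 0"
        using t[OF \<psi>(1)] primitive_by_parts[OF \<psi>(1) L2_integrable[OF g]]
        by (simp add: \<psi>(2)[symmetric] left_diff_distrib)
    qed
    then obtain c where "AE x in iv a b. f x - ?G x = c" by blast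
    then have "AE x in iv a b. f x = c + ?G x" by eventually_elim simp
    then show ?R using f g by blast
  next
    assume ?R
    then obtain c where f: "f \<in> L2 (iv a b)" and g: "g \<in> L2 (iv a b)"
      and c: "AE x in iv a b. f x = c + ?G x" by blast
    have Gi: "integrable (iv a b) ?G" using L2_kop_below[OF g] by (rule L2_integrable)
    have "(\<integral>x. f x * deriv \<psi> x \<partial>iv a b) = - (\<integral>x. g x * \<psi> x \<partial>iv a b)" if \<psi>: "\<psi> \<in> C1c a b" for \<psi>
    proof -
      note D = C1c_props(2)[OF \<psi>]
      have i: "integrable (iv a b) (deriv \<psi>)" "integrable (iv a b) (\<lambda>x. ?G x * deriv \<psi> x)"
        using integrable_continuous_mult_iv[OF D Gi] integrable_continuous_mult_iv[OF D, of a b "\<lambda>_. 1"]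
        by (simp_all add: mult.commute)
      note [measurable] = L2_measurable[OF f] borel_measurable_integrable[OF i(1)]
        borel_measurable_integrable[OF Gi]
      have "(\<integral>x. f x * deriv \<psi> x \<partial>iv a b) = (\<integral>x. c * deriv \<psi> x + ?G x * deriv \<psi> x \<partial>iv a b)"
        by (rule integral_cong_AE; measurable?)
           (use c in eventually_elim, simp add: distrib_right)
      also have "\<dots> = - (\<integral>x. g x * \<psi> x \<partial>iv a b)"
        using i primitive_by_parts[OF \<psi> L2_integrable[OF g]] C1c_deriv_integral[OF \<psi>] by simp
      finally show ?thesis .
    qed
    then show ?L using wd f g by blast
  qed
qed

section \<open>Boundary values and the Green function\<close>

lemma continuous_AE_eq:
  fixes f g :: "real \<Rightarrow> real"
  assumes "a < b" "continuous_on {a..b} f" "continuous_on {a..b} g" "AE x in iv a b. f x = g x"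
    and c: "c \<in> {a..b}"
  shows "f c = g c"
proof -
  let ?C = "{x \<in> {a..b}. f x - g x = 0}"
  have C: "closed ?C"
    using continuous_closed_preimage_constant[of "{a..b}" "\<lambda>x. f x - g x" 0] assms(2,3)
    by (auto intro: continuous_intros)
  have "AE x\<in>{a<..<b} in lebesgue. x \<in> ?C"
    using AE_completion[OF assms(4)[unfolded AE_iv]] by eventually_elim auto
  then have "x \<in> ?C" if "x \<in> {a<..<b}" for x
    using mem_closed_if_AE_lebesgue_open[OF _ C _ that] by simp
  then have "closure {a<..<b} \<subseteq> ?C"
    using C by (intro closure_minimal) blast
  then show ?thesis using c \<open>a < b\<close> by auto
qed

text \<open>Two continuous representatives agree on a closed set of full measure, hence on all of
  \<open>[a, b]\<close>; so the description by \<open>THE\<close> is met by exactly one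
  value.\<close>

lemma point_value_eq:
  assumes "a < b" "continuous_on {a..b} g" "AE x in iv a b. g x = f x" "c \<in> {a..b}"
  shows "point_value a b f c = g c"
  unfolding point_value_def
proof (rule the_equality)
  show "\<exists>h. continuous_on {a..b} h \<and> (AE x\<in>{a<..<b} in lborel. h x = f x) \<and> g c = h c"
    using assms by (auto simp: AE_iv)
next
  fix y assume "\<exists>h. continuous_on {a..b} h \<and> (AE x\<in>{a<..<b} in lborel. h x = f x) \<and> y = h c"
  then obtain h where h: "continuous_on {a..b} h" "AE x in iv a b. h x = f x" "y = h c"
    unfolding AE_iv by blast
  have "AE x in iv a b. h x = g x"
    using h(2) assms(3) by eventually_elim simp
  then show "y = g c"
    using continuous_AE_eq[OF assms(1) h(1) assms(2) _ assms(4)] h(3) by simp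
qed

text \<open>\<open>G0\<close> is the Green function of \<open>v'' = h\<close>, \<open>v(0) = v(l) = 0\<close>, and \<open>G1\<close> its derivative in the first
  variable, so that \<open>v\<close> belongs to \<open>V2 l\<close> iff \<open>v = \<integral> G0 v''\<close> almost everywhere with \<open>v'' \<in> L\<^sup>2\<close>.\<close>

definition G1 :: "real \<Rightarrow> real \<Rightarrow> real \<Rightarrow> real" where
  "G1 l x y = below x y - (l - y) / l"

definition G0 :: "real \<Rightarrow> real \<Rightarrow> real \<Rightarrow> real" where
  "G0 l x y = max (x - y) 0 - x * (l - y) / l"

lemma bker_G1: "0 < l \<Longrightarrow> bker (iv 0 l) (iv 0 l) (G1 l) 1"
proof (rule bker_iv)
  show "case_prod (G1 l) \<in> borel_measurable (borel \<Otimes>\<^sub>M borel)"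
    unfolding G1_def[abs_def] below_def[abs_def] by measurable
  assume "0 < l"
  fix x y assume "x \<in> {0<..<l}" "y \<in> {0<..<l}"
  then have "0 \<le> (l - y) / l" "(l - y) / l \<le> 1" using \<open>0 < l\<close> by (auto simp: field_simps)
  then show "\<bar>G1 l x y\<bar> \<le> 1" by (auto simp: G1_def below_def)
qed

lemma bker_G0: "0 < l \<Longrightarrow> bker (iv 0 l) (iv 0 l) (G0 l) l"
proof (rule bker_iv)
  show "case_prod (G0 l) \<in> borel_measurable (borel \<Otimes>\<^sub>M borel)"
    unfolding G0_def[abs_def] by measurable
  assume "0 < l"
  fix x y assume *: "x \<in> {0<..<l}" "y \<in> {0<..<l}"
  then have "0 \<le> x * y" by simp
  then have "x * (l - y) / l \<le> x" "0 \<le> x * (l - y) / l"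
    using * by (auto simp: field_simps)
  moreover define w where "w = x * (l - y) / l"
  ultimately show "\<bar>G0 l x y\<bar> \<le> l"
    using * unfolding G0_def w_def[symmetric] by (auto simp: abs_le_iff max_def)
qed

lemma integral_indicator_iv:
  assumes "a \<le> p" "q \<le> b"
  shows "(\<integral>z. indicator {p<..<q} z \<partial>iv a b) = (max (q - p) 0 :: real)"
proof -
  have "(\<integral>z. indicator {p<..<q} z \<partial>iv a b) = (\<integral>z. indicator {p<..<q} z \<partial>lborel :: real)"
    unfolding integral_restrict_space[of "{a<..<b}" lborel, simplified]
    using assms by (intro Bochner_Integration.integral_cong) (auto split: split_indicator)
  also have "\<dots> = max (q - p) 0" by (cases "p \<le> q") auto
  finally show ?thesis .
qed

lemma kcomp_below_below:
  assumes "x \<le> l" "0 \<le> y"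
  shows "kcomp (iv 0 l) below below x y = max (x - y) 0"
  unfolding kcomp_def integral_indicator_iv[OF assms(2,1), symmetric]
  by (intro Bochner_Integration.integral_cong) (auto simp: below_def)

lemma integral_below:
  assumes "0 \<le> x" "x \<le> l"
  shows "(\<integral>z. below x z \<partial>iv 0 l) = x"
proof -
  have "(\<integral>z. below x z \<partial>iv 0 l) = (\<integral>z. indicator {0<..<x} z \<partial>iv 0 l)"
    by (intro Bochner_Integration.integral_cong) (auto simp: below_def)
  then show ?thesis using integral_indicator_iv[of 0 0 x l] assms by simp
qed

lemma integrable_below_const: "integrable (iv a b) (below x)"
proof -
  have "integrable (iv a b) (\<lambda>_. 1 :: real)"
    by (rule finite_measure.integrable_const[OF finite_measure_iv])
  from integrable_below[OF this, of x] show ?thesis by simp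
qed

text \<open>\<open>G0\<close> is the primitive of \<open>G1\<close> in the first variable:
  integrating \<open>below x z * below z y\<close> over \<open>z\<close> measures the interval
  \<open>(y, x)\<close>.\<close>

lemma kcomp_below_G1:
  assumes "0 \<le> x" "x \<le> l" "0 \<le> y"
  shows "kcomp (iv 0 l) below (G1 l) x y = G0 l x y"
proof -
  have "kcomp (iv 0 l) below (G1 l) x y = (\<integral>z. below x z * below z y - below x z * ((l - y) / l) \<partial>iv 0 l)"
    unfolding kcomp_def by (intro Bochner_Integration.integral_cong) (auto simp: G1_def algebra_simps)
  also have "\<dots> = kcomp (iv 0 l) below below x y - (\<integral>z. below x z \<partial>iv 0 l) * ((l - y) / l)"
  proof -
    have "integrable (iv 0 l) (\<lambda>z. below z y)"
    proof (rule finite_measure.integrable_const_bound[OF finite_measure_iv, where B=1])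
      show "(\<lambda>z. below z y) \<in> borel_measurable (iv 0 l)"
        unfolding below_def by (intro borel_measurable_iv) measurable
    qed (simp add: below_def)
    then have "integrable (iv 0 l) (\<lambda>z. below x z * below z y)"
      by (rule integrable_below)
    then show ?thesis using integrable_below_const by (simp add: kcomp_def)
  qed
  finally show ?thesis
    using assms by (simp add: kcomp_below_below integral_below G0_def)
qed

lemma kop_G1:
  assumes "0 < l" "integrable (iv 0 l) h"
  shows "kop (iv 0 l) (G1 l) h x = kop (iv 0 l) below h x - (\<integral>y. (l - y) / l * h y \<partial>iv 0 l)"
proof -
  interpret finite_measure "iv 0 l" by (rule finite_measure_iv)
  have "integrable (iv 0 l) (\<lambda>y. (l - y) / l * h y)"
    by (rule integrable_continuous_mult_iv[OF _ assms(2)]) (use assms in \<open>auto intro!: continuous_intros\<close>)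
  then show ?thesis
    using integrable_below[OF assms(2), of x] by (simp add: kop_def G1_def left_diff_distrib)
qed

lemma continuous_on_kop_G1:
  assumes "0 < l" "integrable (iv 0 l) h"
  shows "continuous_on S (kop (iv 0 l) (G1 l) h)"
  unfolding kop_G1[OF assms, abs_def] using continuous_on_kop_below[OF assms(2)]
  by (auto intro!: continuous_intros)

lemma kop_below_kop_G1:
  assumes "0 < l" "integrable (iv 0 l) h" "0 \<le> x" "x \<le> l"
  shows "kop (iv 0 l) below (kop (iv 0 l) (G1 l) h) x = kop (iv 0 l) (G0 l) h x"
proof -
  have "kop (iv 0 l) below (kop (iv 0 l) (G1 l) h) x = kop (iv 0 l) (kcomp (iv 0 l) below (G1 l)) h x"
    by (intro kop_kop[OF _ _ _ bker_G1[OF assms(1)]] finite_measure_iv assms(2) integrable_below_const)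
  also have "\<dots> = kop (iv 0 l) (G0 l) h x"
    unfolding kop_def using assms
    by (intro Bochner_Integration.integral_cong) (auto simp: kcomp_below_G1)
  finally show ?thesis .
qed

lemma kop_below_cong:
  "AE y in iv a b. f y = g y \<Longrightarrow> f \<in> borel_measurable (iv a b) \<Longrightarrow> g \<in> borel_measurable (iv a b) \<Longrightarrow>
   kop (iv a b) below f x = kop (iv a b) below g x"
  by (rule kop_cong_AE) (auto intro: below_section)

text \<open>Integrating twice leaves two constants. The value 0 at 0 removes the first; the value 0
  at \<open>l\<close> says that \<open>g\<close> has integral 0, which determines the second as the
  subtracted term of \<open>G1\<close>.\<close>

lemma V2_imp_kernel:
  assumes l: "0 < l" and f: "f \<in> V2 l" and fg: "has_weak_deriv 0 l f g" and gh: "has_weak_deriv 0 l g h"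
  shows "AE x in iv 0 l. f x = kop (iv 0 l) (G0 l) h x"
    and "AE x in iv 0 l. g x = kop (iv 0 l) (G1 l) h x"
proof -
  interpret finite_measure "iv 0 l" by (rule finite_measure_iv)
  let ?I = "kop (iv 0 l) below"
  obtain c where L: "f \<in> L2 (iv 0 l)" "g \<in> L2 (iv 0 l)" and c: "AE x in iv 0 l. f x = c + ?I g x"
    using fg has_weak_deriv_iff[OF l] by blast
  obtain d where h: "h \<in> L2 (iv 0 l)" and d: "AE x in iv 0 l. g x = d + ?I h x"
    using gh has_weak_deriv_iff[OF l] by blast
  note hi = L2_integrable[OF h] and gi = L2_integrable[OF L(2)]
  have pv: "point_value 0 l f x = c + ?I g x" if "x \<in> {0..l}" for x
  proof (rule point_value_eq[OF l _ _ that])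
    show "continuous_on {0..l} (\<lambda>x. c + ?I g x)"
      by (intro continuous_intros continuous_on_kop_below gi)
    show "AE x in iv 0 l. c + ?I g x = f x" using c by eventually_elim simp
  qed
  have "c = 0" using pv[of 0] f l by (simp add: V2_def kop_below_left)
  have g0: "(\<integral>x. g x \<partial>iv 0 l) = 0"
    using pv[of l] f l \<open>c = 0\<close> by (simp add: V2_def kop_below_right)
  have Ii: "integrable (iv 0 l) (?I h)" using L2_kop_below[OF h] by (rule L2_integrable)
  have "(\<integral>x. g x \<partial>iv 0 l) = (\<integral>x. d + ?I h x \<partial>iv 0 l)"
    using d L Ii by (intro integral_cong_AE) (auto simp: L2_measurable)
  also have "\<dots> = d * l + (\<integral>x. ?I h x * 1 \<partial>iv 0 l)"
    using Ii l by (simp add: measure_iv[simplified])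
  \<comment> \<open>The swap turns the integral of the primitive of \<open>h\<close> into a weighted
    integral of \<open>h\<close>, the weight being the length \<open>l - y\<close> of
    \<open>(y, l)\<close>.\<close>
  also have "(\<integral>x. ?I h x * 1 \<partial>iv 0 l) = (\<integral>y. h y * kop (iv 0 l) above (\<lambda>_. 1) y \<partial>iv 0 l)"
    unfolding above_eq_transpose by (intro kernel_swap[OF _ _ bker_below hi] finite_measure_iv) simp
  also have "\<dots> = (\<integral>y. l * ((l - y) / l * h y) \<partial>iv 0 l)"
  proof (rule Bochner_Integration.integral_cong)
    fix y assume y: "y \<in> space (iv 0 l)"
    have "kop (iv 0 l) above (\<lambda>_. 1) y = (\<integral>z. indicator {y<..<l} z \<partial>iv 0 l)"
      unfolding kop_def by (intro Bochner_Integration.integral_cong) (auto simp: above_def)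
    then show "h y * kop (iv 0 l) above (\<lambda>_. 1) y = l * ((l - y) / l * h y)"
      using integral_indicator_iv[of 0 y l l] y l by simp
  qed simp
  also have "\<dots> = l * (\<integral>y. (l - y) / l * h y \<partial>iv 0 l)"
    by (rule integral_mult_right_zero)
  finally have "l * (d + (\<integral>y. (l - y) / l * h y \<partial>iv 0 l)) = 0"
    unfolding g0 distrib_left by (simp only: mult.commute)
  then have dd: "d = - (\<integral>y. (l - y) / l * h y \<partial>iv 0 l)"
    using l by (simp only: mult_eq_0_iff) (auto simp only: add_eq_0_iff2)
  show g: "AE x in iv 0 l. g x = kop (iv 0 l) (G1 l) h x"
    unfolding kop_G1[OF l hi] using d by eventually_elim (simp add: dd)
  have Ig: "?I g x = ?I (kop (iv 0 l) (G1 l) h) x" for x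
    using g L(2) kop_L2[OF finite_measure_iv bker_G1[OF l] h]
    by (intro kop_below_cong) (auto simp: L2_measurable)
  show "AE x in iv 0 l. f x = kop (iv 0 l) (G0 l) h x"
    using c AE_space[of "iv 0 l"]
    by eventually_elim (use \<open>c = 0\<close> Ig kop_below_kop_G1[OF l hi] in auto)
qed

text \<open>The boundary values are 0 because the primitive starts at 0 and
  \<open>G0 l l y = 0\<close>. For the slope, the derivative selected by \<open>weak_deriv\<close>
  has to be compared with \<open>g\<close>.\<close>

lemma kernel_imp_V2:
  assumes l: "0 < l" and L: "f \<in> L2 (iv 0 l)" "g \<in> L2 (iv 0 l)" "h \<in> L2 (iv 0 l)"
    and f: "AE x in iv 0 l. f x = kop (iv 0 l) (G0 l) h x"
    and g: "AE x in iv 0 l. g x = kop (iv 0 l) (G1 l) h x"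
  shows "f \<in> V2 l" "has_weak_deriv 0 l f g" "has_weak_deriv 0 l g h"
    and "c \<in> {0..l} \<Longrightarrow> point_slope 0 l f c = kop (iv 0 l) (G1 l) h c"
proof -
  interpret finite_measure "iv 0 l" by (rule finite_measure_iv)
  let ?I = "kop (iv 0 l) below" and ?g = "kop (iv 0 l) (G1 l) h"
  note hi = L2_integrable[OF L(3)] and gi = L2_integrable[OF L(2)]
  have "AE x in iv 0 l. g x = - (\<integral>y. (l - y) / l * h y \<partial>iv 0 l) + ?I h x"
    using g unfolding kop_G1[OF l hi] by eventually_elim simp
  then show gh: "has_weak_deriv 0 l g h" using L by (auto simp: has_weak_deriv_iff[OF l])
  have gL: "?g \<in> L2 (iv 0 l)" by (rule kop_L2[OF finite_measure_iv bker_G1[OF l] L(3)])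
  have Ig: "?I g x = kop (iv 0 l) (G0 l) h x" if "x \<in> {0..l}" for x
    using that g L(2) gL kop_below_cong[where f=g and g="?g" and x=x and a=0 and b=l] kop_below_kop_G1[OF l hi, of x] by (auto simp: L2_measurable)
  have fI: "AE x in iv 0 l. ?I g x = f x"
    using f AE_space[of "iv 0 l"] by eventually_elim (use Ig in auto)
  then have "AE x in iv 0 l. f x = 0 + ?I g x" by eventually_elim simp
  then show fg: "has_weak_deriv 0 l f g" using L unfolding has_weak_deriv_iff[OF l] by blast
  have pv: "point_value 0 l f x = ?I g x" if "x \<in> {0..l}" for x
    by (rule point_value_eq[OF l continuous_on_kop_below[OF gi] fI that])
  have G0l: "G0 l l y = 0" if "y \<in> {0<..<l}" for y using that l by (auto simp: G0_def)
  have "?I g l = kop (iv 0 l) (G0 l) h l" using Ig l by simp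
  also have "\<dots> = 0"
    unfolding kop_def by (rule integral_eq_zero_AE) (use G0l in \<open>auto intro!: AE_I2\<close>)
  finally have "?I g l = 0" .
  then show "f \<in> V2 l"
    using fg gh pv[of 0] pv[of l] l by (auto simp: V2_def H2_on_def kop_below_left)
  assume c: "c \<in> {0..l}"
  \<comment> \<open>\<open>weak_deriv\<close> is an arbitrary choice. Its primitive and that of
    \<open>g\<close> differ by a constant, so the choice agrees with \<open>g\<close> almost
    everywhere and has the continuous representative \<open>?g\<close>.\<close>
  have wf: "has_weak_deriv 0 l f (weak_deriv 0 l f)"
    unfolding weak_deriv_def using fg by (rule someI[of "has_weak_deriv 0 l f"])
  then obtain d where w: "weak_deriv 0 l f \<in> L2 (iv 0 l)"
    and d: "AE x in iv 0 l. f x = d + ?I (weak_deriv 0 l f) x"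
    using has_weak_deriv_iff[OF l] by blast
  note wi = L2_integrable[OF w]
  have e: "?I g x = d + ?I (weak_deriv 0 l f) x" if "x \<in> {0..l}" for x
  proof (rule continuous_AE_eq[OF l _ _ _ that])
    show "AE x in iv 0 l. ?I g x = d + ?I (weak_deriv 0 l f) x"
      using fI d by eventually_elim simp
  qed (auto intro!: continuous_intros continuous_on_kop_below gi wi)
  have Id: "?I (\<lambda>y. weak_deriv 0 l f y - g y) x = ?I (weak_deriv 0 l f) x - ?I g x" for x
    using integrable_below[OF gi, of x] integrable_below[OF wi, of x] by (simp add: kop_def right_diff_distrib)
  have "AE x in iv 0 l. weak_deriv 0 l f x - g x = 0"
  proof (rule AE_eq_0_of_primitive[OF _ l])
    show "integrable (iv 0 l) (\<lambda>x. weak_deriv 0 l f x - g x)" using gi wi by simp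
  qed (use e Id in auto)
  then have "AE x in iv 0 l. ?g x = weak_deriv 0 l f x"
    using g by eventually_elim simp
  then show "point_slope 0 l f c = ?g c"
    unfolding point_slope_def
    by (rule point_value_eq[OF l continuous_on_kop_G1[OF l hi] _ c])
qed

section \<open>Functions of space and time\<close>

abbreviation cm :: "real \<Rightarrow> real \<Rightarrow> (real \<times> real) measure" where
  "cm l T \<equiv> iv 0 l \<Otimes>\<^sub>M iv 0 T"

abbreviation past :: "real \<Rightarrow> (real \<times> real \<Rightarrow> real) \<Rightarrow> real \<times> real \<Rightarrow> real" where
  "past T \<equiv> tk (iv 0 T) below"

abbreviation fut :: "real \<Rightarrow> (real \<times> real \<Rightarrow> real) \<Rightarrow> real \<times> real \<Rightarrow> real" where
  "fut T \<equiv> tk (iv 0 T) above"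

abbreviation pot0 :: "real \<Rightarrow> (real \<times> real \<Rightarrow> real) \<Rightarrow> real \<times> real \<Rightarrow> real" where
  "pot0 l \<equiv> sk (iv 0 l) (G0 l)"

abbreviation pot1 :: "real \<Rightarrow> (real \<times> real \<Rightarrow> real) \<Rightarrow> real \<times> real \<Rightarrow> real" where
  "pot1 l \<equiv> sk (iv 0 l) (G1 l)"

lemma finite_pair_iv: "finite_pair (iv a b) (iv c d)"
  by (simp add: finite_pair_def finite_measure_iv)

context finite_pair
begin

text \<open>Cauchy-Schwarz on almost every section, then integration over the other variable. With a
  Volterra kernel it controls the values at a fixed time; its mirrored form, with
  \<open>G1 l c\<close>, controls the slopes at the ends.\<close>

lemma L2_section_functional:
  assumes k: "k \<in> L2 B" and f: "f \<in> L2 PM"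
  shows "(\<lambda>x. ip B k (\<lambda>t. f (x, t))) \<in> L2 A"
    and "nrm A (\<lambda>x. ip B k (\<lambda>t. f (x, t))) \<le> nrm B k * nrm PM f"
proof -
  note [measurable] = L2_measurable[OF k] L2_measurable[OF f]
  let ?F = "\<lambda>x. ip B k (\<lambda>t. f (x, t))"
  let ?q = "\<lambda>x. \<integral>s. (f (x, s))\<^sup>2 \<partial>B"
  have q: "integrable A ?q" "(\<integral>x. ?q x \<partial>A) = ip PM f f"
    using AB.integrable_fst'[OF L2_integrable_square[OF f]]
      AB.integral_fst'[OF L2_integrable_square[OF f]]
    by (auto simp: ip_def power2_eq_square)
  have m: "?F \<in> borel_measurable A" unfolding ip_def by measurable
  have le: "AE x in A. (?F x)\<^sup>2 \<le> ip B k k * ?q x"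
    using AE_section[OF f]
  proof eventually_elim
    case (elim x)
    have "(?F x)\<^sup>2 \<le> (nrm B k * nrm B (\<lambda>t. f (x, t)))\<^sup>2"
      using Cauchy_Schwarz_ip[OF k elim] by (intro abs_le_square_iff[THEN iffD1]) simp
    then show ?case by (simp add: power_mult_distrib nrm_square) (simp add: ip_def power2_eq_square)
  qed
  have i: "integrable A (\<lambda>x. (?F x)\<^sup>2)"
  proof (rule Bochner_Integration.integrable_bound)
    show "integrable A (\<lambda>x. ip B k k * ?q x)" using q by simp
    show "AE x in A. norm ((?F x)\<^sup>2) \<le> norm (ip B k k * ?q x)"
      using le by eventually_elim simp
  qed (use m in measurable)
  with m show "?F \<in> L2 A" by (simp add: L2_def)
  have "ip A ?F ?F \<le> (\<integral>x. ip B k k * ?q x \<partial>A)"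
    unfolding ip_def[of A] power2_eq_square[symmetric] using i q le by (intro integral_mono_AE) auto
  then have "(nrm A ?F)\<^sup>2 \<le> (nrm B k * nrm PM f)\<^sup>2"
    using q(2) by (simp add: nrm_square power_mult_distrib)
  then show "nrm A ?F \<le> nrm B k * nrm PM f"
    by (rule power2_le_imp_le) simp
qed

lemma L2_section_functional':
  assumes k: "k \<in> L2 A" and f: "f \<in> L2 PM"
  shows "(\<lambda>t. ip A k (\<lambda>x. f (x, t))) \<in> L2 B"
    and "nrm B (\<lambda>t. ip A k (\<lambda>x. f (x, t))) \<le> nrm A k * nrm PM f"
proof -
  interpret sw: finite_pair B A ..
  show "(\<lambda>t. ip A k (\<lambda>x. f (x, t))) \<in> L2 B"
    "nrm B (\<lambda>t. ip A k (\<lambda>x. f (x, t))) \<le> nrm A k * nrm PM f"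
    using sw.L2_section_functional[OF k L2_swap[OF f]] ip_swap[OF f f] by (auto simp: nrm_def)
qed

lemma AE_pairI:
  fixes f g :: "'a \<times> 'b \<Rightarrow> real"
  assumes [measurable]: "f \<in> borel_measurable PM" "g \<in> borel_measurable PM"
    and "AE x in A. AE t in B. f (x, t) = g (x, t)"
  shows "AE p in PM. f p = g p"
  using assms(3) by (intro AB.AE_pair_measure) auto

lemma AE_pairI':
  fixes f g :: "'a \<times> 'b \<Rightarrow> real"
  assumes [measurable]: "f \<in> borel_measurable PM" "g \<in> borel_measurable PM"
    and "AE t in B. AE x in A. f (x, t) = g (x, t)"
  shows "AE p in PM. f p = g p"
proof (rule AE_pairI[OF assms(1,2)])
  show "AE x in A. AE t in B. f (x, t) = g (x, t)"
    using assms(3) by (subst AB.AE_commute) auto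
qed

end

text \<open>Applied at almost every time, the Green representation makes \<open>uxx\<close> the only
  free datum, so an arbitrary square-integrable function generates an element of the space.\<close>

lemma L2_V2_iff:
  assumes l: "0 < l"
  shows "L2_V2 l T u ux uxx \<longleftrightarrow> u \<in> L2 (cm l T) \<and> ux \<in> L2 (cm l T) \<and> uxx \<in> L2 (cm l T) \<and>
    (AE p in cm l T. u p = pot0 l uxx p) \<and>
    (AE p in cm l T. ux p = pot1 l uxx p)" (is "?L \<longleftrightarrow> ?R")
proof -
  interpret finite_pair "iv 0 l" "iv 0 T" by (rule finite_pair_iv)
  show ?thesis
  proof
    assume ?L
    then have L: "u \<in> L2 (cm l T)" "ux \<in> L2 (cm l T)" "uxx \<in> L2 (cm l T)"
      and t: "AE t in iv 0 T. (\<lambda>x. u (x, t)) \<in> V2 l \<and>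
        has_weak_deriv 0 l (\<lambda>x. u (x, t)) (\<lambda>x. ux (x, t)) \<and>
        has_weak_deriv 0 l (\<lambda>x. ux (x, t)) (\<lambda>x. uxx (x, t))"
      by (auto simp: L2_V2_def L2_cyl AE_iv)
    note m = L2_measurable[OF sk_L2_nrm(1)[OF bker_G0[OF l] L(3)]]
      L2_measurable[OF sk_L2_nrm(1)[OF bker_G1[OF l] L(3)]]
    have "AE t in iv 0 T. AE x in iv 0 l. u (x, t) = pot0 l uxx (x, t)"
      using t by eventually_elim
        (use V2_imp_kernel(1)[OF l, of "\<lambda>x. u (x, t)" "\<lambda>x. ux (x, t)" "\<lambda>x. uxx (x, t)" for t] in \<open>simp add: sk_def\<close>)
    then have "AE p in cm l T. u p = pot0 l uxx p"
      by (rule AE_pairI'[OF L2_measurable[OF L(1)] m(1)[OF less_imp_le[OF l]]])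
    moreover have "AE t in iv 0 T. AE x in iv 0 l. ux (x, t) = pot1 l uxx (x, t)"
      using t by eventually_elim
        (use V2_imp_kernel(2)[OF l, of "\<lambda>x. u (x, t)" "\<lambda>x. ux (x, t)" "\<lambda>x. uxx (x, t)" for t] in \<open>simp add: sk_def\<close>)
    then have "AE p in cm l T. ux p = pot1 l uxx p"
      by (rule AE_pairI'[OF L2_measurable[OF L(2)] m(2)[OF zero_le_one]])
    ultimately show ?R using L l by auto
  next
    assume ?R
    then have R: "u \<in> L2 (cm l T)" "ux \<in> L2 (cm l T)" "uxx \<in> L2 (cm l T)"
      and E: "AE p in cm l T. u p = pot0 l uxx p" "AE p in cm l T. ux p = pot1 l uxx p"
      by auto
    have "AE t in iv 0 T. (\<lambda>x. u (x, t)) \<in> V2 l \<and>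
        has_weak_deriv 0 l (\<lambda>x. u (x, t)) (\<lambda>x. ux (x, t)) \<and>
        has_weak_deriv 0 l (\<lambda>x. ux (x, t)) (\<lambda>x. uxx (x, t))"
      using R[THEN AE_section'] E[THEN AE_pair_snd]
    proof eventually_elim
      case (elim t)
      then show ?case
        using kernel_imp_V2(1-3)[OF l, of "\<lambda>x. u (x, t)" "\<lambda>x. ux (x, t)" "\<lambda>x. uxx (x, t)"]
        by (simp add: sk_def)
    qed
    then show ?L using R by (auto simp: L2_V2_def L2_cyl AE_iv)
  qed
qed

text \<open>Evaluates the continuous representative of \<open>ux\<close>, namely the integral of
  \<open>uxx\<close> against \<open>G1\<close>, at \<open>c\<close>. The right side is measurable in
  \<open>t\<close>, although \<open>point_slope\<close> is defined one section at a time.\<close>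

lemma L2_V2_point_slope:
  assumes l: "0 < l" and V: "L2_V2 l T u ux uxx" and c: "c \<in> {0..l}"
  shows "AE t in iv 0 T. point_slope 0 l (\<lambda>x. u (x, t)) c = ip (iv 0 l) (G1 l c) (\<lambda>x. uxx (x, t))"
proof -
  interpret finite_pair "iv 0 l" "iv 0 T" by (rule finite_pair_iv)
  have R: "u \<in> L2 (cm l T)" "ux \<in> L2 (cm l T)" "uxx \<in> L2 (cm l T)"
    "AE p in cm l T. u p = pot0 l uxx p"
    "AE p in cm l T. ux p = pot1 l uxx p"
    using V L2_V2_iff[OF l] by blast+
  show ?thesis
    using AE_section'[OF R(1)] AE_section'[OF R(2)] AE_section'[OF R(3)] AE_pair_snd[OF R(4)] AE_pair_snd[OF R(5)]
  proof eventually_elim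
    case (elim t)
    then show ?case
      using kernel_imp_V2(4)[OF l, of "\<lambda>x. u (x, t)" "\<lambda>x. ux (x, t)" "\<lambda>x. uxx (x, t)" c] c
      by (simp add: sk_def ip_def kop_def)
  qed
qed

section \<open>Time primitives, initial and final values\<close>

lemma L2_below: "below t \<in> L2 (iv a b)"
  by (rule finite_measure.L2_bounded[OF finite_measure_iv below_section, where C=1]) (simp add: below_def)

lemma above_section: "above t \<in> borel_measurable (iv a b)"
proof (rule borel_measurable_iv)
  show "above t \<in> borel_measurable borel" unfolding above_def[abs_def] by measurable
qed

lemma L2_above: "above t \<in> L2 (iv a b)"
  by (rule finite_measure.L2_bounded[OF finite_measure_iv above_section, where C=1]) (simp add: above_def)

lemma kop_above_eq:
  assumes "integrable (iv a b) f"
  shows "kop (iv a b) above f t = (\<integral>s. f s \<partial>iv a b) - kop (iv a b) below f t"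
proof -
  have "kop (iv a b) above f t = (\<integral>s. f s - below t s * f s \<partial>iv a b)"
    unfolding kop_def
  proof (rule integral_cong_AE)
    note [measurable] = borel_measurable_integrable[OF assms] above_section
    show "(\<lambda>s. above t s * f s) \<in> borel_measurable (iv a b)" by measurable
    show "(\<lambda>s. f s - below t s * f s) \<in> borel_measurable (iv a b)" by measurable
    show "AE s in iv a b. above t s * f s = f s - below t s * f s"
      using AE_iv_neq[where c=t] by eventually_elim (auto simp: above_def below_def)
  qed
  then show ?thesis using assms integrable_below[OF assms, of t] by (simp add: kop_def)
qed

text \<open>Up to sign the difference is the indicator of the interval between \<open>s\<close> and
  \<open>t\<close>. This is the source of the Hoelder continuity of time primitives with exponent
  1/2.\<close>

lemma nrm_below_diff:
  assumes "0 \<le> s" "s \<le> T" "0 \<le> t" "t \<le> T"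
  shows "nrm (iv 0 T) (\<lambda>\<tau>. below t \<tau> - below s \<tau>) = sqrt \<bar>t - s\<bar>"
proof -
  have *: "ip (iv 0 T) (\<lambda>\<tau>. below t \<tau> - below s \<tau>) (\<lambda>\<tau>. below t \<tau> - below s \<tau>) = t - s"
    if "0 \<le> s" "s \<le> t" "t \<le> T" for s t
  proof -
    have "ip (iv 0 T) (\<lambda>\<tau>. below t \<tau> - below s \<tau>) (\<lambda>\<tau>. below t \<tau> - below s \<tau>)
        = (\<integral>\<tau>. below t \<tau> - below s \<tau> \<partial>iv 0 T)"
      unfolding ip_def using that by (intro Bochner_Integration.integral_cong) (auto simp: below_def)
    also have "\<dots> = t - s"
      using integrable_below_const integral_below that by simp
    finally show ?thesis .
  qed
  show ?thesis
  proof (cases "s \<le> t")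
    case False
    have "ip (iv 0 T) (\<lambda>\<tau>. below t \<tau> - below s \<tau>) (\<lambda>\<tau>. below t \<tau> - below s \<tau>)
      = ip (iv 0 T) (\<lambda>\<tau>. below s \<tau> - below t \<tau>) (\<lambda>\<tau>. below s \<tau> - below t \<tau>)"
      unfolding ip_def by (intro Bochner_Integration.integral_cong) (auto simp: algebra_simps)
    then show ?thesis using *[of t s] False assms by (simp add: nrm_def)
  qed (use *[of s t] assms in \<open>simp add: nrm_def\<close>)
qed

lemma nrm_above_diff:
  assumes "0 \<le> s" "s \<le> T" "0 \<le> t" "t \<le> T"
  shows "nrm (iv 0 T) (\<lambda>\<tau>. above t \<tau> - above s \<tau>) = sqrt \<bar>t - s\<bar>"
proof -
  have "ip (iv 0 T) (\<lambda>\<tau>. above t \<tau> - above s \<tau>) (\<lambda>\<tau>. above t \<tau> - above s \<tau>)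
    = ip (iv 0 T) (\<lambda>\<tau>. -1 * (below t \<tau> - below s \<tau>)) (\<lambda>\<tau>. -1 * (below t \<tau> - below s \<tau>))"
  proof (rule ip_cong_AE)
    note [measurable] = above_section
    show "(\<lambda>\<tau>. above t \<tau> - above s \<tau>) \<in> borel_measurable (iv 0 T)" by measurable
    then show "(\<lambda>\<tau>. above t \<tau> - above s \<tau>) \<in> borel_measurable (iv 0 T)" .
    show "(\<lambda>\<tau>. -1 * (below t \<tau> - below s \<tau>)) \<in> borel_measurable (iv 0 T)" by measurable
    then show "(\<lambda>\<tau>. -1 * (below t \<tau> - below s \<tau>)) \<in> borel_measurable (iv 0 T)" .
    show "AE \<tau> in iv 0 T. above t \<tau> - above s \<tau> = -1 * (below t \<tau> - below s \<tau>)"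
      using AE_iv_neq[where c=t] AE_iv_neq[where c=s]
      by eventually_elim (auto simp: above_def below_def)
    then show "AE \<tau> in iv 0 T. above t \<tau> - above s \<tau> = -1 * (below t \<tau> - below s \<tau>)" .
  qed
  then have "nrm (iv 0 T) (\<lambda>\<tau>. above t \<tau> - above s \<tau>) = nrm (iv 0 T) (\<lambda>\<tau>. -1 * (below t \<tau> - below s \<tau>))"
    by (simp only: nrm_def)
  then show ?thesis unfolding nrm_cmult using nrm_below_diff[OF assms] by simp
qed

text \<open>The function serves as its own continuous representative: by Cauchy-Schwarz in time, two
  of its time sections differ by at most \<open>sqrt \<bar>t - s\<bar>\<close> times the norm of
  \<open>f\<close>. The general kernel covers \<open>below\<close> and \<open>above\<close> at
  once.\<close>

lemma vanishes_at_timeI: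
  assumes k: "\<And>t. k t \<in> L2 (iv 0 T)" and f: "f \<in> L2 (cm l T)"
    and d: "\<And>s t. s \<in> {0..T} \<Longrightarrow> t \<in> {0..T} \<Longrightarrow> nrm (iv 0 T) (\<lambda>\<tau>. k t \<tau> - k s \<tau>) = sqrt \<bar>t - s\<bar>"
    and c: "\<And>\<tau>. \<tau> \<in> {0<..<T} \<Longrightarrow> k c \<tau> = 0"
  shows "vanishes_at_time l T (tk (iv 0 T) k f) c"
proof -
  interpret finite_pair "iv 0 l" "iv 0 T" by (rule finite_pair_iv)
  have tk: "tk (iv 0 T) k f (x, t) = ip (iv 0 T) (k t) (\<lambda>s. f (x, s))" for x t
    by (simp add: tk_def kop_def ip_def)
  let ?w = "tk (iv 0 T) k f"
  have L: "(\<lambda>x. ?w (x, t)) \<in> L2 (iv 0 l)" for t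
    unfolding tk by (rule L2_section_functional[OF k f])
  have n: "nrm (iv 0 l) (\<lambda>x. ?w (x, t) - ?w (x, s)) \<le> sqrt \<bar>t - s\<bar> * nrm (cm l T) f"
    if "s \<in> {0..T}" "t \<in> {0..T}" for s t
  proof -
    have "ip (iv 0 l) (\<lambda>x. ?w (x, t) - ?w (x, s)) (\<lambda>x. ?w (x, t) - ?w (x, s)) =
      ip (iv 0 l) (\<lambda>x. ip (iv 0 T) (\<lambda>\<tau>. k t \<tau> - k s \<tau>) (\<lambda>\<tau>. f (x, \<tau>)))
        (\<lambda>x. ip (iv 0 T) (\<lambda>\<tau>. k t \<tau> - k s \<tau>) (\<lambda>\<tau>. f (x, \<tau>)))"
    proof -
      have e: "AE x in iv 0 l. ?w (x, t) - ?w (x, s) = ip (iv 0 T) (\<lambda>\<tau>. k t \<tau> - k s \<tau>) (\<lambda>\<tau>. f (x, \<tau>))"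
        using AE_section[OF f] by eventually_elim (simp add: tk ip_diff_left k)
      have m: "(\<lambda>x. ?w (x, t) - ?w (x, s)) \<in> borel_measurable (iv 0 l)"
        "(\<lambda>x. ip (iv 0 T) (\<lambda>\<tau>. k t \<tau> - k s \<tau>) (\<lambda>\<tau>. f (x, \<tau>))) \<in> borel_measurable (iv 0 l)"
        by (rule L2_measurable, intro L2_diff L L2_section_functional k f)+
      show ?thesis by (rule ip_cong_AE[OF m m e e])
    qed
    then show ?thesis
      using L2_section_functional(2)[OF L2_diff[OF k k] f, of t s] d[OF that] by (simp add: nrm_def)
  qed
  show ?thesis
    unfolding vanishes_at_time_def
  proof (intro exI[of _ ?w] conjI ballI)
    fix s assume s: "s \<in> {0..T}"
    have "((\<lambda>t. sqrt \<bar>t - s\<bar> * nrm (cm l T) f) \<longlongrightarrow> sqrt \<bar>s - s\<bar> * nrm (cm l T) f) (at s within {0..T})"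
      by (intro tendsto_intros)
    then have lim: "((\<lambda>t. sqrt \<bar>t - s\<bar> * nrm (cm l T) f) \<longlongrightarrow> 0) (at s within {0..T})" by simp
    show "((\<lambda>t. L2_norm {0<..<l} (\<lambda>x. ?w (x, t) - ?w (x, s))) \<longlongrightarrow> 0) (at s within {0..T})"
    proof (rule tendsto_sandwich[OF _ _ tendsto_const lim])
      show "\<forall>\<^sub>F t in at s within {0..T}. L2_norm {0<..<l} (\<lambda>x. ?w (x, t) - ?w (x, s)) \<le> sqrt \<bar>t - s\<bar> * nrm (cm l T) f"
        using n s by (simp add: L2_norm_eq_nrm eventually_at_filter)
      show "\<forall>\<^sub>F t in at s within {0..T}. 0 \<le> L2_norm {0<..<l} (\<lambda>x. ?w (x, t) - ?w (x, s))"
        by (simp add: L2_norm_eq_nrm)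
    qed
  next
    have "?w (x, c) = 0" for x
      unfolding tk_def kop_def by (simp, rule integral_eq_zero_AE) (use c in \<open>auto intro!: AE_I2\<close>)
    then show "AE x\<in>{0<..<l} in lborel. ?w (x, c) = 0" by simp
  qed (use L in \<open>auto simp: L2_iv\<close>)
qed

lemma vanishes_tk_below:
  assumes "f \<in> L2 (cm l T)"
  shows "vanishes_at_time l T (past T f) 0"
proof (rule vanishes_at_timeI[OF L2_below assms])
  show "nrm (iv 0 T) (\<lambda>\<tau>. below t \<tau> - below s \<tau>) = sqrt \<bar>t - s\<bar>" if "s \<in> {0..T}" "t \<in> {0..T}" for s t
    using that by (intro nrm_below_diff) auto
qed (simp add: below_def)

lemma vanishes_tk_above:
  assumes "f \<in> L2 (cm l T)"
  shows "vanishes_at_time l T (fut T f) T"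
proof (rule vanishes_at_timeI[OF L2_above assms])
  show "nrm (iv 0 T) (\<lambda>\<tau>. above t \<tau> - above s \<tau>) = sqrt \<bar>t - s\<bar>" if "s \<in> {0..T}" "t \<in> {0..T}" for s t
    using that by (intro nrm_above_diff) auto
qed (simp add: above_def)

lemma has_weak_time_deriv_iff:
  "has_weak_time_deriv l T u ut \<longleftrightarrow> u \<in> L2 (cm l T) \<and> ut \<in> L2 (cm l T) \<and>
     (\<forall>\<psi>\<in>C1c 0 T. AE x in iv 0 l.
        (\<integral>t. u (x, t) * deriv \<psi> t \<partial>iv 0 T) = - (\<integral>t. ut (x, t) * \<psi> t \<partial>iv 0 T))"
  by (simp add: has_weak_time_deriv_def L2_cyl AE_iv integral_iv)

lemma time_deriv_tk_below:
  assumes f: "f \<in> L2 (cm l T)"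
  shows "has_weak_time_deriv l T (past T f) f"
proof -
  interpret finite_pair "iv 0 l" "iv 0 T" by (rule finite_pair_iv)
  have "AE x in iv 0 l. (\<integral>t. past T f (x, t) * deriv \<psi> t \<partial>iv 0 T) = - (\<integral>t. f (x, t) * \<psi> t \<partial>iv 0 T)"
    if "\<psi> \<in> C1c 0 T" for \<psi>
    using AE_section[OF f]
    by eventually_elim (simp add: tk_def primitive_by_parts[OF that] B.L2_integrable)
  then show ?thesis
    using f tk_L2_nrm(1)[OF bker_below f] unfolding has_weak_time_deriv_iff by simp
qed

lemma time_deriv_tk_above:
  assumes f: "f \<in> L2 (cm l T)"
  shows "has_weak_time_deriv l T (fut T f) (\<lambda>p. - f p)"
proof -
  interpret finite_pair "iv 0 l" "iv 0 T" by (rule finite_pair_iv)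
  have "AE x in iv 0 l. (\<integral>t. fut T f (x, t) * deriv \<psi> t \<partial>iv 0 T) = - (\<integral>t. - f (x, t) * \<psi> t \<partial>iv 0 T)"
    if \<psi>: "\<psi> \<in> C1c 0 T" for \<psi>
    using AE_section[OF f]
  proof eventually_elim
    case (elim x)
    let ?f = "\<lambda>t. f (x, t)" and ?c = "\<integral>t. f (x, t) \<partial>iv 0 T"
    note D = C1c_props(2)[OF \<psi>]
    have fi: "integrable (iv 0 T) ?f" using elim by (rule B.L2_integrable)
    have i: "integrable (iv 0 T) (deriv \<psi>)" "integrable (iv 0 T) (\<lambda>t. kop (iv 0 T) below ?f t * deriv \<psi> t)"
      using integrable_continuous_mult_iv[OF D B.L2_integrable[OF L2_kop_below[OF elim]]]
        integrable_continuous_mult_iv[OF D, of 0 T "\<lambda>_. 1"] by (simp_all add: mult.commute)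
    have "(\<integral>t. fut T f (x, t) * deriv \<psi> t \<partial>iv 0 T) =
        (\<integral>t. ?c * deriv \<psi> t - kop (iv 0 T) below ?f t * deriv \<psi> t \<partial>iv 0 T)"
      by (simp add: tk_def kop_above_eq[OF fi] left_diff_distrib)
    also have "\<dots> = - (\<integral>t. - f (x, t) * \<psi> t \<partial>iv 0 T)"
      using i primitive_by_parts[OF \<psi> fi] C1c_deriv_integral[OF \<psi>] by simp
    finally show ?case .
  qed
  then show ?thesis
    using L2_minus[OF f] tk_L2_nrm(1)[OF bker_above f zero_le_one] unfolding has_weak_time_deriv_iff by blast
qed

lemma AE_iv_ex:
  assumes "AE t in iv a b. Q t" "a \<le> p" "p < q" "q \<le> b"
  shows "\<exists>t\<in>{p<..<q}. Q t"
proof (rule ccontr)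
  assume "\<not> ?thesis"
  then have n: "t \<in> {p<..<q} \<Longrightarrow> \<not> Q t" for t by blast
  have "AE t in lborel. t \<notin> {p<..<q}"
    using assms(1)[unfolded AE_iv] by eventually_elim (use n assms(2-4) in auto)
  then have "emeasure lborel {p<..<q} = 0"
    by (subst (asm) AE_iff_measurable[of "{p<..<q}"]) auto
  then show False using assms by (simp add: ennreal_eq_0_iff)
qed

text \<open>The null set in the definition of the weak time derivative depends on the test function.
  Countably many test functions leave a common null set in \<open>x\<close>, outside of which du
  Bois-Reymond applies to the section.\<close>

lemma time_deriv_imp_primitive:
  assumes T: "0 < T" and wt: "has_weak_time_deriv l T u ut"
  shows "\<exists>c\<in>L2 (iv 0 l). AE p in cm l T. u p = c (fst p) + past T ut p"
proof -
  interpret finite_pair "iv 0 l" "iv 0 T" by (rule finite_pair_iv)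
  have u: "u \<in> L2 (cm l T)" and ut: "ut \<in> L2 (cm l T)"
    and test: "\<And>\<psi>. \<psi> \<in> C1c 0 T \<Longrightarrow> AE x in iv 0 l.
        (\<integral>t. u (x, t) * deriv \<psi> t \<partial>iv 0 T) = - (\<integral>t. ut (x, t) * \<psi> t \<partial>iv 0 T)"
    using wt by (auto simp: has_weak_time_deriv_iff)
  let ?U = "past T ut"
  have U: "?U \<in> L2 (cm l T)" by (rule tk_L2_nrm(1)[OF bker_below ut]) simp
  note w = L2_diff[OF u U]
  \<comment> \<open>The constant of each section is recovered as the time mean of
    \<open>u - ?U\<close>, which makes it measurable and square integrable in
    \<open>x\<close>.\<close>
  define c where "c = (\<lambda>x. ip (iv 0 T) (\<lambda>_. 1 / T) (\<lambda>t. u (x, t) - ?U (x, t)))"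
  have c: "c \<in> L2 (iv 0 l)"
    unfolding c_def using L2_section_functional(1)[OF B.L2_const w] by simp
  obtain \<Psi> where \<Psi>: "\<And>p q n. 0 < p \<Longrightarrow> p < q \<Longrightarrow> q < T \<Longrightarrow> \<Psi> p q n \<in> C1c 0 T"
    "\<And>p q n. 0 < p \<Longrightarrow> p < q \<Longrightarrow> q < T \<Longrightarrow> deriv (\<Psi> p q n) = dtest 0 T p q n"
    using dtest_C1c[of 0 _ _ T] by metis
  let ?S = "{(p :: real, q :: real, n :: nat). p \<in> \<rat> \<and> q \<in> \<rat> \<and> 0 < p \<and> p < q \<and> q < T}"
  have S: "countable ?S"
  proof (rule countable_subset)
    show "?S \<subseteq> \<rat> \<times> \<rat> \<times> (UNIV :: nat set)" by auto
    show "countable ((\<rat> :: real set) \<times> (\<rat> :: real set) \<times> (UNIV :: nat set))" by (intro countable_SIGMA countable_rat) auto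
  qed
  have "AE x in iv 0 l. \<forall>(p, q, n)\<in>?S. (\<integral>t. u (x, t) * deriv (\<Psi> p q n) t \<partial>iv 0 T)
      = - (\<integral>t. ut (x, t) * \<Psi> p q n t \<partial>iv 0 T)"
    using test \<Psi>(1) by (subst AE_ball_countable[OF S]) auto
  then have "AE x in iv 0 l. AE t in iv 0 T. u (x, t) = c x + ?U (x, t)"
    using AE_section[OF u] AE_section[OF ut] AE_section[OF U]
  proof eventually_elim
    case (elim x)
    let ?w = "\<lambda>t. u (x, t) - ?U (x, t)"
    have i: "integrable (iv 0 T) (\<lambda>t. u (x, t))" "integrable (iv 0 T) (\<lambda>t. ?U (x, t))"
      "integrable (iv 0 T) (\<lambda>t. ut (x, t))"
      using elim by (auto intro: B.L2_integrable)
    have "\<exists>d. AE t in iv 0 T. ?w t = d"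
    proof (rule du_Bois_Reymond[OF T])
      show "integrable (iv 0 T) ?w" using i by simp
      fix p q :: real and n
      assume pq: "p \<in> \<rat>" "q \<in> \<rat>" "0 < p" "p < q" "q < T"
      note \<psi> = \<Psi>[OF pq(3-5), of n]
      have j: "integrable (iv 0 T) (\<lambda>t. u (x, t) * deriv (\<Psi> p q n) t)"
        "integrable (iv 0 T) (\<lambda>t. ?U (x, t) * deriv (\<Psi> p q n) t)"
        using integrable_continuous_mult_iv[OF C1c_props(2)[OF \<psi>(1)] i(1)]
          integrable_continuous_mult_iv[OF C1c_props(2)[OF \<psi>(1)] i(2)] by (simp_all add: mult.commute)
      have "(\<integral>t. u (x, t) * deriv (\<Psi> p q n) t \<partial>iv 0 T) = - (\<integral>t. ut (x, t) * \<Psi> p q n t \<partial>iv 0 T)"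
        using elim(1) pq by blast
      moreover have "(\<integral>t. ?U (x, t) * deriv (\<Psi> p q n) t \<partial>iv 0 T) = - (\<integral>t. ut (x, t) * \<Psi> p q n t \<partial>iv 0 T)"
        using primitive_by_parts[OF \<psi>(1) i(3)] by (simp add: tk_def)
      ultimately show "(\<integral>t. ?w t * dtest 0 T p q n t \<partial>iv 0 T) = 0"
        unfolding \<psi>(2)[symmetric] left_diff_distrib using j by simp
    qed
    then obtain d where d: "AE t in iv 0 T. ?w t = d" by blast
    have "c x = (\<integral>t. 1 / T * d \<partial>iv 0 T)"
      unfolding c_def ip_def using i d by (intro integral_cong_AE) auto
    also have "\<dots> = d" using measure_iv[of 0 T] T by simp
    finally have "c x = d" .
    show ?case using d by eventually_elim (simp add: \<open>c x = d\<close>[symmetric] algebra_simps)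
  qed
  then have "AE p in cm l T. u p = c (fst p) + ?U p"
    using L2_measurable[OF u] L2_measurable[OF U] L2_measurable[OF c] 
    by (intro AE_pairI) (measurable, simp_all)
  with c show ?thesis by blast
qed

text \<open>The representative \<open>w\<close> and the sum of \<open>c\<close> and the primitive
  are both continuous in time into \<open>L\<^sup>2(0, l)\<close>. They agree at almost every time,
  and times of agreement accumulate at \<open>s\<close>, where \<open>w\<close> vanishes.\<close>

lemma vanishes_at_time_primitive:
  assumes T: "0 < T" and s: "s \<in> {0..T}" and c: "c \<in> L2 (iv 0 l)" and f: "f \<in> L2 (cm l T)"
    and u: "AE p in cm l T. u p = c (fst p) + past T f p"
    and v: "vanishes_at_time l T u s"
  shows "AE x in iv 0 l. c x + kop (iv 0 T) below (\<lambda>t. f (x, t)) s = 0"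
proof -
  interpret finite_pair "iv 0 l" "iv 0 T" by (rule finite_pair_iv)
  obtain w where w: "AE p in cm l T. w p = u p" "\<And>t. t \<in> {0..T} \<Longrightarrow> (\<lambda>x. w (x, t)) \<in> L2 (iv 0 l)"
    "((\<lambda>t. nrm (iv 0 l) (\<lambda>x. w (x, t) - w (x, s))) \<longlongrightarrow> 0) (at s within {0..T})"
    "AE x in iv 0 l. w (x, s) = 0"
    using v s unfolding vanishes_at_time_def L2_norm_eq_nrm[OF borel_open[OF open_greaterThanLessThan]]
      L2_iv AE_cyl AE_iv by blast
  let ?k = "\<lambda>t x. ip (iv 0 T) (below t) (\<lambda>\<tau>. f (x, \<tau>))"
  let ?u = "\<lambda>t x. c x + ?k t x"
  have kL: "?k t \<in> L2 (iv 0 l)" for t by (rule L2_section_functional[OF L2_below f])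
  have uL: "?u t \<in> L2 (iv 0 l)" for t by (rule L2_add[OF c kL])
  have cont: "nrm (iv 0 l) (\<lambda>x. ?u s x - ?u t x) \<le> sqrt \<bar>t - s\<bar> * nrm (cm l T) f" if "t \<in> {0..T}" for t
  proof -
    have e: "AE x in iv 0 l. ?u s x - ?u t x = ip (iv 0 T) (\<lambda>\<tau>. below s \<tau> - below t \<tau>) (\<lambda>\<tau>. f (x, \<tau>))"
      using AE_section[OF f] by eventually_elim (simp add: ip_diff_left L2_below)
    have "ip (iv 0 l) (\<lambda>x. ?u s x - ?u t x) (\<lambda>x. ?u s x - ?u t x) =
      ip (iv 0 l) (\<lambda>x. ip (iv 0 T) (\<lambda>\<tau>. below s \<tau> - below t \<tau>) (\<lambda>\<tau>. f (x, \<tau>)))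
        (\<lambda>x. ip (iv 0 T) (\<lambda>\<tau>. below s \<tau> - below t \<tau>) (\<lambda>\<tau>. f (x, \<tau>)))"
      by (rule ip_cong_AE[OF _ _ _ _ e e])
        (rule L2_measurable, intro L2_diff uL L2_section_functional L2_below f)+
    then show ?thesis
      using L2_section_functional(2)[OF L2_diff[OF L2_below L2_below] f, of s t]
        nrm_below_diff[of t T s] s that by (simp add: nrm_def abs_minus_commute)
  qed
  have good: "AE t in iv 0 T. nrm (iv 0 l) (?u t) = nrm (iv 0 l) (\<lambda>x. w (x, t) - w (x, s))"
    using AE_pair_snd[OF u] AE_pair_snd[OF w(1)] AE_space[of "iv 0 T"]
  proof eventually_elim
    case (elim t)
    then have t: "t \<in> {0..T}" by simp
    have e: "AE x in iv 0 l. ?u t x = w (x, t) - w (x, s)"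
      using elim(1,2) w(4) by eventually_elim (simp add: tk_def kop_def ip_def)
    have "ip (iv 0 l) (?u t) (?u t) = ip (iv 0 l) (\<lambda>x. w (x, t) - w (x, s)) (\<lambda>x. w (x, t) - w (x, s))"
      by (rule ip_cong_AE[OF _ _ _ _ e e]) (rule L2_measurable, intro uL L2_diff w(2) t s)+
    then show ?case by (simp add: nrm_def)
  qed
  have "nrm (iv 0 l) (?u s) \<le> 0 + \<epsilon>" if "0 < \<epsilon>" for \<epsilon>
  proof -
    have "((\<lambda>t. sqrt \<bar>t - s\<bar> * nrm (cm l T) f) \<longlongrightarrow> sqrt \<bar>s - s\<bar> * nrm (cm l T) f) (at s within {0..T})"
      by (intro tendsto_intros)
    then have "((\<lambda>t. sqrt \<bar>t - s\<bar> * nrm (cm l T) f + nrm (iv 0 l) (\<lambda>x. w (x, t) - w (x, s))) \<longlongrightarrow> 0) (at s within {0..T})"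
      using tendsto_add[OF _ w(3)] by fastforce
    then have "eventually (\<lambda>t. sqrt \<bar>t - s\<bar> * nrm (cm l T) f + nrm (iv 0 l) (\<lambda>x. w (x, t) - w (x, s)) < \<epsilon>) (at s within {0..T})"
      using that by (rule order_tendstoD)
    then obtain d where d: "0 < d" "\<And>t. t \<in> {0..T} \<Longrightarrow> t \<noteq> s \<Longrightarrow> dist t s < d \<Longrightarrow>
        sqrt \<bar>t - s\<bar> * nrm (cm l T) f + nrm (iv 0 l) (\<lambda>x. w (x, t) - w (x, s)) < \<epsilon>"
      unfolding eventually_at by blast
    \<comment> \<open>An interval on one side of \<open>s\<close>, since \<open>s\<close> may be an
      end point of \<open>[0, T]\<close>; it excludes \<open>s\<close>, about which the punctured
      limit says nothing.\<close>
    have "\<exists>p q. 0 \<le> p \<and> p < q \<and> q \<le> T \<and> s \<notin> {p<..<q} \<and> (\<forall>t\<in>{p<..<q}. dist t s < d)"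
    proof (cases "s = T")
      case True
      then show ?thesis using T d(1)
        by (intro exI[of _ "max 0 (T - d)"] exI[of _ T]) (auto simp: dist_real_def)
    next
      case False
      then show ?thesis using s d(1)
        by (intro exI[of _ s] exI[of _ "min T (s + d)"]) (auto simp: dist_real_def)
    qed
    then obtain p q where pq: "0 \<le> p" "p < q" "q \<le> T" "s \<notin> {p<..<q}" "\<forall>t\<in>{p<..<q}. dist t s < d" by blast
    obtain t where t: "t \<in> {p<..<q}" "nrm (iv 0 l) (?u t) = nrm (iv 0 l) (\<lambda>x. w (x, t) - w (x, s))"
      using AE_iv_ex[OF good pq(1-3)] by blast
    have t': "t \<in> {0..T}" "t \<noteq> s" "dist t s < d" using t(1) pq by auto
    have "nrm (iv 0 l) (?u s) = nrm (iv 0 l) (\<lambda>x. (?u s x - ?u t x) + ?u t x)" by (simp add: algebra_simps)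
    also have "\<dots> \<le> nrm (iv 0 l) (\<lambda>x. ?u s x - ?u t x) + nrm (iv 0 l) (?u t)"
      by (rule nrm_triangle[OF L2_diff[OF uL uL] uL])
    also have "\<dots> \<le> \<epsilon>" using cont[OF t'(1)] d(2)[OF t'] t(2) by simp
    finally show ?thesis by simp
  qed
  then have "nrm (iv 0 l) (?u s) \<le> 0" by (rule field_le_epsilon)
  then have "nrm (iv 0 l) (?u s) = 0" using nrm_nonneg[of "iv 0 l" "?u s"] by linarith
  from nrm_eq_0_AE[OF uL this] show ?thesis by (simp add: ip_def kop_def)
qed

lemma primitive_from_start:
  assumes T: "0 < T" and d: "has_weak_time_deriv l T u ut" and v: "vanishes_at_time l T u 0"
  shows "AE p in cm l T. u p = past T ut p"
proof -
  interpret finite_pair "iv 0 l" "iv 0 T" by (rule finite_pair_iv)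
  obtain c where c: "c \<in> L2 (iv 0 l)" "AE p in cm l T. u p = c (fst p) + past T ut p"
    using time_deriv_imp_primitive[OF T d] by blast
  have "AE x in iv 0 l. c x = 0"
    using vanishes_at_time_primitive[OF T _ c(1) _ c(2) v] d T
    by (simp add: has_weak_time_deriv_iff kop_below_left)
  then have "AE x in iv 0 l. \<forall>t\<in>space (iv 0 T). c (fst (x, t)) = 0"
    by eventually_elim simp
  then have "AE p in cm l T. c (fst p) = 0" by (rule AE_fst_pair)
  with c(2) show ?thesis by eventually_elim simp
qed

text \<open>Vanishing at \<open>T\<close> makes \<open>c\<close> minus the integral over all of
  \<open>(0, T)\<close>; adding the integral up to \<open>t\<close> leaves minus the one from
  \<open>t\<close> to \<open>T\<close>.\<close>

lemma primitive_to_end: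
  assumes T: "0 < T" and d: "has_weak_time_deriv l T u ut" and v: "vanishes_at_time l T u T"
  shows "AE p in cm l T. u p = - fut T ut p"
proof -
  interpret finite_pair "iv 0 l" "iv 0 T" by (rule finite_pair_iv)
  obtain c where c: "c \<in> L2 (iv 0 l)" "AE p in cm l T. u p = c (fst p) + past T ut p"
    using time_deriv_imp_primitive[OF T d] by blast
  have ut: "ut \<in> L2 (cm l T)" using d by (simp add: has_weak_time_deriv_iff)
  have "AE x in iv 0 l. c x + (\<integral>t. ut (x, t) \<partial>iv 0 T) = 0"
    using vanishes_at_time_primitive[OF T _ c(1) ut c(2) v] T by (simp add: kop_below_right)
  then have "AE x in iv 0 l. \<forall>t\<in>space (iv 0 T).
      c (fst (x, t)) + past T ut (x, t) = - fut T ut (x, t)"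
    using AE_section[OF ut] by eventually_elim (auto simp: tk_def kop_above_eq B.L2_integrable)
  then have "AE p in cm l T. c (fst p) + past T ut p = - fut T ut p"
    by (rule AE_fst_pair)
  with c(2) show ?thesis by eventually_elim simp
qed

section \<open>Weak solutions\<close>

text \<open>The coefficient depends on \<open>x\<close> only, so multiplication by it commutes with
  every operator in time; this is how the time independence of the coefficients enters.\<close>

definition cmul :: "(real \<Rightarrow> real) \<Rightarrow> (real \<times> real \<Rightarrow> real) \<Rightarrow> real \<times> real \<Rightarrow> real" where
  "cmul \<rho> f p = \<rho> (fst p) * f p"

lemma Linf_iv:
  assumes "\<rho> \<in> Linf_on {0<..<l}"
  shows "\<rho> \<in> borel_measurable (iv 0 l)" "\<exists>C. AE x in iv 0 l. \<bar>\<rho> x\<bar> \<le> C"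
  using assms unfolding Linf_on_def set_borel_measurable_def
  by (auto simp: borel_measurable_restrict_space_iff AE_iv)

lemma AE_fst_cm: "AE x in iv 0 l. Q x \<Longrightarrow> AE p in cm l T. Q (fst p)"
proof -
  interpret finite_pair "iv 0 l" "iv 0 T" by (rule finite_pair_iv)
  assume "AE x in iv 0 l. Q x"
  then have "AE x in iv 0 l. \<forall>t\<in>space (iv 0 T). Q (fst (x, t))" by simp
  then show ?thesis by (rule AE_fst_pair)
qed

lemma L2_cmul:
  assumes \<rho>: "\<rho> \<in> Linf_on {0<..<l}" and f: "f \<in> L2 (cm l T)"
  shows "cmul \<rho> f \<in> L2 (cm l T)"
proof -
  obtain C where "AE x in iv 0 l. \<bar>\<rho> x\<bar> \<le> C" using Linf_iv[OF \<rho>] by blast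
  then have "AE p in cm l T. \<bar>\<rho> (fst p)\<bar> \<le> C" by (rule AE_fst_cm)
  moreover have "(\<lambda>p. \<rho> (fst p)) \<in> borel_measurable (cm l T)"
    using Linf_iv(1)[OF \<rho>] by measurable
  ultimately show ?thesis unfolding cmul_def[abs_def] by (intro L2_bounded_mult[OF f])
qed

text \<open>\<open>f\<close> stands for an expression in point slopes, known to agree only almost
  everywhere with a Borel function; completeness of \<open>lebesgue\<close> makes it measurable
  there.\<close>

lemma lebesgue_integral_iv:
  fixes f g :: "real \<Rightarrow> real"
  assumes "AE t in iv a b. f t = g t" "g \<in> borel_measurable (iv a b)"
  shows "(LINT t:{a<..<b}|lebesgue. f t) = (\<integral>t. g t \<partial>iv a b)"
proof -
  let ?f = "\<lambda>t. indicator {a<..<b} t *\<^sub>R f t" and ?g = "\<lambda>t. indicator {a<..<b} t *\<^sub>R g t"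
  have g: "?g \<in> borel_measurable lborel"
    using assms(2) by (subst (asm) borel_measurable_restrict_space_iff) auto
  have ae: "AE t in lborel. ?g t = ?f t"
    using assms(1)[unfolded AE_iv] by eventually_elim (auto split: split_indicator)
  have gl: "?g \<in> borel_measurable lebesgue"
    using g by (rule measurable_completion)
  then have fl: "?f \<in> borel_measurable lebesgue"
    using ae by (rule borel_measurable_AE[OF _ AE_completion])
  have "(LINT t:{a<..<b}|lebesgue. f t) = (\<integral>t. ?g t \<partial>lebesgue)"
    unfolding set_lebesgue_integral_def using AE_completion[OF ae] fl gl
    by (intro integral_cong_AE) auto
  also have "\<dots> = (\<integral>t. ?g t \<partial>lborel)" using g by (rule integral_completion)
  also have "\<dots> = (\<integral>t. g t \<partial>iv a b)" by (simp add: integral_restrict_space)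
  finally show ?thesis .
qed

lemma L2_V2_kernels:
  assumes l: "0 < l" and g: "g \<in> L2 (cm l T)"
  shows "L2_V2 l T (pot0 l g) (pot1 l g) g"
proof -
  interpret finite_pair "iv 0 l" "iv 0 T" by (rule finite_pair_iv)
  show ?thesis
    unfolding L2_V2_iff[OF l] using sk_L2_nrm(1)[OF bker_G0[OF l] g] sk_L2_nrm(1)[OF bker_G1[OF l] g] l g by auto
qed

lemma L2_V2_minus:
  assumes l: "0 < l" and "L2_V2 l T u ux uxx"
  shows "L2_V2 l T (\<lambda>p. - u p) (\<lambda>p. - ux p) (\<lambda>p. - uxx p)"
proof -
  interpret finite_pair "iv 0 l" "iv 0 T" by (rule finite_pair_iv)
  show ?thesis
    using assms(2) unfolding L2_V2_iff[OF l] by (auto simp: L2_minus sk_minus)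
qed

lemma L2_V2_tk:
  assumes l: "0 < l" and m: "bker (iv 0 T) (iv 0 T) m C" "0 \<le> C" and g: "g \<in> L2 (cm l T)"
  shows "L2_V2 l T (tk (iv 0 T) m (pot0 l g)) (tk (iv 0 T) m (pot1 l g)) (tk (iv 0 T) m g)"
proof -
  interpret finite_pair "iv 0 l" "iv 0 T" by (rule finite_pair_iv)
  note L = sk_L2_nrm(1)[OF bker_G0[OF l] g less_imp_le[OF l]] sk_L2_nrm(1)[OF bker_G1[OF l] g zero_le_one]
  show ?thesis
    unfolding L2_V2_iff[OF l]
    using tk_L2_nrm(1)[OF m(1) L(1) m(2)] tk_L2_nrm(1)[OF m(1) L(2) m(2)] tk_L2_nrm(1)[OF m(1) g m(2)]
      tk_sk_commute[OF m(1) bker_G0[OF l] g] tk_sk_commute[OF m(1) bker_G1[OF l] g]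
    by (auto intro!: AE_I2)
qed

text \<open>The integral up to \<open>T\<close> supplies the time derivative that a test function
  must have, namely minus the integrand, in all three spatial orders.\<close>

lemma H1_V2_above:
  assumes l: "0 < l" and g: "g \<in> L2 (cm l T)"
  shows "H1_V2 l T (fut T (pot0 l g)) (fut T (pot1 l g))
    (fut T g) (\<lambda>p. - pot0 l g p) (\<lambda>p. - pot1 l g p) (\<lambda>p. - g p)"
proof -
  interpret finite_pair "iv 0 l" "iv 0 T" by (rule finite_pair_iv)
  show ?thesis
    unfolding H1_V2_def
    by (intro conjI L2_V2_tk[OF l bker_above zero_le_one g] L2_V2_minus[OF l] L2_V2_kernels[OF l g]
        time_deriv_tk_above sk_L2_nrm(1)[OF bker_G0[OF l] g less_imp_le[OF l]])
qed

lemma H1_V2_below: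
  assumes l: "0 < l" and g: "g \<in> L2 (cm l T)"
  shows "H1_V2 l T (past T (pot0 l g)) (past T (pot1 l g))
    (past T g) (pot0 l g) (pot1 l g) g"
proof -
  interpret finite_pair "iv 0 l" "iv 0 T" by (rule finite_pair_iv)
  show ?thesis
    unfolding H1_V2_def
    by (intro conjI L2_V2_tk[OF l bker_below zero_le_one g] L2_V2_kernels[OF l g]
        time_deriv_tk_below sk_L2_nrm(1)[OF bker_G0[OF l] g less_imp_le[OF l]])
qed

text \<open>The weak formulations, tested with \<open>v\<^sub>x\<^sub>x = \<integral>\<^sub>t\<^sup>T g\<close> and \<open>v\<^sub>x\<^sub>x = \<integral>\<^sub>0\<^sup>t g\<close> for arbitrary
  \<open>g \<in> L\<^sup>2\<close>. The unknowns are \<open>U = u\<^sub>x\<^sub>x\<close>,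
  \<open>a = u\<^sub>t\<close> and \<open>\<Phi> = \<phi>\<^sub>x\<^sub>x\<close>, \<open>b = \<phi>\<^sub>t\<close>.\<close>

definition forward_form :: "real \<Rightarrow> real \<Rightarrow> (real \<Rightarrow> real) \<Rightarrow> (real \<Rightarrow> real) \<Rightarrow> (real \<Rightarrow> real) \<Rightarrow> (real \<Rightarrow> real)
    \<Rightarrow> (real \<Rightarrow> real) \<Rightarrow> (real \<times> real \<Rightarrow> real) \<Rightarrow> (real \<times> real \<Rightarrow> real) \<Rightarrow> (real \<times> real \<Rightarrow> real) \<Rightarrow> bool" where
  "forward_form l T \<rho> \<mu> Tr r \<kappa> F U a \<longleftrightarrow> U \<in> L2 (cm l T) \<and> a \<in> L2 (cm l T) \<and>
     (AE p in cm l T. pot0 l U p = past T a p) \<and>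
     (\<forall>g\<in>L2 (cm l T).
        ip (cm l T) (cmul \<rho> a) (pot0 l g)
        + ip (cm l T) (cmul \<mu> a) (fut T (pot0 l g))
        + ip (cm l T) (cmul Tr (pot1 l U)) (fut T (pot1 l g))
        + ip (cm l T) (cmul r U) (fut T g)
        + ip (cm l T) (cmul \<kappa> U) g
        = ip (cm l T) F (fut T (pot0 l g)))"

definition adjoint_form :: "real \<Rightarrow> real \<Rightarrow> (real \<Rightarrow> real) \<Rightarrow> (real \<Rightarrow> real) \<Rightarrow> (real \<Rightarrow> real) \<Rightarrow> (real \<Rightarrow> real)
    \<Rightarrow> (real \<Rightarrow> real) \<Rightarrow> (real \<times> real \<Rightarrow> real) \<Rightarrow> (real \<times> real \<Rightarrow> real) \<Rightarrow> (real \<times> real \<Rightarrow> real) \<Rightarrow> bool" where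
  "adjoint_form l T \<rho> \<mu> Tr r \<kappa> W \<Phi> b \<longleftrightarrow> \<Phi> \<in> L2 (cm l T) \<and> b \<in> L2 (cm l T) \<and>
     (AE p in cm l T. pot0 l \<Phi> p = - fut T b p) \<and>
     (\<forall>g\<in>L2 (cm l T).
        - ip (cm l T) (cmul \<rho> b) (pot0 l g)
        - ip (cm l T) (cmul \<mu> b) (past T (pot0 l g))
        + ip (cm l T) (cmul Tr (pot1 l \<Phi>)) (past T (pot1 l g))
        + ip (cm l T) (cmul r \<Phi>) (past T g)
        + ip (cm l T) (cmul \<kappa> \<Phi>) g
        = ip (cm l T) W (past T g))"

lemma integral_sum5:
  fixes f1 f2 f3 f4 f5 g1 g2 g3 g4 g5 :: "'a \<Rightarrow> real"
  assumes "f1 \<in> L2 M" "f2 \<in> L2 M" "f3 \<in> L2 M" "f4 \<in> L2 M" "f5 \<in> L2 M"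
    "g1 \<in> L2 M" "g2 \<in> L2 M" "g3 \<in> L2 M" "g4 \<in> L2 M" "g5 \<in> L2 M"
  shows "(\<integral>x. f1 x * g1 x + f2 x * g2 x + f3 x * g3 x + f4 x * g4 x + f5 x * g5 x \<partial>M)
    = ip M f1 g1 + ip M f2 g2 + ip M f3 g3 + ip M f4 g4 + ip M f5 g5"
  using assms by (simp add: ip_def L2_integrable_mult)

text \<open>For \<open>v = fut T (pot0 l g)\<close> the time derivatives are
  \<open>vt = - pot0 l g\<close> and \<open>vxxt = - g\<close>, so the \<open>\<rho>\<close> and
  \<open>\<kappa>\<close> terms change sign and all five terms get a plus. The initial condition and
  the time derivative merge into \<open>pot0 l U = past T a\<close>.\<close>

lemma forward_weak_solution_form:
  assumes l: "0 < l" and T: "0 < T"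
    and coef: "\<rho> \<in> Linf_on {0<..<l}" "\<mu> \<in> Linf_on {0<..<l}" "Tr \<in> Linf_on {0<..<l}"
      "r \<in> Linf_on {0<..<l}" "\<kappa> \<in> Linf_on {0<..<l}"
    and sol: "forward_weak_solution l T \<rho> \<mu> Tr r \<kappa> F u"
  shows "\<exists>ux U a. L2_V2 l T u ux U \<and> forward_form l T \<rho> \<mu> Tr r \<kappa> F U a"
proof -
  interpret finite_pair "iv 0 l" "iv 0 T" by (rule finite_pair_iv)
  obtain ux U a where V: "L2_V2 l T u ux U" and wt: "has_weak_time_deriv l T u a"
    and v0: "vanishes_at_time l T u 0"
    and weak: "\<And>v vx vxx vt vxt vxxt. H1_V2 l T v vx vxx vt vxt vxxt \<Longrightarrow> vanishes_at_time l T v T \<Longrightarrow>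
           (LINT (x, t):cyl l T|lborel.
               - \<rho> x * a (x, t) * vt (x, t) + \<mu> x * a (x, t) * v (x, t)
               + Tr x * ux (x, t) * vx (x, t) + r x * U (x, t) * vxx (x, t)
               - \<kappa> x * U (x, t) * vxxt (x, t))
           = (LINT (x, t):cyl l T|lborel. F (x, t) * v (x, t))"
    using sol unfolding forward_weak_solution_def by blast
  have u: "u \<in> L2 (cm l T)" and ux: "ux \<in> L2 (cm l T)" and U: "U \<in> L2 (cm l T)"
    and eu: "AE p in cm l T. u p = pot0 l U p"
    and eux: "AE p in cm l T. ux p = pot1 l U p"
    using V unfolding L2_V2_iff[OF l] by auto
  have a: "a \<in> L2 (cm l T)" using wt by (simp add: has_weak_time_deriv_iff)
  note G0 = sk_L2_nrm(1)[OF bker_G0[OF l] _ less_imp_le[OF l]]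
    and G1 = sk_L2_nrm(1)[OF bker_G1[OF l] _ zero_le_one]
    and J = tk_L2_nrm(1)[OF bker_above _ zero_le_one]
  have "AE p in cm l T. pot0 l U p = past T a p"
    using primitive_from_start[OF T wt v0] eu by eventually_elim simp
  moreover have "ip (cm l T) (cmul \<rho> a) (pot0 l g)
        + ip (cm l T) (cmul \<mu> a) (fut T (pot0 l g))
        + ip (cm l T) (cmul Tr (pot1 l U)) (fut T (pot1 l g))
        + ip (cm l T) (cmul r U) (fut T g)
        + ip (cm l T) (cmul \<kappa> U) g
        = ip (cm l T) F (fut T (pot0 l g))" if g: "g \<in> L2 (cm l T)" for g
  proof -
    have "ip (cm l T) (cmul Tr (pot1 l U)) (fut T (pot1 l g))
        = ip (cm l T) (cmul Tr ux) (fut T (pot1 l g))"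
      using eux by (intro ip_cong_AE L2_measurable L2_cmul coef G1 J U ux g) (auto simp: cmul_def)
    moreover have "ip (cm l T) (cmul \<rho> a) (pot0 l g)
        + ip (cm l T) (cmul \<mu> a) (fut T (pot0 l g))
        + ip (cm l T) (cmul Tr ux) (fut T (pot1 l g))
        + ip (cm l T) (cmul r U) (fut T g)
        + ip (cm l T) (cmul \<kappa> U) g = ip (cm l T) F (fut T (pot0 l g))"
      using weak[OF H1_V2_above[OF l g] vanishes_tk_above[OF G0[OF g]]]
      unfolding integral_cyl
      by (subst integral_sum5[symmetric])
        (auto simp: cmul_def ip_def split_beta' intro!: L2_cmul coef G0 G1 J U a ux g)
    ultimately show ?thesis by simp
  qed
  ultimately show ?thesis using V U a unfolding forward_form_def by blast
qed

text \<open>\<open>bker_G1\<close> covers interior points of the interval only, whereas slopes are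
  taken at its end points.\<close>

lemma L2_G1: "0 < l \<Longrightarrow> c \<in> {0..l} \<Longrightarrow> G1 l c \<in> L2 (iv 0 l)"
proof (rule finite_measure.L2_bounded[OF finite_measure_iv, where C=1])
  assume l: "0 < l" "c \<in> {0..l}"
  show "G1 l c \<in> borel_measurable (iv 0 l)"
    unfolding G1_def[abs_def] by (intro borel_measurable_diff below_section borel_measurable_iv) measurable
  have "\<bar>G1 l c y\<bar> \<le> 1" if "y \<in> {0<..<l}" for y
  proof -
    have "0 \<le> (l - y) / l" "(l - y) / l \<le> 1" using that l by (auto simp: field_simps)
    then show ?thesis by (auto simp: G1_def below_def)
  qed
  then show "AE y in iv 0 l. \<bar>G1 l c y\<bar> \<le> 1" by (intro AE_I2) simp
qed

definition slope :: "real \<Rightarrow> real \<Rightarrow> (real \<times> real \<Rightarrow> real) \<Rightarrow> real \<Rightarrow> real" where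
  "slope l c U t = ip (iv 0 l) (G1 l c) (\<lambda>x. U (x, t))"

text \<open>Represents the functional
  \<open>\<integral> (p v\<^sub>x(0, t) + q v\<^sub>x(l, t)) dt\<close> as a pairing with
  \<open>v\<^sub>x\<^sub>x\<close> in \<open>L\<^sup>2\<close>, so that boundary data enter like a
  load.\<close>

definition boundary_load :: "real \<Rightarrow> (real \<Rightarrow> real) \<Rightarrow> (real \<Rightarrow> real) \<Rightarrow> real \<times> real \<Rightarrow> real" where
  "boundary_load l p q = (\<lambda>(x, t). G1 l 0 x * p t + G1 l l x * q t)"

lemma slope_L2:
  assumes "0 < l" "c \<in> {0..l}" "U \<in> L2 (cm l T)"
  shows "slope l c U \<in> L2 (iv 0 T)"
    and "nrm (iv 0 T) (slope l c U) \<le> nrm (iv 0 l) (G1 l c) * nrm (cm l T) U"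
  using finite_pair.L2_section_functional'[OF finite_pair_iv L2_G1[OF assms(1,2)] assms(3)]
  by (auto simp: slope_def[abs_def])

lemma slope_diff:
  assumes "0 < l" "c \<in> {0..l}" "U \<in> L2 (cm l T)" "V \<in> L2 (cm l T)"
  shows "AE t in iv 0 T. slope l c (\<lambda>p. U p - V p) t = slope l c U t - slope l c V t"
  using finite_pair.AE_section'[OF finite_pair_iv assms(3)] finite_pair.AE_section'[OF finite_pair_iv assms(4)]
  by eventually_elim (simp add: slope_def ip_diff_right[OF _ _ L2_G1[OF assms(1,2)]])

lemma L2_boundary_load:
  assumes l: "0 < l" and p: "p \<in> L2 (iv 0 T)" and q: "q \<in> L2 (iv 0 T)"
  shows "boundary_load l p q \<in> L2 (cm l T)"
  using L2_add[OF finite_pair.L2_pair_mult[OF finite_pair_iv L2_G1[OF l, of 0] p]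
      finite_pair.L2_pair_mult[OF finite_pair_iv L2_G1[OF l, of l] q]] l
  by (simp add: boundary_load_def split_beta')

lemma ip_boundary_load:
  assumes l: "0 < l" and p: "p \<in> L2 (iv 0 T)" and q: "q \<in> L2 (iv 0 T)" and U: "U \<in> L2 (cm l T)"
  shows "ip (cm l T) (boundary_load l p q) U = ip (iv 0 T) p (slope l 0 U) + ip (iv 0 T) q (slope l l U)"
proof -
  interpret finite_pair "iv 0 l" "iv 0 T" by (rule finite_pair_iv)
  note W = L2_boundary_load[OF l p q]
  note s = slope_L2(1)[OF l _ U]
  have "ip (cm l T) (boundary_load l p q) U
      = (\<integral>t. p t * slope l 0 U t + q t * slope l l U t \<partial>iv 0 T)"
    unfolding ip_snd[OF W U]
  proof (rule integral_cong_AE)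
    note [measurable] = L2_measurable[OF W] L2_measurable[OF U] L2_measurable[OF p] L2_measurable[OF q]
    show "(\<lambda>t. ip (iv 0 l) (\<lambda>x. boundary_load l p q (x, t)) (\<lambda>x. U (x, t))) \<in> borel_measurable (iv 0 T)"
      unfolding ip_def by measurable
    show "(\<lambda>t. p t * slope l 0 U t + q t * slope l l U t) \<in> borel_measurable (iv 0 T)"
      using l by (intro borel_measurable_add borel_measurable_times L2_measurable[OF p] L2_measurable[OF q]
          L2_measurable[OF s]) auto
    show "AE t in iv 0 T. ip (iv 0 l) (\<lambda>x. boundary_load l p q (x, t)) (\<lambda>x. U (x, t))
        = p t * slope l 0 U t + q t * slope l l U t"
      using AE_section'[OF U]
    proof eventually_elim
      case (elim t)
      have "ip (iv 0 l) (\<lambda>x. boundary_load l p q (x, t)) (\<lambda>x. U (x, t))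
        = ip (iv 0 l) (\<lambda>x. p t * G1 l 0 x + q t * G1 l l x) (\<lambda>x. U (x, t))"
        by (simp add: boundary_load_def mult.commute)
      also have "\<dots> = p t * slope l 0 U t + q t * slope l l U t"
        using elim l by (simp add: ip_add_left L2_cmult L2_G1 ip_cmult_left slope_def)
      finally show ?case .
    qed
  qed
  also have "\<dots> = ip (iv 0 T) p (slope l 0 U) + ip (iv 0 T) q (slope l l U)"
    using l by (simp add: ip_def L2_integrable_mult p q s)
  finally show ?thesis .
qed

text \<open>\<open>p'\<close> and \<open>q'\<close> are the misfits built from point slopes,
  \<open>p\<close> and \<open>q\<close> their Borel representatives. Here
  \<open>v = past T (pot0 l g)\<close> has \<open>vt = pot0 l g\<close> and \<open>vxxt = g\<close>,
  so the signs of the weak form are kept.\<close>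

lemma adjoint_weak_solution_form:
  assumes l: "0 < l" and T: "0 < T"
    and coef: "\<rho> \<in> Linf_on {0<..<l}" "\<mu> \<in> Linf_on {0<..<l}" "Tr \<in> Linf_on {0<..<l}"
      "r \<in> Linf_on {0<..<l}" "\<kappa> \<in> Linf_on {0<..<l}"
    and p: "p \<in> L2 (iv 0 T)" "AE t in iv 0 T. p' t = p t"
    and q: "q \<in> L2 (iv 0 T)" "AE t in iv 0 T. q' t = q t"
    and sol: "adjoint_weak_solution l T \<rho> \<mu> Tr r \<kappa> p' q' \<phi>"
  shows "\<exists>\<phi>x \<Phi> b. L2_V2 l T \<phi> \<phi>x \<Phi> \<and> adjoint_form l T \<rho> \<mu> Tr r \<kappa> (boundary_load l p q) \<Phi> b"
proof -
  interpret finite_pair "iv 0 l" "iv 0 T" by (rule finite_pair_iv)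
  obtain ux U a where V: "L2_V2 l T \<phi> ux U" and wt: "has_weak_time_deriv l T \<phi> a"
    and v0: "vanishes_at_time l T \<phi> T"
    and weak: "\<And>v vx vxx vt vxt vxxt. H1_V2 l T v vx vxx vt vxt vxxt \<Longrightarrow> vanishes_at_time l T v 0 \<Longrightarrow>
           (LINT (x, t):cyl l T|lborel.
               - \<rho> x * a (x, t) * vt (x, t) - \<mu> x * a (x, t) * v (x, t)
               + Tr x * ux (x, t) * vx (x, t) + r x * U (x, t) * vxx (x, t)
               + \<kappa> x * U (x, t) * vxxt (x, t))
           = (LINT t:{0<..<T}|lebesgue. p' t * point_slope 0 l (\<lambda>x. v (x, t)) 0
               + q' t * point_slope 0 l (\<lambda>x. v (x, t)) l)"
    using sol unfolding adjoint_weak_solution_def by blast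
  have u: "\<phi> \<in> L2 (cm l T)" and ux: "ux \<in> L2 (cm l T)" and U: "U \<in> L2 (cm l T)"
    and eu: "AE p in cm l T. \<phi> p = pot0 l U p"
    and eux: "AE p in cm l T. ux p = pot1 l U p"
    using V unfolding L2_V2_iff[OF l] by auto
  have a: "a \<in> L2 (cm l T)" using wt by (simp add: has_weak_time_deriv_iff)
  note G0 = sk_L2_nrm(1)[OF bker_G0[OF l] _ less_imp_le[OF l]]
    and G1 = sk_L2_nrm(1)[OF bker_G1[OF l] _ zero_le_one]
    and J = tk_L2_nrm(1)[OF bker_below _ zero_le_one]
  have "AE p in cm l T. pot0 l U p = - fut T a p"
    using primitive_to_end[OF T wt v0] eu by eventually_elim simp
  moreover have "- ip (cm l T) (cmul \<rho> a) (pot0 l g)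
        - ip (cm l T) (cmul \<mu> a) (past T (pot0 l g))
        + ip (cm l T) (cmul Tr (pot1 l U)) (past T (pot1 l g))
        + ip (cm l T) (cmul r U) (past T g)
        + ip (cm l T) (cmul \<kappa> U) g
        = ip (cm l T) (boundary_load l p q) (past T g)" if g: "g \<in> L2 (cm l T)" for g
  proof -
    let ?v = "past T (pot0 l g)" and ?vxx = "past T g"
    have "ip (cm l T) (cmul Tr (pot1 l U)) (past T (pot1 l g))
        = ip (cm l T) (cmul Tr ux) (past T (pot1 l g))"
      using eux by (intro ip_cong_AE L2_measurable L2_cmul coef G1 J U ux g) (auto simp: cmul_def)
    moreover have "ip (cm l T) (\<lambda>p. - cmul \<rho> a p) (pot0 l g)
        + ip (cm l T) (\<lambda>p. - cmul \<mu> a p) ?v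
        + ip (cm l T) (cmul Tr ux) (past T (pot1 l g))
        + ip (cm l T) (cmul r U) (past T g)
        + ip (cm l T) (cmul \<kappa> U) g = (LINT t:{0<..<T}|lebesgue. p' t * point_slope 0 l (\<lambda>x. ?v (x, t)) 0
               + q' t * point_slope 0 l (\<lambda>x. ?v (x, t)) l)"
      using weak[OF H1_V2_below[OF l g] vanishes_tk_below[OF G0[OF g]]]
      unfolding integral_cyl
      by (subst integral_sum5[symmetric])
        (auto simp: cmul_def split_beta' intro!: L2_minus L2_cmul[OF coef(1) a, unfolded cmul_def[abs_def]]
          L2_cmul[OF coef(2) a, unfolded cmul_def[abs_def]] L2_cmul coef G0 G1 J U a ux g)
    moreover have "(LINT t:{0<..<T}|lebesgue. p' t * point_slope 0 l (\<lambda>x. ?v (x, t)) 0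
               + q' t * point_slope 0 l (\<lambda>x. ?v (x, t)) l) = ip (cm l T) (boundary_load l p q) ?vxx"
    proof -
      note V' = L2_V2_tk[OF l bker_below zero_le_one g]
      note s = slope_L2(1)[OF l _ J[OF g]]
      have c: "0 \<in> {0..l}" "l \<in> {0..l}" using l by auto
      have "AE t in iv 0 T. p' t * point_slope 0 l (\<lambda>x. ?v (x, t)) 0 + q' t * point_slope 0 l (\<lambda>x. ?v (x, t)) l
          = p t * slope l 0 ?vxx t + q t * slope l l ?vxx t"
        using p(2) q(2) L2_V2_point_slope[OF l V' c(1)] L2_V2_point_slope[OF l V' c(2)]
        by eventually_elim (simp add: slope_def)
      then have "(LINT t:{0<..<T}|lebesgue. p' t * point_slope 0 l (\<lambda>x. ?v (x, t)) 0
               + q' t * point_slope 0 l (\<lambda>x. ?v (x, t)) l) = (\<integral>t. p t * slope l 0 ?vxx t + q t * slope l l ?vxx t \<partial>iv 0 T)"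
        using l by (intro lebesgue_integral_iv borel_measurable_add borel_measurable_times L2_measurable[OF s]
            L2_measurable[OF p(1)] L2_measurable[OF q(1)]) auto
      also have "\<dots> = ip (iv 0 T) p (slope l 0 ?vxx) + ip (iv 0 T) q (slope l l ?vxx)"
        using l by (simp add: ip_def L2_integrable_mult p(1) q(1) s)
      finally show ?thesis using ip_boundary_load[OF l p(1) q(1) J[OF g]] by simp
    qed
    ultimately show ?thesis by (simp add: ip_minus_left)
  qed
  ultimately show ?thesis using V U a unfolding adjoint_form_def by blast
qed

section \<open>The energy estimate\<close>

lemma tk_coefficient: "tk B m (cmul \<rho> f) = cmul \<rho> (tk B m f)"
  by (simp add: fun_eq_iff tk_def cmul_def kop_cmult)

lemma ip_primitive_nonneg:
  assumes "g \<in> L2 (iv a b)"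
  shows "0 \<le> ip (iv a b) g (kop (iv a b) below g)" "0 \<le> ip (iv a b) g (kop (iv a b) above g)"
proof -
  interpret finite_measure "iv a b" by (rule finite_measure_iv)
  let ?m = "\<integral>x. g x \<partial>iv a b"
  note gi = L2_integrable[OF assms]
  have i: "integrable (iv a b) (\<lambda>x. g x * kop (iv a b) below g x)"
    by (rule L2_integrable_mult[OF assms L2_kop_below[OF assms]])
  \<comment> \<open>The kernels are transposes, so the two pairings are equal, and their sum is the
    square of the full integral.\<close>
  have 1: "ip (iv a b) g (kop (iv a b) below g) = ip (iv a b) g (kop (iv a b) above g)"
    unfolding ip_commute[of _ g "kop (iv a b) below g"] unfolding ip_def above_eq_transpose
    by (rule kernel_swap[OF finite_measure_iv finite_measure_iv bker_below gi gi])
  also have "\<dots> = (\<integral>x. g x * ?m - g x * kop (iv a b) below g x \<partial>iv a b)"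
    by (simp add: ip_def kop_above_eq[OF gi] right_diff_distrib)
  also have "\<dots> = ?m * ?m - ip (iv a b) g (kop (iv a b) below g)"
    using gi i by (simp add: ip_def)
  finally have "2 * ip (iv a b) g (kop (iv a b) below g) = ?m\<^sup>2" by (simp add: power2_eq_square)
  then show "0 \<le> ip (iv a b) g (kop (iv a b) below g)" using zero_le_power2[of ?m] by linarith
  with 1 show "0 \<le> ip (iv a b) g (kop (iv a b) above g)" by simp
qed

lemma ip_cmul_primitive_nonneg:
  assumes \<rho>: "\<rho> \<in> Linf_on {0<..<l}" "AE x in iv 0 l. 0 \<le> \<rho> x" and f: "f \<in> L2 (cm l T)"
  shows "0 \<le> ip (cm l T) (cmul \<rho> f) (past T f)"
    and "0 \<le> ip (cm l T) (cmul \<rho> f) (fut T f)"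
proof -
  interpret finite_pair "iv 0 l" "iv 0 T" by (rule finite_pair_iv)
  have *: "ip (iv 0 T) (\<lambda>t. cmul \<rho> f (x, t)) g = \<rho> x * ip (iv 0 T) (\<lambda>t. f (x, t)) g" for x g
    by (simp add: cmul_def ip_cmult_left)
  show "0 \<le> ip (cm l T) (cmul \<rho> f) (past T f)"
    unfolding ip_fst[OF L2_cmul[OF \<rho>(1) f] tk_L2_nrm(1)[OF bker_below f zero_le_one]]
    by (rule integral_nonneg_AE, use \<rho>(2) AE_section[OF f] in eventually_elim)
      (simp add: * tk_def ip_primitive_nonneg)
  show "0 \<le> ip (cm l T) (cmul \<rho> f) (fut T f)"
    unfolding ip_fst[OF L2_cmul[OF \<rho>(1) f] tk_L2_nrm(1)[OF bker_above f zero_le_one]]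
    by (rule integral_nonneg_AE, use \<rho>(2) AE_section[OF f] in eventually_elim)
      (simp add: * tk_def ip_primitive_nonneg)
qed

lemma ip_cmul_ge:
  assumes \<rho>: "\<rho> \<in> Linf_on {0<..<l}" "AE x in iv 0 l. c \<le> \<rho> x" and f: "f \<in> L2 (cm l T)"
  shows "c * (nrm (cm l T) f)\<^sup>2 \<le> ip (cm l T) (cmul \<rho> f) f"
proof -
  have "ip (cm l T) (\<lambda>p. c * f p) f \<le> ip (cm l T) (cmul \<rho> f) f"
    unfolding ip_def
  proof (rule integral_mono_AE)
    show "AE p in cm l T. c * f p * f p \<le> cmul \<rho> f p * f p"
      using AE_fst_cm[OF \<rho>(2), of T]
      by eventually_elim (auto simp: cmul_def mult.assoc intro!: mult_right_mono)
  qed (intro L2_integrable_mult L2_cmult L2_cmul \<rho> f)+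
  then show ?thesis by (simp add: ip_cmult_left nrm_square)
qed

text \<open>The form is tested with \<open>g = U\<close>. In the constant, \<open>T\<close> bounds
  the norm of the integral up to \<open>T\<close>, and \<open>l\<^sup>2\<close> that of the Green
  operator: kernel bound \<open>l\<close> times length \<open>l\<close>.\<close>

lemma forward_form_estimate:
  assumes l: "0 < l" and T: "0 < T"
    and coef: "\<rho> \<in> Linf_on {0<..<l}" "\<mu> \<in> Linf_on {0<..<l}" "Tr \<in> Linf_on {0<..<l}"
      "r \<in> Linf_on {0<..<l}" "\<kappa> \<in> Linf_on {0<..<l}"
    and pos: "AE x in iv 0 l. 0 \<le> \<rho> x" "AE x in iv 0 l. 0 \<le> \<mu> x" "AE x in iv 0 l. 0 \<le> Tr x"
      "AE x in iv 0 l. 0 \<le> r x" "AE x in iv 0 l. \<kappa>0 \<le> \<kappa> x" "0 < \<kappa>0"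
    and F: "F \<in> L2 (cm l T)" and form: "forward_form l T \<rho> \<mu> Tr r \<kappa> F U a"
  shows "nrm (cm l T) U \<le> T * l\<^sup>2 / \<kappa>0 * nrm (cm l T) F"
proof -
  interpret finite_pair "iv 0 l" "iv 0 T" by (rule finite_pair_iv)
  let ?I = "past T" and ?J = "fut T" and ?u = "pot0 l U"
  have U: "U \<in> L2 (cm l T)" and a: "a \<in> L2 (cm l T)" and ua: "AE p in cm l T. ?u p = ?I a p"
    using form by (auto simp: forward_form_def)
  note G0 = sk_L2_nrm[OF bker_G0[OF l] _ less_imp_le[OF l]]
    and G1 = sk_L2_nrm(1)[OF bker_G1[OF l] _ zero_le_one]
    and I = tk_L2_nrm(1)[OF bker_below _ zero_le_one]
    and J = tk_L2_nrm[OF bker_above _ zero_le_one]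
  have eq: "ip (cm l T) (cmul \<rho> a) ?u + ip (cm l T) (cmul \<mu> a) (?J ?u)
        + ip (cm l T) (cmul Tr (pot1 l U)) (?J (pot1 l U))
        + ip (cm l T) (cmul r U) (?J U) + ip (cm l T) (cmul \<kappa> U) U = ip (cm l T) F (?J ?u)"
    using form U by (simp add: forward_form_def)
  \<comment> \<open>\<open>u\<close> is the time primitive of \<open>a\<close>, so \<open>a\<close>
    is paired with its own primitive.\<close>
  have 1: "0 \<le> ip (cm l T) (cmul \<rho> a) ?u"
  proof -
    have "ip (cm l T) (cmul \<rho> a) ?u = ip (cm l T) (cmul \<rho> a) (?I a)"
      using ua by (intro ip_cong_AE L2_measurable L2_cmul coef a G0 U I) auto
    then show ?thesis using ip_cmul_primitive_nonneg(1)[OF coef(1) pos(1) a] by simp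
  qed
  \<comment> \<open>Moving the time integration onto \<open>a\<close> produces \<open>u\<close> once
    more and leaves the integral of \<open>\<mu> u\<^sup>2\<close>.\<close>
  have 2: "0 \<le> ip (cm l T) (cmul \<mu> a) (?J ?u)"
  proof -
    have "ip (cm l T) (cmul \<mu> a) (?J ?u) = ip (cm l T) (?I (cmul \<mu> a)) ?u"
      unfolding above_eq_transpose
      by (rule tk_adjoint[OF bker_below _ _ zero_le_one, symmetric]) (intro L2_cmul coef a G0 U)+
    also have "\<dots> = ip (cm l T) (cmul \<mu> ?u) ?u"
      unfolding tk_coefficient using ua by (intro ip_cong_AE L2_measurable L2_cmul coef a G0 U I) (auto simp: cmul_def)
    finally show ?thesis using ip_cmul_ge[OF coef(2) pos(2) G0(1)[OF U]] by simp
  qed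
  have 3: "0 \<le> ip (cm l T) (cmul Tr (pot1 l U)) (?J (pot1 l U))"
    by (rule ip_cmul_primitive_nonneg(2)[OF coef(3) pos(3) G1[OF U]])
  have 4: "0 \<le> ip (cm l T) (cmul r U) (?J U)"
    by (rule ip_cmul_primitive_nonneg(2)[OF coef(4) pos(4) U])
  have 5: "\<kappa>0 * (nrm (cm l T) U)\<^sup>2 \<le> ip (cm l T) (cmul \<kappa> U) U"
    by (rule ip_cmul_ge[OF coef(5) pos(5) U])
  have "\<kappa>0 * (nrm (cm l T) U)\<^sup>2 \<le> ip (cm l T) F (?J ?u)" using eq 1 2 3 4 5 by linarith
  also have "\<dots> \<le> nrm (cm l T) F * nrm (cm l T) (?J ?u)"
    using Cauchy_Schwarz_ip[OF F J(1)[OF G0(1)[OF U]]] by linarith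
  also have "nrm (cm l T) (?J ?u) \<le> T * nrm (cm l T) ?u"
    using J(2)[OF G0(1)[OF U]] measure_iv[of 0 T] T by simp
  also have "nrm (cm l T) ?u \<le> l * l * nrm (cm l T) U"
    using G0(2)[OF U] measure_iv[of 0 l] l by simp
  finally have "\<kappa>0 * (nrm (cm l T) U)\<^sup>2 \<le> nrm (cm l T) F * (T * (l * l * nrm (cm l T) U))"
    using T by (simp add: mult_left_mono)
  then have "(\<kappa>0 * nrm (cm l T) U) * nrm (cm l T) U \<le> (T * l\<^sup>2 * nrm (cm l T) F) * nrm (cm l T) U"
    by (simp add: power2_eq_square mult_ac)
  then have "\<kappa>0 * nrm (cm l T) U \<le> T * l\<^sup>2 * nrm (cm l T) F"
    using nrm_nonneg[of "cm l T" U] T nrm_nonneg[of "cm l T" F]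
    by (cases "nrm (cm l T) U = 0") (auto simp: mult_le_cancel_right)
  then show ?thesis using pos(6) by (simp add: field_simps)
qed

section \<open>Duality\<close>

text \<open>Averaging forward in time over the length \<open>h\<close>: \<open>expk h\<close> is the kernel of the resolvent
  \<open>f \<mapsto> \<psi>\<close>, \<open>\<psi> - h \<psi>' = f\<close>, \<open>\<psi>(T) = 0\<close>.\<close>

definition expk :: "real \<Rightarrow> real \<Rightarrow> real \<Rightarrow> real" where
  "expk h t s = above t s * exp (- (s - t) / h) / h"

abbreviation avg :: "real \<Rightarrow> real \<Rightarrow> (real \<times> real \<Rightarrow> real) \<Rightarrow> real \<times> real \<Rightarrow> real" where
  "avg T h \<equiv> tk (iv 0 T) (expk h)"

lemma bker_expk:
  assumes "0 < h"
  shows "bker (iv a b) (iv c d) (expk h) (1 / h)"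
proof (rule bker_iv)
  show "case_prod (expk h) \<in> borel_measurable (borel \<Otimes>\<^sub>M borel)"
    unfolding expk_def[abs_def] above_def[abs_def] by measurable
  fix x y
  have "exp (- (y - x) / h) \<le> 1" if "x < y" using that assms by (simp add: field_simps)
  then show "\<bar>expk h x y\<bar> \<le> 1 / h"
    using assms by (auto simp: expk_def above_def field_simps)
qed

lemma integral_FTC_iv:
  fixes f F :: "real \<Rightarrow> real"
  assumes "a \<le> p" "p \<le> q" "q \<le> b" and F: "\<And>x. (F has_real_derivative f x) (at x)"
    and f: "continuous_on UNIV f"
  shows "(\<integral>s. indicator {p<..<q} s * f s \<partial>iv a b) = F q - F p"
proof -
  have "(\<integral>s. indicator {p<..<q} s * f s \<partial>iv a b) = (\<integral>s. f s * indicator {p..q} s \<partial>lborel)"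
    unfolding integral_restrict_space[of "{a<..<b}" lborel, simplified]
  proof (rule integral_cong_AE)
    have [measurable]: "f \<in> borel_measurable borel" using f by (intro borel_measurable_continuous_onI)
    show "(\<lambda>s. indicator {a<..<b} s *\<^sub>R (indicator {p<..<q} s * f s)) \<in> borel_measurable lborel"
      "(\<lambda>s. f s * indicator {p..q} s) \<in> borel_measurable lborel" by measurable
    show "AE x in lborel. indicator {a<..<b} x *\<^sub>R (indicator {p<..<q} x * f x) = f x * indicator {p..q} x"
      using AE_lborel_singleton[of p] AE_lborel_singleton[of q]
      by eventually_elim (use assms(1-3) in \<open>auto split: split_indicator\<close>)
  qed
  also have "\<dots> = F q - F p"
    using assms by (intro integral_FTC_Icc_real) (auto simp: continuous_on_eq_continuous_at)
  finally show ?thesis .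
qed

lemma integral_exp_iv:
  fixes k c :: real
  assumes "a \<le> p" "p \<le> q" "q \<le> b" "k \<noteq> 0"
  shows "(\<integral>s. indicator {p<..<q} s * exp (k * s + c) \<partial>iv a b) = (exp (k * q + c) - exp (k * p + c)) / k"
proof -
  have "(\<integral>s. indicator {p<..<q} s * exp (k * s + c) \<partial>iv a b) = exp (k * q + c) / k - exp (k * p + c) / k"
    using assms by (intro integral_FTC_iv) (auto intro!: derivative_eq_intros continuous_intros)
  then show ?thesis by (simp add: diff_divide_distrib)
qed

text \<open>For \<open>t < r\<close> either composition integrates an exponential over
  \<open>(t, r)\<close> and gives \<open>1 - exp (- (r - t) / h)\<close>. Equality of the two orders
  reflects that both kernels depend on the time difference only and vanish on one side.\<close>

lemma kcomp_above_expk: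
  assumes "0 < h" "t \<in> {0<..<T}" "r \<in> {0<..<T}"
  shows "kcomp (iv 0 T) above (expk h) t r = above t r - h * expk h t r"
    and "kcomp (iv 0 T) (expk h) above t r = above t r - h * expk h t r"
proof -
  have z: "(\<integral>s. f s \<partial>iv 0 T) = 0" if "\<And>s. f s = 0" for f :: "real \<Rightarrow> real" using that by simp
  show "kcomp (iv 0 T) above (expk h) t r = above t r - h * expk h t r"
  proof (cases "t < r")
    case True
    have "kcomp (iv 0 T) above (expk h) t r = (\<integral>s. (indicator {t<..<r} s * exp (1 / h * s + (- r / h))) / h \<partial>iv 0 T)"
      unfolding kcomp_def
      by (intro Bochner_Integration.integral_cong)
        (auto simp: above_def expk_def diff_divide_distrib split: split_indicator)
    also have "\<dots> = 1 - exp (- (r - t) / h)"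
      using True assms by (subst integral_divide_zero, subst integral_exp_iv) (auto simp: diff_divide_distrib)
    finally show ?thesis using True assms by (simp add: above_def expk_def)
  next
    case False
    then have "kcomp (iv 0 T) above (expk h) t r = 0"
      unfolding kcomp_def by (intro z) (auto simp: above_def expk_def)
    then show ?thesis using False by (simp add: above_def expk_def)
  qed
  show "kcomp (iv 0 T) (expk h) above t r = above t r - h * expk h t r"
  proof (cases "t < r")
    case True
    have "kcomp (iv 0 T) (expk h) above t r = (\<integral>s. (indicator {t<..<r} s * exp ((- 1 / h) * s + t / h)) / h \<partial>iv 0 T)"
      unfolding kcomp_def
      by (intro Bochner_Integration.integral_cong)
        (auto simp: above_def expk_def diff_divide_distrib split: split_indicator)
    also have "\<dots> = 1 - exp (- (r - t) / h)"
      using True assms by (subst integral_divide_zero, subst integral_exp_iv) (auto simp: diff_divide_distrib)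
    finally show ?thesis using True assms by (simp add: above_def expk_def)
  next
    case False
    then have "kcomp (iv 0 T) (expk h) above t r = 0"
      unfolding kcomp_def by (intro z) (auto simp: above_def expk_def)
    then show ?thesis using False by (simp add: above_def expk_def)
  qed
qed

lemma tk_above_expk:
  assumes h: "0 < h" and f: "f \<in> L2 (cm l T)"
  shows "AE p in cm l T. fut T (avg T h f) p = fut T f p - h * avg T h f p"
    and "AE p in cm l T. avg T h (fut T f) p = fut T f p - h * avg T h f p"
proof -
  interpret finite_pair "iv 0 l" "iv 0 T" by (rule finite_pair_iv)
  have e: "tk (iv 0 T) (kcomp (iv 0 T) above (expk h)) f p = tk (iv 0 T) (\<lambda>t r. above t r - h * expk h t r) f p"
    "tk (iv 0 T) (kcomp (iv 0 T) (expk h) above) f p = tk (iv 0 T) (\<lambda>t r. above t r - h * expk h t r) f p"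
    if "p \<in> space (cm l T)" for p
    using that h kcomp_above_expk[OF h] by (auto intro!: tk_kernel_cong)
  show "AE p in cm l T. fut T (avg T h f) p = fut T f p - h * avg T h f p"
    using tk_comp[OF bker_above bker_expk[OF h] f] tk_diff_kernel[OF bker_above bker_expk[OF h] f, of h] AE_space[of "cm l T"]
    by eventually_elim (simp add: e)
  show "AE p in cm l T. avg T h (fut T f) p = fut T f p - h * avg T h f p"
    using tk_comp[OF bker_expk[OF h] bker_above f] tk_diff_kernel[OF bker_above bker_expk[OF h] f, of h] AE_space[of "cm l T"]
    by eventually_elim (simp add: e)
qed

lemma L2_expk: "0 < h \<Longrightarrow> f \<in> L2 (cm l T) \<Longrightarrow> avg T h f \<in> L2 (cm l T)"
  by (rule finite_pair.tk_L2_nrm(1)[OF finite_pair_iv bker_expk]) auto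

text \<open>\<open>Lop T h (expk h) = (1 - K) / h\<close> is minus the time derivative of \<open>K = avg T h\<close>.\<close>

definition Lop :: "real \<Rightarrow> real \<Rightarrow> (real \<Rightarrow> real \<Rightarrow> real) \<Rightarrow> (real \<times> real \<Rightarrow> real) \<Rightarrow> real \<times> real \<Rightarrow> real" where
  "Lop T h m f p = inverse h * (f p - tk (iv 0 T) m f p)"

lemma L2_Lop:
  assumes "bker (iv 0 T) (iv 0 T) m C" "0 \<le> C" "f \<in> L2 (cm l T)"
  shows "Lop T h m f \<in> L2 (cm l T)"
  unfolding Lop_def[abs_def]
  by (intro L2_cmult L2_diff assms finite_pair.tk_L2_nrm(1)[OF finite_pair_iv assms(1) assms(3,2)])

lemma Lop_cmul: "Lop T h m (cmul \<rho> f) = cmul \<rho> (Lop T h m f)"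
  by (simp add: fun_eq_iff Lop_def tk_coefficient cmul_def algebra_simps)

lemma Lop_adjoint:
  assumes m: "bker (iv 0 T) (iv 0 T) m C" "0 \<le> C" and f: "f \<in> L2 (cm l T)" and g: "g \<in> L2 (cm l T)"
  shows "ip (cm l T) (Lop T h m f) g = ip (cm l T) f (Lop T h (\<lambda>s t. m t s) g)"
proof -
  interpret finite_pair "iv 0 l" "iv 0 T" by (rule finite_pair_iv)
  show ?thesis
    unfolding Lop_def[abs_def]
    using f g tk_L2_nrm(1)[OF m(1) f m(2)] tk_L2_nrm(1)[OF bker_transpose[OF m(1)] g m(2)] tk_adjoint[OF m(1) f g m(2)]
    by (simp add: ip_cmult_left ip_cmult_right ip_diff_left ip_diff_right)
qed

lemma sk_Lop:
  assumes m: "bker (iv 0 T) (iv 0 T) m C" "0 \<le> C" and k: "bker (iv 0 l) (iv 0 l) k D" and f: "f \<in> L2 (cm l T)"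
  shows "AE p in cm l T. sk (iv 0 l) k (Lop T h m f) p = Lop T h m (sk (iv 0 l) k f) p"
proof -
  interpret finite_pair "iv 0 l" "iv 0 T" by (rule finite_pair_iv)
  show ?thesis
    using sk_diff[OF k f tk_L2_nrm(1)[OF m(1) f m(2)]] AE_space[of "cm l T"]
    by eventually_elim (simp add: Lop_def[abs_def] sk_cmult[where f="\<lambda>p. f p - tk (iv 0 T) m f p"] tk_sk_commute[OF m(1) k f])
qed

text \<open>The resolvent identity solved for the average. A test function generated by
  \<open>Lop\<close> of the second derivative of a solution is therefore exactly the averaged
  solution.\<close>

lemma above_Lop:
  assumes h: "0 < h" and f: "f \<in> L2 (cm l T)"
  shows "AE p in cm l T. fut T (Lop T h (expk h) f) p = avg T h f p"
    and "AE p in cm l T. Lop T h (expk h) (fut T f) p = avg T h f p"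
proof -
  interpret finite_pair "iv 0 l" "iv 0 T" by (rule finite_pair_iv)
  show "AE p in cm l T. fut T (Lop T h (expk h) f) p = avg T h f p"
    using tk_diff[OF bker_above f L2_expk[OF h f]] tk_above_expk(1)[OF h f]
    by eventually_elim (use h in \<open>simp add: Lop_def[abs_def] tk_cmult[where f="\<lambda>p. f p - avg T h f p"]\<close>)
  show "AE p in cm l T. Lop T h (expk h) (fut T f) p = avg T h f p"
    using tk_above_expk(2)[OF h f] by eventually_elim (use h in \<open>simp add: Lop_def\<close>)
qed

text \<open>For \<open>g = (f - K f) / h\<close>, with \<open>K\<close> the average, the integral of
  \<open>g\<close> up to \<open>T\<close> is \<open>K f\<close>, and the pairing of the two is
  nonnegative; so the square of the norm of \<open>K f\<close> is at most the inner product of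
  \<open>f\<close> and \<open>K f\<close>. The resulting bound 1 is uniform in \<open>h\<close>,
  unlike the kernel bound \<open>1 / h\<close>.\<close>

lemma expk_contraction:
  assumes h: "0 < h" and f: "f \<in> L2 (cm l T)"
  shows "nrm (cm l T) (avg T h f) \<le> nrm (cm l T) f"
proof -
  interpret finite_pair "iv 0 l" "iv 0 T" by (rule finite_pair_iv)
  let ?K = "avg T h f" and ?L = "Lop T h (expk h) f"
  have K: "?K \<in> L2 (cm l T)" by (rule L2_expk[OF h f])
  have hL: "?L \<in> L2 (cm l T)" by (rule L2_Lop[OF bker_expk[OF h] _ f]) (use h in simp)
  have one: "(\<lambda>_. 1) \<in> Linf_on {0<..<l}" by (auto simp: Linf_on_def set_borel_measurable_def)
  have "0 \<le> ip (cm l T) ?L (fut T ?L)"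
    using ip_cmul_primitive_nonneg(2)[OF one _ hL] by (simp add: cmul_def[abs_def])
  also have "\<dots> = ip (cm l T) ?L ?K"
    using above_Lop(1)[OF h f] by (intro ip_cong_AE L2_measurable hL K tk_L2_nrm(1)[OF bker_above hL]) auto
  also have "\<dots> = inverse h * (ip (cm l T) f ?K - ip (cm l T) ?K ?K)"
    unfolding Lop_def[abs_def] ip_cmult_left using ip_diff_left[OF f K K] by simp
  finally have "ip (cm l T) ?K ?K \<le> ip (cm l T) f ?K" using h by (simp add: zero_le_mult_iff)
  also have "\<dots> \<le> nrm (cm l T) f * nrm (cm l T) ?K" using Cauchy_Schwarz_ip[OF f K] by linarith
  finally have "nrm (cm l T) ?K * nrm (cm l T) ?K \<le> nrm (cm l T) f * nrm (cm l T) ?K"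
    by (simp add: nrm_square[symmetric] power2_eq_square)
  then show ?thesis using nrm_nonneg[of "cm l T" ?K] nrm_nonneg[of "cm l T" f]
    by (cases "nrm (cm l T) ?K = 0") (auto simp: mult_le_cancel_right)
qed

section \<open>Duality for averaged solutions\<close>

lemma ip_cmul_swap: "ip M (cmul \<rho> f) g = ip M (cmul \<rho> g) f"
  by (simp add: ip_def cmul_def mult_ac)

lemma Lop_cong_AE:
  assumes m: "bker (iv 0 T) (iv 0 T) m C" and f: "f \<in> L2 (cm l T)" and g: "g \<in> L2 (cm l T)"
    and e: "AE p in cm l T. f p = g p"
  shows "AE p in cm l T. Lop T h m f p = Lop T h m g p"
  using finite_pair.tk_cong_AE[OF finite_pair_iv m L2_measurable[OF f] L2_measurable[OF g] e] e
  by eventually_elim (simp add: Lop_def)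

lemma Lop_minus: "Lop T h m (\<lambda>p. - f p) p = - Lop T h m f p"
  using finite_pair.tk_minus[OF finite_pair_iv, of 0 T m f p] by (simp add: Lop_def algebra_simps)

lemma ip_above_left:
  assumes "f \<in> L2 (cm l T)" "g \<in> L2 (cm l T)"
  shows "ip (cm l T) (fut T f) g = ip (cm l T) f (past T g)"
  using finite_pair.tk_adjoint[OF finite_pair_iv bker_above assms zero_le_one]
  by (simp add: above_eq_transpose)

lemma L2_above_tk: "f \<in> L2 (cm l T) \<Longrightarrow> fut T f \<in> L2 (cm l T)"
  by (rule finite_pair.tk_L2_nrm(1)[OF finite_pair_iv bker_above]) auto

lemma L2_below_tk: "f \<in> L2 (cm l T) \<Longrightarrow> past T f \<in> L2 (cm l T)"
  by (rule finite_pair.tk_L2_nrm(1)[OF finite_pair_iv bker_below]) auto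

text \<open>The transpose of the second identity in \<open>above_Lop\<close>. It says that the
  transposed \<open>Lop\<close>, followed by the primitive from 0, is the transposed
  average.\<close>

lemma ip_below_Lop:
  assumes h: "0 < h" and X: "X \<in> L2 (cm l T)" and Y: "Y \<in> L2 (cm l T)"
  shows "ip (cm l T) X (past T (Lop T h (\<lambda>s t. expk h t s) Y)) = ip (cm l T) (avg T h X) Y"
proof -
  note m = bker_expk[OF h, of 0 T 0 T]
  have h': "0 \<le> 1 / h" using h by simp
  have "ip (cm l T) X (past T (Lop T h (\<lambda>s t. expk h t s) Y))
      = ip (cm l T) (fut T X) (Lop T h (\<lambda>s t. expk h t s) Y)"
    by (rule ip_above_left[symmetric, OF X L2_Lop[OF bker_transpose[OF m] h' Y]])
  also have "\<dots> = ip (cm l T) (Lop T h (expk h) (fut T X)) Y"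
    by (rule Lop_adjoint[symmetric, OF m h' L2_above_tk[OF X] Y])
  also have "\<dots> = ip (cm l T) (avg T h X) Y"
    using above_Lop(2)[OF h X]
    by (intro ip_cong_AE L2_measurable L2_Lop[OF m h'] L2_above_tk X Y L2_expk h) auto
  finally show ?thesis .
qed

text \<open>The forward form is taken at \<open>g = ?L \<Phi>\<close> and the adjoint form at
  \<open>g = ?Lt U\<close>. Both left sides reduce to the same five pairings of \<open>U\<close>,
  \<open>a\<close> with \<open>\<Phi>\<close>, \<open>b\<close>, so the two load terms must
  agree.\<close>

lemma duality_smoothed:
  assumes l: "0 < l" and h: "0 < h"
    and coef: "\<rho> \<in> Linf_on {0<..<l}" "\<mu> \<in> Linf_on {0<..<l}" "Tr \<in> Linf_on {0<..<l}"
      "r \<in> Linf_on {0<..<l}" "\<kappa> \<in> Linf_on {0<..<l}"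
    and F: "F \<in> L2 (cm l T)" and W: "W \<in> L2 (cm l T)"
    and fwd: "forward_form l T \<rho> \<mu> Tr r \<kappa> F U a" and adj: "adjoint_form l T \<rho> \<mu> Tr r \<kappa> W \<Phi> b"
  shows "ip (cm l T) F (avg T h (pot0 l \<Phi>)) = ip (cm l T) (avg T h W) U"
proof -
  interpret finite_pair "iv 0 l" "iv 0 T" by (rule finite_pair_iv)
  let ?P = "cm l T" and ?I = "past T" and ?J = "fut T"
    and ?S0 = "pot0 l" and ?S1 = "pot1 l"
    and ?K = "avg T h" and ?L = "Lop T h (expk h)" and ?Lt = "Lop T h (\<lambda>s t. expk h t s)"
  have U: "U \<in> L2 ?P" and a: "a \<in> L2 ?P" and ua: "AE p in ?P. ?S0 U p = ?I a p"
    using fwd by (auto simp: forward_form_def)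
  have \<Phi>: "\<Phi> \<in> L2 ?P" and b: "b \<in> L2 ?P" and pb: "AE p in ?P. ?S0 \<Phi> p = - ?J b p"
    using adj by (auto simp: adjoint_form_def)
  note m = bker_expk[OF h, of 0 T 0 T]
  have h': "0 \<le> 1 / h" using h by simp
  note S0 = sk_L2_nrm(1)[OF bker_G0[OF l] _ less_imp_le[OF l]]
    and S1 = sk_L2_nrm(1)[OF bker_G1[OF l] _ zero_le_one]
    and I = L2_below_tk and J = L2_above_tk and K = L2_expk[OF h]
    and L = L2_Lop[OF m h'] and Lt = L2_Lop[OF bker_transpose[OF m] h']
  note mem = L2_measurable L2_cmul coef S0 S1 I J K L Lt U a \<Phi> b F W L2_minus

  \<comment> \<open>A spatial operator passes through \<open>Lop\<close>, which the integral up to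
    \<open>T\<close> then turns into the average; with \<open>G0\<close> and \<open>G1\<close> this
    computes the forward test function and its first derivative.\<close>
  have JS: "AE p in ?P. ?J (sk (iv 0 l) k (?L \<Phi>)) p = ?K (sk (iv 0 l) k \<Phi>) p"
    if k: "bker (iv 0 l) (iv 0 l) k D" "0 \<le> D" for k D
  proof -
    note kL = sk_L2_nrm(1)[OF k(1) _ k(2)]
    show ?thesis
      using tk_cong_AE[OF bker_above L2_measurable[OF kL[OF L[OF \<Phi>]]] L2_measurable[OF L[OF kL[OF \<Phi>]]] sk_Lop[OF m h' k(1) \<Phi>, of h]]
        above_Lop(1)[OF h kL[OF \<Phi>]]
      by eventually_elim simp
  qed
  \<comment> \<open>Minus the time derivative of the averaged \<open>\<phi>\<close>, expressed
    through \<open>b = \<phi>\<^sub>t\<close>.\<close>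
  have Lphi: "AE p in ?P. ?S0 (?L \<Phi>) p = - ?K b p"
    using sk_Lop[OF m h' bker_G0[OF l] \<Phi>, of h] Lop_cong_AE[OF m S0[OF \<Phi>] L2_minus[OF J[OF b]] pb, of h]
      above_Lop(2)[OF h b]
    by eventually_elim (simp add: Lop_minus)
  have Kphi: "AE p in ?P. ?K (?S0 \<Phi>) p = - ?J (?K b) p"
    using tk_cong_AE[OF m L2_measurable[OF S0[OF \<Phi>]] L2_measurable[OF L2_minus[OF J[OF b]]] pb]
      tk_above_expk[OF h b]
    by eventually_elim (simp add: tk_minus)
  have f1: "ip ?P (cmul \<rho> a) (?S0 (?L \<Phi>)) = - ip ?P (cmul \<rho> a) (?K b)"
    unfolding ip_minus_right[symmetric] using Lphi by (intro ip_cong_AE mem) auto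
  have f2: "ip ?P (cmul \<mu> a) (?J (?S0 (?L \<Phi>))) = - ip ?P (cmul \<mu> a) (?J (?K b))"
    unfolding ip_minus_right[symmetric]
  proof (intro ip_cong_AE mem)
    show "AE p in ?P. ?J (?S0 (?L \<Phi>)) p = - ?J (?K b) p"
      using JS[OF bker_G0[OF l] less_imp_le[OF l]] Kphi by eventually_elim simp
  qed auto
  have f3: "ip ?P (cmul Tr (?S1 U)) (?J (?S1 (?L \<Phi>))) = ip ?P (cmul Tr (?S1 U)) (?K (?S1 \<Phi>))"
    using JS[OF bker_G1[OF l] zero_le_one] by (intro ip_cong_AE mem) auto
  have f4: "ip ?P (cmul r U) (?J (?L \<Phi>)) = ip ?P (cmul r U) (?K \<Phi>)"
    using above_Lop(1)[OF h \<Phi>] by (intro ip_cong_AE mem) auto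
  have f6: "ip ?P F (?J (?S0 (?L \<Phi>))) = ip ?P F (?K (?S0 \<Phi>))"
    using JS[OF bker_G0[OF l] less_imp_le[OF l]] by (intro ip_cong_AE mem) auto
  have "ip ?P (cmul \<rho> a) (?S0 (?L \<Phi>)) + ip ?P (cmul \<mu> a) (?J (?S0 (?L \<Phi>)))
      + ip ?P (cmul Tr (?S1 U)) (?J (?S1 (?L \<Phi>))) + ip ?P (cmul r U) (?J (?L \<Phi>))
      + ip ?P (cmul \<kappa> U) (?L \<Phi>) = ip ?P F (?J (?S0 (?L \<Phi>)))"
    using fwd L[OF \<Phi>, of h] unfolding forward_form_def by blast
  then have forward: "- ip ?P (cmul \<rho> a) (?K b) - ip ?P (cmul \<mu> a) (?J (?K b)) + ip ?P (cmul Tr (?S1 U)) (?K (?S1 \<Phi>))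
      + ip ?P (cmul r U) (?K \<Phi>) + ip ?P (cmul \<kappa> U) (?L \<Phi>) = ip ?P F (?K (?S0 \<Phi>))"
    using f1 f2 f3 f4 f6 by linarith

  have IS: "AE p in ?P. ?I (sk (iv 0 l) k (?Lt U)) p = ?I (?Lt (sk (iv 0 l) k U)) p"
    if k: "bker (iv 0 l) (iv 0 l) k D" "0 \<le> D" for k D
  proof -
    note kL = sk_L2_nrm(1)[OF k(1) _ k(2)]
    show ?thesis
      by (rule tk_cong_AE[OF bker_below L2_measurable[OF kL[OF Lt[OF U]]] L2_measurable[OF Lt[OF kL[OF U]]]
          sk_Lop[OF bker_transpose[OF m] h' k(1) U]])
  qed
  \<comment> \<open>Moves the integration in \<open>u = past T a\<close> to the other factor, so
    that adjoint terms containing \<open>u\<close> become the terms in \<open>a\<close> of the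
    forward identity.\<close>
  have adjK: "ip ?P (cmul c x) (?S0 U) = ip ?P (cmul c a) (?J x)"
    if "c \<in> Linf_on {0<..<l}" "x \<in> L2 ?P" for c x
  proof -
    have "ip ?P (cmul c x) (?S0 U) = ip ?P (cmul c x) (?I a)"
      using ua by (intro ip_cong_AE mem that) auto
    also have "\<dots> = ip ?P (?J (cmul c x)) a"
      by (rule ip_above_left[symmetric]) (intro mem that)+
    also have "\<dots> = ip ?P (cmul c a) (?J x)" unfolding tk_coefficient by (rule ip_cmul_swap)
    finally show ?thesis .
  qed
  have a1: "ip ?P (cmul \<rho> b) (?S0 (?Lt U)) = ip ?P (cmul \<rho> a) (?K b)"
  proof -
    have "ip ?P (cmul \<rho> b) (?S0 (?Lt U)) = ip ?P (cmul \<rho> b) (?Lt (?S0 U))"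
      using sk_Lop[OF bker_transpose[OF m] h' bker_G0[OF l] U] by (intro ip_cong_AE mem) auto
    also have "\<dots> = ip ?P (cmul \<rho> (?L b)) (?S0 U)"
      unfolding Lop_cmul[symmetric] by (rule Lop_adjoint[symmetric, OF m h']) (intro mem)+
    also have "\<dots> = ip ?P (cmul \<rho> a) (?J (?L b))" by (rule adjK) (intro mem)+
    also have "\<dots> = ip ?P (cmul \<rho> a) (?K b)"
      using above_Lop(1)[OF h b] by (intro ip_cong_AE mem) auto
    finally show ?thesis .
  qed
  have a2: "ip ?P (cmul \<mu> b) (?I (?S0 (?Lt U))) = ip ?P (cmul \<mu> a) (?J (?K b))"
  proof -
    have "ip ?P (cmul \<mu> b) (?I (?S0 (?Lt U))) = ip ?P (cmul \<mu> b) (?I (?Lt (?S0 U)))"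
      using IS[OF bker_G0[OF l] less_imp_le[OF l]] by (intro ip_cong_AE mem) auto
    also have "\<dots> = ip ?P (cmul \<mu> (?K b)) (?S0 U)"
      unfolding tk_coefficient[symmetric] by (rule ip_below_Lop[OF h]) (intro mem)+
    also have "\<dots> = ip ?P (cmul \<mu> a) (?J (?K b))" by (rule adjK) (intro mem)+
    finally show ?thesis .
  qed
  have a3: "ip ?P (cmul Tr (?S1 \<Phi>)) (?I (?S1 (?Lt U))) = ip ?P (cmul Tr (?S1 U)) (?K (?S1 \<Phi>))"
  proof -
    have "ip ?P (cmul Tr (?S1 \<Phi>)) (?I (?S1 (?Lt U))) = ip ?P (cmul Tr (?S1 \<Phi>)) (?I (?Lt (?S1 U)))"
      using IS[OF bker_G1[OF l] zero_le_one] by (intro ip_cong_AE mem) auto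
    also have "\<dots> = ip ?P (cmul Tr (?K (?S1 \<Phi>))) (?S1 U)"
      unfolding tk_coefficient[symmetric] by (rule ip_below_Lop[OF h]) (intro mem)+
    finally show ?thesis by (simp only: ip_cmul_swap)
  qed
  have a4: "ip ?P (cmul r \<Phi>) (?I (?Lt U)) = ip ?P (cmul r U) (?K \<Phi>)"
    using ip_below_Lop[OF h L2_cmul[OF coef(4) \<Phi>] U] unfolding tk_coefficient by (simp only: ip_cmul_swap)
  have a5: "ip ?P (cmul \<kappa> \<Phi>) (?Lt U) = ip ?P (cmul \<kappa> U) (?L \<Phi>)"
    using Lop_adjoint[OF m h' L2_cmul[OF coef(5) \<Phi>] U, of h] unfolding Lop_cmul by (simp only: ip_cmul_swap)
  have a6: "ip ?P W (?I (?Lt U)) = ip ?P (?K W) U" by (rule ip_below_Lop[OF h W U])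
  have "- ip ?P (cmul \<rho> b) (?S0 (?Lt U)) - ip ?P (cmul \<mu> b) (?I (?S0 (?Lt U)))
      + ip ?P (cmul Tr (?S1 \<Phi>)) (?I (?S1 (?Lt U))) + ip ?P (cmul r \<Phi>) (?I (?Lt U))
      + ip ?P (cmul \<kappa> \<Phi>) (?Lt U) = ip ?P W (?I (?Lt U))"
    using adj Lt[OF U, of h] unfolding adjoint_form_def by blast
  then show ?thesis using forward a1 a2 a3 a4 a5 a6 by linarith
qed

section \<open>Passage to the limit\<close>

lemma (in finite_pair) sk_adjoint:
  assumes m: "bker A A m C" and f: "f \<in> L2 PM" and g: "g \<in> L2 PM" and "0 \<le> C"
  shows "ip PM (sk A m f) g = ip PM f (sk A (\<lambda>s t. m t s) g)"
proof -
  interpret sw: finite_pair B A ..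
  note f' = L2_swap[OF f] and g' = L2_swap[OF g]
  have "ip PM (sk A m f) g = ip (B \<Otimes>\<^sub>M A) (tk A m (\<lambda>(t, x). f (x, t))) (\<lambda>(t, x). g (x, t))"
    using sw.ip_swap[OF sw.tk_L2_nrm(1)[OF m f' \<open>0 \<le> C\<close>] g'] by (simp add: sk_eq split_beta')
  also have "\<dots> = ip (B \<Otimes>\<^sub>M A) (\<lambda>(t, x). f (x, t)) (tk A (\<lambda>s t. m t s) (\<lambda>(t, x). g (x, t)))"
    by (rule sw.tk_adjoint[OF m f' g' \<open>0 \<le> C\<close>])
  also have "\<dots> = ip PM f (sk A (\<lambda>s t. m t s) g)"
    using sw.ip_swap[OF f' sw.tk_L2_nrm(1)[OF bker_transpose[OF m] g' \<open>0 \<le> C\<close>]] by (simp add: sk_eq split_beta')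
  finally show ?thesis .
qed

lemma (in finite_pair) nrm_pair_mult:
  assumes f: "f \<in> L2 A" and g: "g \<in> L2 B"
  shows "nrm PM (\<lambda>(x, t). f x * g t) = nrm A f * nrm B g"
proof -
  have "ip PM (\<lambda>(x, t). f x * g t) (\<lambda>(x, t). f x * g t) = (\<integral>x. ip B (\<lambda>t. f x * g t) (\<lambda>t. f x * g t) \<partial>A)"
    using ip_fst[OF L2_pair_mult[OF f g] L2_pair_mult[OF f g]] by simp
  also have "\<dots> = ip A f f * ip B g g"
    by (simp add: ip_cmult_left ip_cmult_right mult.assoc[symmetric]) (simp add: ip_def[of A])
  finally show ?thesis by (simp add: nrm_def real_sqrt_mult)
qed

text \<open>The squared positive part is differentiable across 0, which gives \<open>G0\<close> an
  antiderivative in \<open>x\<close> on the whole line and lets it be integrated across its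
  kink.\<close>

lemma DERIV_max_square: "((\<lambda>z. (max z 0)\<^sup>2 / 2) has_real_derivative max z 0) (at z)" for z :: real
proof -
  consider "z > 0" | "z < 0" | "z = 0" by linarith
  then show ?thesis
  proof cases
    case 1
    have "((\<lambda>z. z\<^sup>2 / 2) has_real_derivative max z 0) (at z)"
      using 1 by (auto intro!: derivative_eq_intros)
    then show ?thesis
      by (rule has_field_derivative_transform_within_open[of _ _ _ "{0<..}"]) (use 1 in auto)
  next
    case 2
    have "((\<lambda>z. 0) has_real_derivative max z 0) (at z)"
      using 2 by (auto intro!: derivative_eq_intros)
    then show ?thesis
      by (rule has_field_derivative_transform_within_open[of _ _ _ "{..<0}"]) (use 2 in auto)
  next
    case 3
    have "((\<lambda>h. (max h 0)\<^sup>2 / 2 / h) \<longlongrightarrow> 0) (at (0 :: real))"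
    proof (rule Lim_null_comparison[of _ "\<lambda>h. \<bar>h\<bar>"])
      show "\<forall>\<^sub>F h in at (0 :: real). norm ((max h 0)\<^sup>2 / 2 / h) \<le> \<bar>h\<bar>"
        by (rule always_eventually) (auto simp: max_def power2_eq_square)
      show "((\<lambda>h. \<bar>h\<bar>) \<longlongrightarrow> (0::real)) (at 0)" by (auto intro!: tendsto_eq_intros)
    qed
    then show ?thesis using 3 by (simp add: DERIV_def)
  qed
qed

lemma integral_G0_iv:
  assumes "0 < l" "0 \<le> p" "p \<le> q" "q \<le> l"
  shows "(\<integral>x. indicator {p<..<q} x * G0 l x y \<partial>iv 0 l) =
    ((max (q - y) 0)\<^sup>2 / 2 - q\<^sup>2 * (l - y) / (2 * l)) - ((max (p - y) 0)\<^sup>2 / 2 - p\<^sup>2 * (l - y) / (2 * l))"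
proof (rule integral_FTC_iv[OF assms(2-4)])
  fix x
  have "((\<lambda>x. x - y) has_real_derivative 1) (at x)" by (auto intro!: derivative_eq_intros)
  from DERIV_chain2[OF DERIV_max_square this]
  have 1: "((\<lambda>x. (max (x - y) 0)\<^sup>2 / 2) has_real_derivative max (x - y) 0) (at x)" by simp
  have 2: "((\<lambda>x. x\<^sup>2 * (l - y) / (2 * l)) has_real_derivative x * (l - y) / l) (at x)"
    using assms(1) by (auto intro!: derivative_eq_intros simp: field_simps)
  show "((\<lambda>x. (max (x - y) 0)\<^sup>2 / 2 - x\<^sup>2 * (l - y) / (2 * l)) has_real_derivative G0 l x y) (at x)"
    unfolding G0_def by (rule DERIV_diff[OF 1 2])
  show "continuous_on UNIV (\<lambda>x. G0 l x y)"
    unfolding G0_def by (intro continuous_intros) (use assms in auto)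
qed

lemma nrm_le_indicator:
  assumes k: "k \<in> borel_measurable (iv a b)" and d: "a \<le> p" "p \<le> q" "q \<le> b"
    and le: "\<And>x. x \<in> {a<..<b} \<Longrightarrow> \<bar>k x\<bar> \<le> indicator {p..q} x"
  shows "nrm (iv a b) k \<le> sqrt (q - p)"
proof -
  have "AE x in iv a b. k x * k x \<le> indicator {p<..<q} x"
    using AE_iv_neq[where c=p] AE_iv_neq[where c=q] AE_space[of "iv a b"]
  proof eventually_elim
    case (elim x)
    then have "\<bar>k x\<bar> * \<bar>k x\<bar> \<le> indicator {p..q} x * indicator {p..q} x"
      using le[of x] by (intro mult_mono) auto
    then show ?case using elim by (auto split: split_indicator_asm split_indicator simp: abs_mult_self_eq)
  qed
  moreover have "k \<in> L2 (iv a b)"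
    using k by (intro finite_measure.L2_bounded[OF finite_measure_iv, where C=1] AE_I2)
      (auto intro!: order_trans[OF le])
  moreover have "integrable (iv a b) (indicator {p<..<q} :: real \<Rightarrow> real)"
    by (intro finite_measure.integrable_const_bound[OF finite_measure_iv, where B=1] borel_measurable_iv) auto
  ultimately have "ip (iv a b) k k \<le> (\<integral>x. indicator {p<..<q} x \<partial>iv a b)"
    unfolding ip_def by (intro integral_mono_AE L2_integrable_mult)
  also have "\<dots> = q - p" using integral_indicator_iv[OF d(1,3)] d by simp
  finally show ?thesis by (simp add: nrm_def)
qed

lemma L2_indicator_iv: "(\<lambda>x. c * indicator {p<..<q} x) \<in> L2 (iv a b)"
  by (intro L2_cmult finite_measure.L2_bounded[OF finite_measure_iv, where C=1] borel_measurable_iv) auto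

text \<open>Interpolation: the slopes at the ends of \<open>v\<close> are the sum of an average of \<open>v\<close> and a term
  bounded by a small multiple of the norm of \<open>v\<^sub>x\<^sub>x\<close>.\<close>

lemma G1_approx:
  assumes l: "0 < l" and e: "0 < e" and c: "c = 0 \<or> c = l"
  shows "\<exists>\<beta>\<in>L2 (iv 0 l). nrm (iv 0 l) (\<lambda>y. G1 l c y - kop (iv 0 l) (\<lambda>y x. G0 l x y) \<beta> y) \<le> e"
proof -
  \<comment> \<open>The error is at most 1 in absolute value and confined to a strip of width
    \<open>d\<close>, so its norm is at most \<open>sqrt d \<le> e\<close>. The bound
    \<open>l / 2\<close> keeps the strip inside the interval.\<close>
  define d where "d = min (l / 2) (e\<^sup>2)"
  have d: "0 < d" "d < l" "d \<le> e\<^sup>2" using l e by (auto simp: d_def)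
  have sd: "sqrt d \<le> e" using real_sqrt_le_mono[OF d(3)] e by simp
  then have sd': "sqrt (d - 0) \<le> e" "sqrt (l - (l - d)) \<le> e" by simp_all
  have cL: "c \<in> {0..l}" using c l by auto
  let ?T = "\<lambda>\<beta>. kop (iv 0 l) (\<lambda>y x. G0 l x y) \<beta>"
  have T: "?T (\<lambda>x. k * indicator {p<..<q} x) y = k * (\<integral>x. indicator {p<..<q} x * G0 l x y \<partial>iv 0 l)" for k p q y
    unfolding kop_def by (subst integral_mult_right_zero[symmetric]) (simp add: mult_ac)
  have m: "(\<lambda>y. G1 l c y - ?T (\<lambda>x. k * indicator {p<..<q} x) y) \<in> borel_measurable (iv 0 l)" for k p q
    by (intro L2_measurable L2_diff L2_G1 l cL L2_indicator_iv
        finite_measure.kop_L2[OF finite_measure_iv finite_measure_iv bker_transpose[OF bker_G0[OF l]]])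
  show ?thesis
  proof (cases "c = 0")
    case True
    \<comment> \<open>The factor gives the weight on \<open>(0, d)\<close> first moment 1: since
      \<open>v(0) = 0\<close>, the weighted integral of \<open>v\<close> equals
      \<open>v\<^sub>x(0)\<close> to leading order.\<close>
    let ?b = "\<lambda>x. (2 / d\<^sup>2) * indicator {0<..<d} x"
    have "\<bar>G1 l c y - ?T ?b y\<bar> \<le> indicator {0..d} y" if y: "y \<in> {0<..<l}" for y
    proof -
      have "?T ?b y = (max (d - y) 0)\<^sup>2 / d\<^sup>2 - (l - y) / l"
        unfolding T using y d l by (subst integral_G0_iv) (auto simp: field_simps)
      then have "G1 l c y - ?T ?b y = - ((max (d - y) 0) / d)\<^sup>2"
        using True y by (simp add: G1_def below_def power_divide)
      moreover have "((max (d - y) 0) / d)\<^sup>2 \<le> 1"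
        using y d by (intro power_le_one) (auto simp: field_simps)
      ultimately show ?thesis using y d by (auto split: split_indicator)
    qed
    then have "nrm (iv 0 l) (\<lambda>y. G1 l c y - ?T ?b y) \<le> sqrt (d - 0)"
      using d by (intro nrm_le_indicator[OF m]) auto
    from order_trans[OF this sd'(1)] show ?thesis by (rule bexI[where x="?b"]) (rule L2_indicator_iv)
  next
    case False
    then have cl: "c = l" using c by simp
    \<comment> \<open>The mirror image at \<open>l\<close>, with the sign reversed because there
      \<open>v(x)\<close> is \<open>- (l - x) v\<^sub>x(l)\<close> to leading order.\<close>
    let ?b = "\<lambda>x. (- 2 / d\<^sup>2) * indicator {l - d<..<l} x"
    have "\<bar>G1 l c y - ?T ?b y\<bar> \<le> indicator {l - d..l} y" if y: "y \<in> {0<..<l}" for y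
    proof -
      define z where "z = l - y"
      have y': "y = l - z" and z: "0 < z" "z < l" using y by (auto simp: z_def)
      have T': "?T ?b y = (- 2 / d\<^sup>2) * ((z\<^sup>2 / 2 - l\<^sup>2 * z / (2 * l)) - ((max (z - d) 0)\<^sup>2 / 2 - (l - d)\<^sup>2 * z / (2 * l)))"
        unfolding T using y d l by (subst integral_G0_iv) (auto simp: z_def max_def algebra_simps)
      have G: "G1 l c y = 1 - z / l" using y by (simp add: G1_def below_def cl z_def)
      show ?thesis
      proof (cases "z \<le> d")
        case True
        have "G1 l c y - ?T ?b y = (1 - z / d)\<^sup>2"
          unfolding T' G using True d l by (simp add: field_simps power2_eq_square max_def)
        moreover have "(1 - z / d)\<^sup>2 \<le> 1"
          using True z d by (intro power_le_one) (auto simp: field_simps)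
        ultimately show ?thesis using True z by (auto simp: y')
      next
        case False
        have "G1 l c y - ?T ?b y = 0"
          unfolding T' G using False d l by (simp add: field_simps power2_eq_square max_def)
        then show ?thesis by simp
      qed
    qed
    then have "nrm (iv 0 l) (\<lambda>y. G1 l c y - ?T ?b y) \<le> sqrt (l - (l - d))"
      using d by (intro nrm_le_indicator[OF m]) auto
    from order_trans[OF this sd'(2)] show ?thesis by (rule bexI[where x="?b"]) (rule L2_indicator_iv)
  qed
qed

lemma ip_expk_eq_Lop:
  assumes h: "0 < h" and w: "w \<in> L2 (cm l T)" and U: "U \<in> L2 (cm l T)"
  shows "ip (cm l T) w U - ip (cm l T) (avg T h w) U = h * ip (cm l T) (Lop T h (expk h) w) U"
    and "ip (cm l T) U w - ip (cm l T) U (avg T h w) = h * ip (cm l T) U (Lop T h (expk h) w)"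
proof -
  show "ip (cm l T) w U - ip (cm l T) (avg T h w) U = h * ip (cm l T) (Lop T h (expk h) w) U"
    unfolding Lop_def[abs_def] ip_cmult_left using h ip_diff_left[OF w L2_expk[OF h w] U] by simp
  show "ip (cm l T) U w - ip (cm l T) U (avg T h w) = h * ip (cm l T) U (Lop T h (expk h) w)"
    unfolding Lop_def[abs_def] ip_cmult_right using h ip_diff_right[OF w L2_expk[OF h w] U] by simp
qed

text \<open>\<open>G1 l c\<close> is split by \<open>G1_approx\<close>. The small part remains small
  under averaging, uniformly in \<open>h\<close>, by contraction. The rest is a transposed Green
  potential, so pairing it with \<open>U\<close> means pairing \<open>\<beta> x * p t\<close> with
  \<open>u\<close>, and \<open>a = u\<^sub>t\<close> gives an error of order
  \<open>h\<close>.\<close>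

lemma expk_tendsto_separated:
  assumes l: "0 < l" and c: "c = 0 \<or> c = l" and p: "p \<in> L2 (iv 0 T)"
    and U: "U \<in> L2 (cm l T)" and a: "a \<in> L2 (cm l T)"
    and ua: "AE p in cm l T. pot0 l U p = past T a p"
  shows "((\<lambda>h. ip (cm l T) (avg T h (\<lambda>(x, t). G1 l c x * p t)) U)
    \<longlongrightarrow> ip (cm l T) (\<lambda>(x, t). G1 l c x * p t) U) (at_right 0)"
proof (rule tendstoI)
  interpret finite_pair "iv 0 l" "iv 0 T" by (rule finite_pair_iv)
  fix \<epsilon> :: real assume \<epsilon>: "0 < \<epsilon>"
  let ?P = "cm l T" and ?w = "\<lambda>(x, t). G1 l c x * p t" and ?G = "\<lambda>y x. G0 l x y"
  note G = bker_transpose[OF bker_G0[OF l]]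
  \<comment> \<open>The summand 1 keeps the divisor positive. The threshold
    \<open>\<epsilon> / (4 * M)\<close> lets the small part cost \<open>\<epsilon> / 4\<close> with
    the average and \<open>\<epsilon> / 4\<close> without it, leaving \<open>\<epsilon> / 2\<close>
    for the term of order \<open>h\<close>.\<close>
  define M where "M = nrm (iv 0 T) p * nrm ?P U + 1"
  have M: "1 \<le> M" by (simp add: M_def)
  obtain \<beta> where \<beta>: "\<beta> \<in> L2 (iv 0 l)"
    and le: "nrm (iv 0 l) (\<lambda>y. G1 l c y - kop (iv 0 l) ?G \<beta> y) \<le> \<epsilon> / (4 * M)"
    using G1_approx[OF l _ c, of "\<epsilon> / (4 * M)"] \<epsilon> M by auto
  let ?\<alpha> = "\<lambda>y. G1 l c y - kop (iv 0 l) ?G \<beta> y"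
  have cl: "c \<in> {0..l}" using c l by auto
  have \<alpha>: "?\<alpha> \<in> L2 (iv 0 l)"
    by (intro L2_diff L2_G1 l cl A.kop_L2[OF finite_measure_iv G \<beta>])
  let ?wa = "\<lambda>(x, t). ?\<alpha> x * p t" and ?wb = "\<lambda>(x, t). \<beta> x * p t"
  have wa: "?wa \<in> L2 ?P" and wb: "?wb \<in> L2 ?P" and w: "?w \<in> L2 ?P"
    by (intro L2_pair_mult \<alpha> \<beta> p L2_G1 l cl)+
  let ?v = "sk (iv 0 l) ?G ?wb"
  have v: "?v \<in> L2 ?P" by (rule sk_L2_nrm(1)[OF G wb less_imp_le[OF l]])
  have split: "?w q = ?wa q + ?v q" for q
  proof (cases q)
    case (Pair x t)
    have "kop (iv 0 l) ?G (\<lambda>y. \<beta> y * p t) x = kop (iv 0 l) ?G (\<lambda>y. p t * \<beta> y) x" by (simp only: mult.commute)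
    also have "\<dots> = p t * kop (iv 0 l) ?G \<beta> x" by (rule kop_cmult)
    finally show ?thesis by (simp add: Pair sk_def left_diff_distrib)
  qed
  define C where "C = nrm ?P ?wb * nrm ?P a"
  have bound: "\<bar>ip ?P (avg T h ?w) U - ip ?P ?w U\<bar> \<le> \<epsilon> / 2 + h * C" if h: "0 < h" for h
  proof -
    let ?K = "avg T h" and ?L = "Lop T h (expk h)"
    note m = bker_expk[OF h, of 0 T 0 T]
    have h': "0 \<le> 1 / h" using h by simp
    note L = L2_Lop[OF m h', where h=h] and K = L2_expk[OF h]
    have "AE q in ?P. ?K ?w q = ?K ?wa q + ?K ?v q"
      using tk_add[OF m wa v] unfolding split[symmetric] by simp
    then have "ip ?P (?K ?w) U = ip ?P (\<lambda>q. ?K ?wa q + ?K ?v q) U"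
      by (intro ip_cong_AE L2_measurable K w U L2_add wa v) auto
    also have "\<dots> = ip ?P (?K ?wa) U + ip ?P (?K ?v) U"
      by (intro ip_add_left K wa v U)
    finally have Kw: "ip ?P (?K ?w) U = ip ?P (?K ?wa) U + ip ?P (?K ?v) U" .
    have ww: "ip ?P ?w U = ip ?P ?wa U + ip ?P ?v U"
      using ip_add_left[OF wa v U] unfolding split[symmetric] by simp
    \<comment> \<open>The Green operator is transposed onto \<open>U\<close>, which produces
      \<open>u\<close>; the time integration in \<open>u\<close> is then transposed onto
      \<open>Lop\<close>, which it turns into the bounded average.\<close>
    have "ip ?P (?L ?v) U = ip ?P (sk (iv 0 l) ?G (?L ?wb)) U"
      using sk_Lop[OF m h' G wb, of h] by (intro ip_cong_AE L2_measurable L v U wb sk_L2_nrm(1)[OF G _ less_imp_le[OF l]]) auto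
    also have "\<dots> = ip ?P (?L ?wb) (pot0 l U)"
      by (rule sk_adjoint[OF G L[OF wb] U less_imp_le[OF l]])
    also have "\<dots> = ip ?P (?L ?wb) (past T a)"
      using ua by (intro ip_cong_AE L2_measurable L wb L2_below_tk a U sk_L2_nrm(1)[OF bker_G0[OF l] _ less_imp_le[OF l]]) auto
    also have "\<dots> = ip ?P (fut T (?L ?wb)) a"
      by (rule ip_above_left[symmetric, OF L[OF wb] a])
    also have "\<dots> = ip ?P (?K ?wb) a"
      using above_Lop(1)[OF h wb] by (intro ip_cong_AE L2_measurable L wb L2_above_tk a K) auto
    finally have "ip ?P ?v U - ip ?P (?K ?v) U = h * ip ?P (?K ?wb) a"
      using ip_expk_eq_Lop(1)[OF h v U] by simp
    moreover have "\<bar>ip ?P (?K ?wb) a\<bar> \<le> C"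
      unfolding C_def using Cauchy_Schwarz_ip[OF K[OF wb] a] expk_contraction[OF h wb]
      by (meson mult_right_mono nrm_nonneg order_trans)
    ultimately have 1: "\<bar>ip ?P ?v U - ip ?P (?K ?v) U\<bar> \<le> h * C"
      using h by (simp add: abs_mult)
    have na: "nrm ?P ?wa * nrm ?P U \<le> \<epsilon> / 4"
    proof -
      have "nrm ?P ?wa * nrm ?P U = nrm (iv 0 l) ?\<alpha> * (nrm (iv 0 T) p * nrm ?P U)"
        by (simp add: nrm_pair_mult[OF \<alpha> p])
      also have "\<dots> \<le> \<epsilon> / (4 * M) * M"
        using le \<epsilon> M by (intro mult_mono) (auto simp: M_def)
      also have "\<dots> = \<epsilon> / 4" using M by simp
      finally show ?thesis .
    qed
    have "\<bar>ip ?P ?wa U\<bar> \<le> \<epsilon> / 4"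
      using Cauchy_Schwarz_ip[OF wa U] na by linarith
    moreover have "\<bar>ip ?P (?K ?wa) U\<bar> \<le> nrm ?P ?wa * nrm ?P U"
      using Cauchy_Schwarz_ip[OF K[OF wa] U] expk_contraction[OF h wa]
      by (meson mult_right_mono nrm_nonneg order_trans)
    ultimately show ?thesis using 1 na unfolding Kw ww by linarith
  qed
  have C0: "0 \<le> C" by (simp add: C_def)
  have "eventually (\<lambda>h::real. 0 < h \<and> h < \<epsilon> / (2 * (C + 1))) (at_right 0)"
    unfolding eventually_at_right_field using \<epsilon> C0 by (intro exI[of _ "\<epsilon> / (2 * (C + 1))"]) simp
  then show "\<forall>\<^sub>F h in at_right 0. dist (ip ?P (avg T h ?w) U) (ip ?P ?w U) < \<epsilon>"
  proof eventually_elim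
    case (elim h)
    then have "h * (C + 1) < \<epsilon> / 2" using C0 by (simp add: field_simps)
    then have "h * C < \<epsilon> / 2" using elim by (simp add: algebra_simps)
    then show ?case using bound[of h] elim by (simp add: dist_real_def)
  qed
qed

text \<open>The averaged identity is followed as \<open>h\<close> decreases to 0. On the side of the
  load, \<open>\<phi>\<close> minus its average is \<open>h\<close> times \<open>Lop\<close> of
  \<open>\<phi>\<close>, that is \<open>- h\<close> times the average of \<open>b\<close>, hence of
  order \<open>h\<close> by contraction.\<close>

lemma duality:
  assumes l: "0 < l"
    and coef: "\<rho> \<in> Linf_on {0<..<l}" "\<mu> \<in> Linf_on {0<..<l}" "Tr \<in> Linf_on {0<..<l}"
      "r \<in> Linf_on {0<..<l}" "\<kappa> \<in> Linf_on {0<..<l}"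
    and F: "F \<in> L2 (cm l T)" and p: "p \<in> L2 (iv 0 T)" and q: "q \<in> L2 (iv 0 T)"
    and fwd: "forward_form l T \<rho> \<mu> Tr r \<kappa> F U a"
    and adj: "adjoint_form l T \<rho> \<mu> Tr r \<kappa> (boundary_load l p q) \<Phi> b"
  shows "ip (cm l T) F (pot0 l \<Phi>) = ip (cm l T) (boundary_load l p q) U"
proof -
  interpret finite_pair "iv 0 l" "iv 0 T" by (rule finite_pair_iv)
  let ?P = "cm l T" and ?\<phi> = "pot0 l \<Phi>" and ?W = "boundary_load l p q"
  let ?w0 = "\<lambda>(x, t). G1 l 0 x * p t" and ?wl = "\<lambda>(x, t). G1 l l x * q t"
  have U: "U \<in> L2 ?P" and a: "a \<in> L2 ?P" and ua: "AE p in ?P. pot0 l U p = past T a p"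
    using fwd by (auto simp: forward_form_def)
  have \<Phi>: "\<Phi> \<in> L2 ?P" and b: "b \<in> L2 ?P" and pb: "AE p in ?P. ?\<phi> p = - fut T b p"
    using adj by (auto simp: adjoint_form_def)
  have \<phi>: "?\<phi> \<in> L2 ?P" by (rule sk_L2_nrm(1)[OF bker_G0[OF l] \<Phi> less_imp_le[OF l]])
  have W: "?W \<in> L2 ?P" by (rule L2_boundary_load[OF l p q])
  have w0: "?w0 \<in> L2 ?P" and wl: "?wl \<in> L2 ?P"
    using l by (auto intro!: L2_pair_mult p q L2_G1)
  have Ww: "?W = (\<lambda>z. ?w0 z + ?wl z)" by (auto simp: boundary_load_def)
  have "((\<lambda>h. ip ?P (avg T h ?w0) U + ip ?P (avg T h ?wl) U) \<longlongrightarrow> ip ?P ?w0 U + ip ?P ?wl U) (at_right 0)"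
    by (intro tendsto_add expk_tendsto_separated[OF l _ _ U a ua] p q) auto
  moreover have "ip ?P ?w0 U + ip ?P ?wl U = ip ?P ?W U"
    unfolding Ww by (rule ip_add_left[OF w0 wl U, symmetric])
  moreover have "ip ?P (avg T h ?w0) U + ip ?P (avg T h ?wl) U = ip ?P F (avg T h ?\<phi>)"
    if h: "0 < h" for h
  proof -
    have "ip ?P (avg T h ?w0) U + ip ?P (avg T h ?wl) U
        = ip ?P (\<lambda>z. avg T h ?w0 z + avg T h ?wl z) U"
      by (intro ip_add_left[symmetric] L2_expk h w0 wl U)
    also have "\<dots> = ip ?P (avg T h ?W) U"
      using tk_add[OF bker_expk[OF h] w0 wl] unfolding Ww[symmetric]
      by (intro ip_cong_AE L2_measurable L2_add L2_expk h w0 wl U W) auto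
    also have "\<dots> = ip ?P F (avg T h ?\<phi>)"
      by (rule duality_smoothed[symmetric, OF l h coef F W fwd adj])
    finally show ?thesis .
  qed
  then have "eventually (\<lambda>h. ip ?P (avg T h ?w0) U + ip ?P (avg T h ?wl) U
      = ip ?P F (avg T h ?\<phi>)) (at_right 0)"
    unfolding eventually_at_right_field by (intro exI[of _ 1]) simp
  ultimately have 1: "((\<lambda>h. ip ?P F (avg T h ?\<phi>)) \<longlongrightarrow> ip ?P ?W U) (at_right 0)"
    using Lim_transform_eventually by fastforce
  have 2: "((\<lambda>h. ip ?P F (avg T h ?\<phi>)) \<longlongrightarrow> ip ?P F ?\<phi>) (at_right 0)"
  proof (rule Lim_transform_bound[of "\<lambda>h. ip ?P F (avg T h ?\<phi>) - ip ?P F ?\<phi>" _, THEN LIM_zero_cancel])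
    show "((\<lambda>h. h * (nrm ?P F * nrm ?P b)) \<longlongrightarrow> 0) (at_right 0)"
      by (auto intro!: tendsto_eq_intros)
    have "\<bar>ip ?P F (avg T h ?\<phi>) - ip ?P F ?\<phi>\<bar> \<le> h * (nrm ?P F * nrm ?P b)" if h: "0 < h" for h
    proof -
      note m = bker_expk[OF h, of 0 T 0 T]
      have h': "0 \<le> 1 / h" using h by simp
      have "AE z in ?P. Lop T h (expk h) ?\<phi> z = - avg T h b z"
        using Lop_cong_AE[OF m \<phi> L2_minus[OF L2_above_tk[OF b]] pb, of h] above_Lop(2)[OF h b]
        by eventually_elim (simp add: Lop_minus)
      then have "ip ?P F (Lop T h (expk h) ?\<phi>) = ip ?P F (\<lambda>z. - avg T h b z)"
        by (intro ip_cong_AE L2_measurable F L2_Lop[OF m h'] \<phi> L2_minus L2_expk h b) auto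
      then have "ip ?P F ?\<phi> - ip ?P F (avg T h ?\<phi>) = - h * ip ?P F (avg T h b)"
        using ip_expk_eq_Lop(2)[OF h \<phi> F] by (simp add: ip_minus_right)
      moreover have "\<bar>ip ?P F (avg T h b)\<bar> \<le> nrm ?P F * nrm ?P b"
        using Cauchy_Schwarz_ip[OF F L2_expk[OF h b]] expk_contraction[OF h b]
        by (meson mult_left_mono nrm_nonneg order_trans)
      ultimately show ?thesis using h by (simp add: abs_mult abs_minus_commute)
    qed
    then show "\<forall>\<^sub>F h in at_right 0. norm (ip ?P F (avg T h ?\<phi>) - ip ?P F ?\<phi>) \<le> norm (h * (nrm ?P F * nrm ?P b))"
      unfolding eventually_at_right_field by (intro exI[of _ 1]) (simp add: abs_mult)
  qed
  show ?thesis by (rule tendsto_unique[OF _ 2 1]) simp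
qed

section \<open>The gradient\<close>

lemma cmul_diff: "cmul \<rho> (\<lambda>p. f p - g p) = (\<lambda>p. cmul \<rho> f p - cmul \<rho> g p)"
  by (simp add: fun_eq_iff cmul_def right_diff_distrib)

text \<open>An increment need not itself be an admissible load, so no solution is assumed for it;
  the difference of two admissible solutions takes that role.\<close>

lemma forward_form_diff:
  assumes l: "0 < l"
    and coef: "\<rho> \<in> Linf_on {0<..<l}" "\<mu> \<in> Linf_on {0<..<l}" "Tr \<in> Linf_on {0<..<l}"
      "r \<in> Linf_on {0<..<l}" "\<kappa> \<in> Linf_on {0<..<l}"
    and F: "F1 \<in> L2 (cm l T)" "F2 \<in> L2 (cm l T)"
    and 1: "forward_form l T \<rho> \<mu> Tr r \<kappa> F1 U1 a1" and 2: "forward_form l T \<rho> \<mu> Tr r \<kappa> F2 U2 a2"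
  shows "forward_form l T \<rho> \<mu> Tr r \<kappa> (\<lambda>p. F1 p - F2 p) (\<lambda>p. U1 p - U2 p) (\<lambda>p. a1 p - a2 p)"
proof -
  interpret finite_pair "iv 0 l" "iv 0 T" by (rule finite_pair_iv)
  let ?P = "cm l T" and ?J = "fut T" and ?S0 = "pot0 l" and ?S1 = "pot1 l"
  have U: "U1 \<in> L2 ?P" "U2 \<in> L2 ?P" and a: "a1 \<in> L2 ?P" "a2 \<in> L2 ?P"
    and ua: "AE p in ?P. ?S0 U1 p = past T a1 p" "AE p in ?P. ?S0 U2 p = past T a2 p"
    using 1 2 by (auto simp: forward_form_def)
  note S0 = sk_L2_nrm(1)[OF bker_G0[OF l] _ less_imp_le[OF l]]
    and S1 = sk_L2_nrm(1)[OF bker_G1[OF l] _ zero_le_one]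
  note mem = L2_measurable L2_cmul coef S0 S1 L2_above_tk L2_diff U a F
  have "AE p in ?P. ?S0 (\<lambda>p. U1 p - U2 p) p = past T (\<lambda>p. a1 p - a2 p) p"
    using sk_diff[OF bker_G0[OF l] U] tk_diff[OF bker_below a] ua by eventually_elim simp
  moreover have "ip ?P (cmul \<rho> (\<lambda>p. a1 p - a2 p)) (?S0 g) + ip ?P (cmul \<mu> (\<lambda>p. a1 p - a2 p)) (?J (?S0 g))
      + ip ?P (cmul Tr (?S1 (\<lambda>p. U1 p - U2 p))) (?J (?S1 g)) + ip ?P (cmul r (\<lambda>p. U1 p - U2 p)) (?J g)
      + ip ?P (cmul \<kappa> (\<lambda>p. U1 p - U2 p)) g = ip ?P (\<lambda>p. F1 p - F2 p) (?J (?S0 g))"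
    if g: "g \<in> L2 ?P" for g
  proof -
    have e1: "ip ?P (cmul \<rho> a1) (?S0 g) + ip ?P (cmul \<mu> a1) (?J (?S0 g)) + ip ?P (cmul Tr (?S1 U1)) (?J (?S1 g))
        + ip ?P (cmul r U1) (?J g) + ip ?P (cmul \<kappa> U1) g = ip ?P F1 (?J (?S0 g))"
      using 1 g unfolding forward_form_def by blast
    have e2: "ip ?P (cmul \<rho> a2) (?S0 g) + ip ?P (cmul \<mu> a2) (?J (?S0 g)) + ip ?P (cmul Tr (?S1 U2)) (?J (?S1 g))
        + ip ?P (cmul r U2) (?J g) + ip ?P (cmul \<kappa> U2) g = ip ?P F2 (?J (?S0 g))"
      using 2 g unfolding forward_form_def by blast
    have t: "ip ?P (cmul Tr (?S1 (\<lambda>p. U1 p - U2 p))) (?J (?S1 g)) =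
        ip ?P (\<lambda>p. cmul Tr (?S1 U1) p - cmul Tr (?S1 U2) p) (?J (?S1 g))"
      using sk_diff[OF bker_G1[OF l] U] by (intro ip_cong_AE mem g) (auto simp: cmul_def right_diff_distrib)
    have d: "ip ?P (\<lambda>p. x p - y p) z = ip ?P x z - ip ?P y z" if "x \<in> L2 ?P" "y \<in> L2 ?P" "z \<in> L2 ?P" for x y z
      by (rule ip_diff_left[OF that])
    show ?thesis
      unfolding t cmul_diff
      apply (subst d, (intro mem g)+)+
      using e1 e2 by linarith
  qed
  ultimately show ?thesis using U a unfolding forward_form_def by (blast intro: L2_diff)
qed

section \<open>Frechet gradients on the ball of loads\<close>

lemma admissible_loads_iff:
  "F \<in> admissible_loads l T CF \<longleftrightarrow> F \<in> L2 (cm l T) \<and> (nrm (cm l T) F)\<^sup>2 \<le> CF"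
  by (simp add: admissible_loads_def L2_cyl nrm_cyl)

lemma is_frechet_gradient_of_quadratic_bound:
  assumes g: "g \<in> L2 (cm l T)" and "0 \<le> C"
    and J: "\<And>h. h \<in> L2 (cm l T) \<Longrightarrow> (\<lambda>p. F p + h p) \<in> \<F> \<Longrightarrow>
      \<bar>J (\<lambda>p. F p + h p) - J F - ip (cm l T) g h\<bar> \<le> C * (nrm (cm l T) h)\<^sup>2"
  shows "is_frechet_gradient (cyl l T) \<F> J F g"
  unfolding is_frechet_gradient_def has_frechet_deriv_def L2_cyl ip_cyl nrm_cyl
proof (intro conjI ballI allI impI g)
  fix f h :: "real \<times> real \<Rightarrow> real" and a b :: real
  assume f: "f \<in> L2 (cm l T)" and h: "h \<in> L2 (cm l T)"
  show "ip (cm l T) g (\<lambda>x. a * f x + b * h x) = a * ip (cm l T) g f + b * ip (cm l T) g h"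
    using ip_add_right[OF L2_cmult[OF f] L2_cmult[OF h] g, of a b] by (simp add: ip_cmult_right)
next
  show "\<exists>C. \<forall>h\<in>L2 (cm l T). \<bar>ip (cm l T) g h\<bar> \<le> C * nrm (cm l T) h"
    using Cauchy_Schwarz_ip[OF g] by blast
next
  fix \<epsilon> :: real assume \<epsilon>: "0 < \<epsilon>"
  show "\<exists>\<delta>>0. \<forall>h\<in>L2 (cm l T). (\<lambda>x. F x + h x) \<in> \<F> \<and> nrm (cm l T) h < \<delta> \<longrightarrow>
      \<bar>J (\<lambda>x. F x + h x) - J F - ip (cm l T) g h\<bar> \<le> \<epsilon> * nrm (cm l T) h"
  \<comment> \<open>Below this radius the quadratic bound is at most \<open>\<epsilon>\<close> times
    the norm of \<open>h\<close>; the summand 1 covers \<open>C = 0\<close>.\<close>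
  proof (intro exI[of _ "\<epsilon> / (C + 1)"] conjI ballI impI)
    show "0 < \<epsilon> / (C + 1)" using \<epsilon> \<open>0 \<le> C\<close> by simp
    fix h assume h: "h \<in> L2 (cm l T)" and *: "(\<lambda>x. F x + h x) \<in> \<F> \<and> nrm (cm l T) h < \<epsilon> / (C + 1)"
    have "(C + 1) * nrm (cm l T) h \<le> \<epsilon>"
      using * \<open>0 \<le> C\<close> by (simp add: field_simps)
    then have "C * nrm (cm l T) h \<le> \<epsilon>"
      using nrm_nonneg[of "cm l T" h] unfolding distrib_right by linarith
    then have "C * nrm (cm l T) h * nrm (cm l T) h \<le> \<epsilon> * nrm (cm l T) h"
      by (intro mult_right_mono) auto
    then show "\<bar>J (\<lambda>x. F x + h x) - J F - ip (cm l T) g h\<bar> \<le> \<epsilon> * nrm (cm l T) h"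
      using J[OF h] * by (simp add: power2_eq_square mult.assoc)
  qed
qed

text \<open>Increments from a point of the ball to any other point of the ball suffice to identify the
  gradient, also at the boundary.\<close>

lemma frechet_gradient_unique:
  assumes CF: "0 < CF" and F: "F \<in> admissible_loads l T CF"
    and g: "is_frechet_gradient (cyl l T) (admissible_loads l T CF) J F g"
    and f: "is_frechet_gradient (cyl l T) (admissible_loads l T CF) J F f"
  shows "AE p in cm l T. g p = f p"
proof -
  let ?P = "cm l T"
  have gL: "g \<in> L2 ?P" and fL: "f \<in> L2 ?P"
    using f g by (auto simp: is_frechet_gradient_def L2_cyl)
  have FL: "F \<in> L2 ?P" and Fn: "(nrm ?P F)\<^sup>2 \<le> CF" using F by (auto simp: admissible_loads_iff)
  have nF: "nrm ?P F \<le> sqrt CF" using Fn by (simp add: real_le_rsqrt)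
  let ?d = "\<lambda>p. g p - f p"
  have d: "?d \<in> L2 ?P" by (rule L2_diff[OF gL fL])
  have cancel: "x / (2 * (n + 1)) * (n + 1) = x / 2" "x / (n + 1) * (n + 1) = x" if "0 \<le> n" for x n :: real
    using that by (simp_all add: field_simps)
  have lim: "\<exists>\<delta>>0. \<forall>h\<in>L2 ?P. (\<lambda>x. F x + h x) \<in> admissible_loads l T CF \<and> nrm ?P h < \<delta> \<longrightarrow>
      \<bar>J (\<lambda>x. F x + h x) - J F - ip ?P w h\<bar> \<le> \<epsilon> * nrm ?P h"
    if "is_frechet_gradient (cyl l T) (admissible_loads l T CF) J F w" "0 < \<epsilon>" for w \<epsilon>
    using that unfolding is_frechet_gradient_def has_frechet_deriv_def L2_cyl ip_cyl nrm_cyl by blast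
  \<comment> \<open>By convexity the segment from \<open>F\<close> to a point \<open>H\<close> of
    the ball is admissible. Along it both gradients predict the same increment of \<open>J\<close>
    up to \<open>o(s)\<close>, and the predictions are linear in \<open>s\<close>, so they agree on
    \<open>H - F\<close>.\<close>
  have zero: "ip ?P ?d (\<lambda>p. H p - F p) = 0" if H: "H \<in> L2 ?P" "nrm ?P H \<le> sqrt CF" for H
  proof -
    let ?h = "\<lambda>p. H p - F p"
    have h: "?h \<in> L2 ?P" by (rule L2_diff[OF H(1) FL])
    have "\<bar>ip ?P ?d ?h\<bar> \<le> 0 + e" if e: "0 < e" for e
    proof -
      define \<epsilon> where "\<epsilon> = e / (2 * (nrm ?P ?h + 1))"
      have n0: "0 \<le> nrm ?P ?h" by simp
      have \<epsilon>: "0 < \<epsilon>" unfolding \<epsilon>_def using e n0 by (intro divide_pos_pos mult_pos_pos add_nonneg_pos) auto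
      obtain \<delta>1 where \<delta>1: "0 < \<delta>1" "\<forall>h\<in>L2 ?P. (\<lambda>x. F x + h x) \<in> admissible_loads l T CF \<and> nrm ?P h < \<delta>1 \<longrightarrow>
          \<bar>J (\<lambda>x. F x + h x) - J F - ip ?P g h\<bar> \<le> \<epsilon> * nrm ?P h"
        using lim[OF g \<epsilon>] by blast
      obtain \<delta>2 where \<delta>2: "0 < \<delta>2" "\<forall>h\<in>L2 ?P. (\<lambda>x. F x + h x) \<in> admissible_loads l T CF \<and> nrm ?P h < \<delta>2 \<longrightarrow>
          \<bar>J (\<lambda>x. F x + h x) - J F - ip ?P f h\<bar> \<le> \<epsilon> * nrm ?P h"
        using lim[OF f \<epsilon>] by blast
      \<comment> \<open>\<open>s \<le> 1\<close> stays on the segment, and the quotient keeps the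
        step within both radii.\<close>
      define s where "s = min 1 (min \<delta>1 \<delta>2 / (2 * (nrm ?P ?h + 1)))"
      have "0 < min \<delta>1 \<delta>2 / (2 * (nrm ?P ?h + 1))"
        using \<delta>1(1) \<delta>2(1) n0 by (intro divide_pos_pos mult_pos_pos add_nonneg_pos) auto
      then have s: "0 < s" "s \<le> 1" unfolding s_def by auto
      have "s * (nrm ?P ?h + 1) \<le> min \<delta>1 \<delta>2 / (2 * (nrm ?P ?h + 1)) * (nrm ?P ?h + 1)"
        unfolding s_def using n0 by (intro mult_right_mono) auto
      also have "\<dots> = min \<delta>1 \<delta>2 / 2" by (rule cancel(1)[OF n0])
      finally have sn: "s * nrm ?P ?h < min \<delta>1 \<delta>2" using s \<delta>1(1) \<delta>2(1) by (simp add: algebra_simps)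
      let ?k = "\<lambda>p. s * ?h p"
      have k: "?k \<in> L2 ?P" by (rule L2_cmult[OF h])
      have kn: "nrm ?P ?k = s * nrm ?P ?h" using s nrm_cmult[of ?P s ?h] by simp
      have "nrm ?P (\<lambda>p. F p + ?k p) = nrm ?P (\<lambda>p. (1 - s) * F p + s * H p)"
        by (simp add: algebra_simps)
      also have "\<dots> \<le> (1 - s) * nrm ?P F + s * nrm ?P H"
        using nrm_triangle[OF L2_cmult[OF FL] L2_cmult[OF H(1)], of "1 - s" s] nrm_cmult[of ?P "1 - s" F]
          nrm_cmult[of ?P s H] s by simp
      also have "\<dots> \<le> (1 - s) * sqrt CF + s * sqrt CF"
        using s nF H(2) by (intro add_mono mult_left_mono) auto
      finally have "nrm ?P (\<lambda>p. F p + ?k p) \<le> sqrt CF" by (simp add: algebra_simps)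
      then have "(nrm ?P (\<lambda>p. F p + ?k p))\<^sup>2 \<le> (sqrt CF)\<^sup>2" by (intro power_mono) auto
      then have adm: "(\<lambda>p. F p + ?k p) \<in> admissible_loads l T CF"
        using CF L2_add[OF FL k] by (simp add: admissible_loads_iff)
      have "\<bar>J (\<lambda>x. F x + ?k x) - J F - ip ?P g ?k\<bar> \<le> \<epsilon> * nrm ?P ?k"
        "\<bar>J (\<lambda>x. F x + ?k x) - J F - ip ?P f ?k\<bar> \<le> \<epsilon> * nrm ?P ?k"
        using bspec[OF \<delta>1(2) k] bspec[OF \<delta>2(2) k] adm sn kn by auto
      then have "\<bar>ip ?P g ?k - ip ?P f ?k\<bar> \<le> 2 * \<epsilon> * (s * nrm ?P ?h)" unfolding kn by linarith
      moreover have "ip ?P g ?k - ip ?P f ?k = s * ip ?P ?d ?h"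
        using ip_diff_left[OF gL fL k] ip_cmult_right[of ?P ?d s ?h] by simp
      ultimately have "s * \<bar>ip ?P ?d ?h\<bar> \<le> s * (2 * \<epsilon> * nrm ?P ?h)" using s by (simp add: abs_mult mult_ac)
      then have "\<bar>ip ?P ?d ?h\<bar> \<le> 2 * \<epsilon> * nrm ?P ?h" using s by simp
      also have "\<dots> \<le> 2 * \<epsilon> * (nrm ?P ?h + 1)" using \<epsilon> by (intro mult_left_mono) auto
      also have "\<dots> = e" unfolding \<epsilon>_def mult.assoc cancel(1)[OF n0, of e] by simp
      finally show ?thesis by simp
    qed
    then have "\<bar>ip ?P ?d ?h\<bar> \<le> 0" by (rule field_le_epsilon)
    then show ?thesis by simp
  qed
  \<comment> \<open>Scales \<open>?d\<close> into the ball. Subtracting the identity for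
    \<open>H = 0\<close> from that for \<open>H = c * ?d\<close> eliminates \<open>F\<close> and
    leaves \<open>c * ip ?P ?d ?d = 0\<close>.\<close>
  define c where "c = sqrt CF / (nrm ?P ?d + 1)"
  have c: "0 < c" unfolding c_def using CF nrm_nonneg[of ?P ?d] by (intro divide_pos_pos) (auto intro: add_nonneg_pos)
  have "nrm ?P (\<lambda>p. c * ?d p) = c * nrm ?P ?d" using c nrm_cmult[of ?P c ?d] by simp
  also have "\<dots> \<le> c * (nrm ?P ?d + 1)" using c by simp
  also have "\<dots> = sqrt CF" unfolding c_def by (rule cancel(2)[OF nrm_nonneg])
  finally have "ip ?P ?d (\<lambda>p. c * ?d p - F p) = 0"
    using zero[OF L2_cmult[OF d]] by blast
  moreover have "ip ?P ?d (\<lambda>p. 0 - F p) = 0"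
    using CF zero[OF L2_zero] by (simp add: nrm_def ip_def)
  ultimately have "c * ip ?P ?d ?d = 0"
    using ip_diff_right[OF L2_cmult[OF d] FL d, of c] by (simp add: ip_cmult_right ip_minus_right)
  then have "nrm ?P ?d = 0" using c by (simp add: nrm_def)
  from nrm_eq_0_AE[OF d this] show ?thesis by simp
qed

lemma tikhonov_eq:
  assumes m: "m0 \<in> L2 (iv 0 T)" "ml \<in> L2 (iv 0 T)"
    and e: "AE t in iv 0 T. output_misfit l u \<theta>0 0 F t = m0 t" "AE t in iv 0 T. output_misfit l u \<theta>l l F t = ml t"
  shows "tikhonov l T u \<theta>0 \<theta>l F = 1/2 * ip (iv 0 T) m0 m0 + 1/2 * ip (iv 0 T) ml ml"
proof -
  have *: "(LINT t:{0<..<T}|lebesgue. (f t)\<^sup>2) = ip (iv 0 T) k k"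
    if "k \<in> L2 (iv 0 T)" "AE t in iv 0 T. f t = k t" for f k
    unfolding ip_def power2_eq_square using that(2)
    by (intro lebesgue_integral_iv borel_measurable_times L2_measurable[OF that(1)], eventually_elim) simp
  show ?thesis unfolding tikhonov_def *[OF m(1) e(1)] *[OF m(2) e(2)] ..
qed

lemma ip_add_self:
  assumes "m \<in> L2 M" "d \<in> L2 M"
  shows "ip M (\<lambda>x. m x + d x) (\<lambda>x. m x + d x) = ip M m m + 2 * ip M m d + (nrm M d)\<^sup>2"
  using assms by (simp add: ip_add_left ip_add_right L2_add nrm_square ip_commute[of M d m])

lemma H1_on_L2: "\<theta> \<in> H1_on 0 T \<Longrightarrow> \<theta> \<in> L2 (iv 0 T)"
  by (auto simp: H1_on_def has_weak_deriv_def L2_iv)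

text \<open>The expansion is exact: the remainder is half the sum of the squared norms of the two
  slope increments. \<open>C\<close> is assembled from the norms of the slope functionals and the
  constant of the energy estimate, so it serves all \<open>h\<close>.\<close>

lemma tikhonov_quadratic_expansion:
  assumes l: "0 < l" and T: "0 < T"
    and coef: "\<rho> \<in> Linf_on {0<..<l}" "\<mu> \<in> Linf_on {0<..<l}" "Tr \<in> Linf_on {0<..<l}"
      "r \<in> Linf_on {0<..<l}" "\<kappa> \<in> Linf_on {0<..<l}"
    and pos: "AE x in iv 0 l. 0 \<le> \<rho> x" "AE x in iv 0 l. 0 \<le> \<mu> x" "AE x in iv 0 l. 0 \<le> Tr x"
      "AE x in iv 0 l. 0 \<le> r x" "AE x in iv 0 l. \<kappa>0 \<le> \<kappa> x" "0 < \<kappa>0"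
    and \<theta>: "\<theta>0 \<in> L2 (iv 0 T)" "\<theta>l \<in> L2 (iv 0 T)"
    and fwd: "\<And>F. F \<in> \<F> \<Longrightarrow> forward_weak_solution l T \<rho> \<mu> Tr r \<kappa> F (u F)"
    and \<F>: "\<F> \<subseteq> L2 (cm l T)" and F: "F \<in> \<F>"
    and adj: "adjoint_weak_solution l T \<rho> \<mu> Tr r \<kappa> (output_misfit l u \<theta>0 0 F) (output_misfit l u \<theta>l l F) \<phi>"
  shows "\<phi> \<in> L2 (cm l T)"
    and "\<exists>C\<ge>0. \<forall>h\<in>L2 (cm l T). (\<lambda>p. F p + h p) \<in> \<F> \<longrightarrow>
      \<bar>tikhonov l T u \<theta>0 \<theta>l (\<lambda>p. F p + h p) - tikhonov l T u \<theta>0 \<theta>l F - ip (cm l T) \<phi> h\<bar>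
        \<le> C * (nrm (cm l T) h)\<^sup>2"
proof -
  let ?P = "cm l T" and ?B = "iv 0 T" and ?J = "tikhonov l T u \<theta>0 \<theta>l"
  have cl: "0 \<in> {0..l}" "l \<in> {0..l}" using l by auto
  have misfit: "AE t in ?B. output_misfit l u \<theta> c G t = slope l c U t - \<theta> t"
    if "L2_V2 l T (u G) ux U" "c \<in> {0..l}" for G U ux \<theta> c
    using L2_V2_point_slope[OF l that] by eventually_elim (simp add: output_misfit_def slope_def)
  obtain ux U a where V: "L2_V2 l T (u F) ux U" and form: "forward_form l T \<rho> \<mu> Tr r \<kappa> F U a"
    using forward_weak_solution_form[OF l T coef fwd[OF F]] by blast
  have U: "U \<in> L2 ?P" using form by (simp add: forward_form_def)
  let ?m0 = "\<lambda>t. slope l 0 U t - \<theta>0 t" and ?ml = "\<lambda>t. slope l l U t - \<theta>l t"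
  have m: "?m0 \<in> L2 ?B" "?ml \<in> L2 ?B"
    by (intro L2_diff slope_L2(1)[OF l _ U] cl \<theta>)+
  have JF: "?J F = 1/2 * ip ?B ?m0 ?m0 + 1/2 * ip ?B ?ml ?ml"
    by (rule tikhonov_eq[OF m misfit[OF V cl(1)] misfit[OF V cl(2)]])
  obtain \<phi>x \<Phi> b where V\<phi>: "L2_V2 l T \<phi> \<phi>x \<Phi>"
    and aform: "adjoint_form l T \<rho> \<mu> Tr r \<kappa> (boundary_load l ?m0 ?ml) \<Phi> b"
    using adjoint_weak_solution_form[OF l T coef m(1) misfit[OF V cl(1)] m(2) misfit[OF V cl(2)] adj] by blast
  show \<phi>: "\<phi> \<in> L2 ?P" using V\<phi> by (simp add: L2_V2_iff[OF l])
  have \<phi>eq: "AE p in ?P. pot0 l \<Phi> p = \<phi> p" and \<Phi>: "\<Phi> \<in> L2 ?P"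
    using V\<phi> by (auto simp: L2_V2_iff[OF l])
  have \<phi>': "pot0 l \<Phi> \<in> L2 ?P"
    by (rule finite_pair.sk_L2_nrm(1)[OF finite_pair_iv bker_G0[OF l] \<Phi> less_imp_le[OF l]])
  define K where "K = T * l\<^sup>2 / \<kappa>0"
  define N0 where "N0 = nrm (iv 0 l) (G1 l 0) * K"
  define Nl where "Nl = nrm (iv 0 l) (G1 l l) * K"
  have "\<bar>?J (\<lambda>p. F p + h p) - ?J F - ip ?P \<phi> h\<bar> \<le> (N0\<^sup>2 + Nl\<^sup>2) / 2 * (nrm ?P h)\<^sup>2"
    if h: "h \<in> L2 ?P" and Fh: "(\<lambda>p. F p + h p) \<in> \<F>" for h
  proof -
    let ?F' = "\<lambda>p. F p + h p"
    obtain ux' U' a' where V': "L2_V2 l T (u ?F') ux' U'" and form': "forward_form l T \<rho> \<mu> Tr r \<kappa> ?F' U' a'"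
      using forward_weak_solution_form[OF l T coef fwd[OF Fh]] by blast
    have U': "U' \<in> L2 ?P" using form' by (simp add: forward_form_def)
    let ?D = "\<lambda>p. U' p - U p"
    have D: "?D \<in> L2 ?P" by (rule L2_diff[OF U' U])
    have L: "?F' \<in> L2 ?P" "F \<in> L2 ?P" using Fh F \<F> by auto
    have dform: "forward_form l T \<rho> \<mu> Tr r \<kappa> h ?D (\<lambda>p. a' p - a p)"
      using forward_form_diff[OF l coef L form' form] by simp
    have DK: "nrm ?P ?D \<le> K * nrm ?P h"
      unfolding K_def by (rule forward_form_estimate[OF l T coef pos h dform])
    let ?d0 = "slope l 0 ?D" and ?dl = "slope l l ?D"
    note d = slope_L2[OF l cl(1) D] slope_L2[OF l cl(2) D]
    have mis0: "AE t in ?B. output_misfit l u \<theta>0 0 ?F' t = ?m0 t + ?d0 t"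
      using misfit[OF V' cl(1)] slope_diff[OF l cl(1) U' U] by eventually_elim simp
    have misl: "AE t in ?B. output_misfit l u \<theta>l l ?F' t = ?ml t + ?dl t"
      using misfit[OF V' cl(2)] slope_diff[OF l cl(2) U' U] by eventually_elim simp
    have J': "?J ?F' = 1/2 * ip ?B (\<lambda>t. ?m0 t + ?d0 t) (\<lambda>t. ?m0 t + ?d0 t)
        + 1/2 * ip ?B (\<lambda>t. ?ml t + ?dl t) (\<lambda>t. ?ml t + ?dl t)"
      by (rule tikhonov_eq[OF L2_add[OF m(1) d(1)] L2_add[OF m(2) d(3)] mis0 misl])
    \<comment> \<open>Duality turns the term linear in \<open>h\<close> into the cross terms of the
      two expanded squares, which therefore cancel in the remainder.\<close>
    have "ip ?P \<phi> h = ip ?P h (pot0 l \<Phi>)"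
      unfolding ip_commute[of ?P \<phi> h] using \<phi>eq by (intro ip_cong_AE L2_measurable h \<phi> \<phi>') auto
    also have "\<dots> = ip ?P (boundary_load l ?m0 ?ml) ?D"
      by (rule duality[OF l coef h m dform aform])
    also have "\<dots> = ip ?B ?m0 ?d0 + ip ?B ?ml ?dl"
      by (rule ip_boundary_load[OF l m D])
    finally have "?J ?F' - ?J F - ip ?P \<phi> h = ((nrm ?B ?d0)\<^sup>2 + (nrm ?B ?dl)\<^sup>2) / 2"
      unfolding J' JF ip_add_self[OF m(1) d(1)] ip_add_self[OF m(2) d(3)] by (simp add: field_simps)
    moreover have "(nrm ?B ?d0)\<^sup>2 \<le> N0\<^sup>2 * (nrm ?P h)\<^sup>2"
    proof -
      have "nrm ?B ?d0 \<le> N0 * nrm ?P h"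
        using order_trans[OF d(2) mult_left_mono[OF DK nrm_nonneg[of "iv 0 l" "G1 l 0"]]]
        by (simp add: N0_def mult.assoc)
      from power_mono[OF this nrm_nonneg, of 2] show ?thesis by (simp add: power_mult_distrib)
    qed
    moreover have "(nrm ?B ?dl)\<^sup>2 \<le> Nl\<^sup>2 * (nrm ?P h)\<^sup>2"
    proof -
      have "nrm ?B ?dl \<le> Nl * nrm ?P h"
        using order_trans[OF d(4) mult_left_mono[OF DK nrm_nonneg[of "iv 0 l" "G1 l l"]]]
        by (simp add: Nl_def mult.assoc)
      from power_mono[OF this nrm_nonneg, of 2] show ?thesis by (simp add: power_mult_distrib)
    qed
    ultimately show ?thesis by (simp add: distrib_right add_divide_distrib)
  qed
  then show "\<exists>C\<ge>0. \<forall>h\<in>L2 ?P. (\<lambda>p. F p + h p) \<in> \<F> \<longrightarrow>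
      \<bar>?J (\<lambda>p. F p + h p) - ?J F - ip ?P \<phi> h\<bar> \<le> C * (nrm ?P h)\<^sup>2"
    by (intro exI[of _ "(N0\<^sup>2 + Nl\<^sup>2) / 2"]) auto
qed

theorem theorem4:
  fixes l T CF :: real
    and \<rho> \<mu> Tr r \<kappa> \<theta>0 \<theta>l :: "real \<Rightarrow> real"
    and \<rho>0 \<rho>1 Tr0 Tr1 r0 r1 \<mu>0 \<mu>1 \<kappa>0 \<kappa>1 :: real
    and u \<phi> :: "(real \<times> real \<Rightarrow> real) \<Rightarrow> real \<times> real \<Rightarrow> real"
  assumes "0 < l" "0 < T" "0 < CF"
    and "\<rho> \<in> Linf_on {0<..<l}" "\<mu> \<in> Linf_on {0<..<l}" "Tr \<in> Linf_on {0<..<l}"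
      "r \<in> Linf_on {0<..<l}" "\<kappa> \<in> Linf_on {0<..<l}"
    and "0 < \<rho>0" "AE x\<in>{0<..<l} in lborel. \<rho>0 \<le> \<rho> x \<and> \<rho> x \<le> \<rho>1"
    and "0 \<le> Tr0" "AE x\<in>{0<..<l} in lborel. Tr0 \<le> Tr x \<and> Tr x \<le> Tr1"
    and "0 < r0" "AE x\<in>{0<..<l} in lborel. r0 \<le> r x \<and> r x \<le> r1"
    and "0 \<le> \<mu>0" "AE x\<in>{0<..<l} in lborel. \<mu>0 \<le> \<mu> x \<and> \<mu> x \<le> \<mu>1"
    and "0 < \<kappa>0" "AE x\<in>{0<..<l} in lborel. \<kappa>0 \<le> \<kappa> x \<and> \<kappa> x \<le> \<kappa>1"
    and "\<theta>0 \<in> H1_on 0 T" "\<theta>l \<in> H1_on 0 T"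
    and "\<And>F. F \<in> admissible_loads l T CF \<Longrightarrow> forward_weak_solution l T \<rho> \<mu> Tr r \<kappa> F (u F)"
    and "\<And>F. F \<in> admissible_loads l T CF \<Longrightarrow>
      adjoint_weak_solution l T \<rho> \<mu> Tr r \<kappa> (output_misfit l u \<theta>0 0 F) (output_misfit l u \<theta>l l F) (\<phi> F)"
  shows "\<forall>F \<in> admissible_loads l T CF.
    frechet_differentiable_at (cyl l T) (admissible_loads l T CF) (tikhonov l T u \<theta>0 \<theta>l) F \<and>
    (\<forall>g \<in> L2_on (cyl l T).
       is_frechet_gradient (cyl l T) (admissible_loads l T CF) (tikhonov l T u \<theta>0 \<theta>l) F g
         \<longleftrightarrow> (AE p\<in>cyl l T in lborel. g p = \<phi> F p))"
proof (intro ballI conjI)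
  let ?\<F> = "admissible_loads l T CF" and ?J = "tikhonov l T u \<theta>0 \<theta>l"
  fix F assume F: "F \<in> ?\<F>"
  note bounds = assms(10,12,14,16,18)[folded AE_iv]
  have pos: "AE x in iv 0 l. 0 \<le> \<rho> x" "AE x in iv 0 l. 0 \<le> \<mu> x" "AE x in iv 0 l. 0 \<le> Tr x"
      "AE x in iv 0 l. 0 \<le> r x" "AE x in iv 0 l. \<kappa>0 \<le> \<kappa> x"
    subgoal using bounds(1) by eventually_elim (use assms(9) in simp)
    subgoal using bounds(4) by eventually_elim (use assms(15) in simp)
    subgoal using bounds(2) by eventually_elim (use assms(11) in simp)
    subgoal using bounds(3) by eventually_elim (use assms(13) in simp)
    subgoal using bounds(5) by eventually_elim simp
    done
  have sub: "?\<F> \<subseteq> L2 (cm l T)" by (auto simp: admissible_loads_iff)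
  note expansion = tikhonov_quadratic_expansion[OF assms(1,2,4-8) pos assms(17) H1_on_L2[OF assms(19)]
      H1_on_L2[OF assms(20)] assms(21) sub F assms(22)[OF F]]
  obtain C where C: "0 \<le> C" "\<And>h. h \<in> L2 (cm l T) \<Longrightarrow> (\<lambda>p. F p + h p) \<in> ?\<F> \<Longrightarrow>
      \<bar>?J (\<lambda>p. F p + h p) - ?J F - ip (cm l T) (\<phi> F) h\<bar> \<le> C * (nrm (cm l T) h)\<^sup>2"
    using expansion(2) by blast
  have grad: "is_frechet_gradient (cyl l T) ?\<F> ?J F (\<phi> F)"
    by (rule is_frechet_gradient_of_quadratic_bound[OF expansion(1) C])
  then show "frechet_differentiable_at (cyl l T) ?\<F> ?J F"
    by (auto simp: is_frechet_gradient_def frechet_differentiable_at_def)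
  fix g assume "g \<in> L2_on (cyl l T)"
  then have g: "g \<in> L2 (cm l T)" by (simp add: L2_cyl)
  show "is_frechet_gradient (cyl l T) ?\<F> ?J F g \<longleftrightarrow> (AE p\<in>cyl l T in lborel. g p = \<phi> F p)"
    unfolding AE_cyl
  proof
    assume "is_frechet_gradient (cyl l T) ?\<F> ?J F g"
    then show "AE p in cm l T. g p = \<phi> F p" by (rule frechet_gradient_unique[OF assms(3) F _ grad])
  next
    \<comment> \<open>Changing the gradient on a null set alters none of its inner products, so the
      same quadratic bound applies.\<close>
    assume e: "AE p in cm l T. g p = \<phi> F p"
    have "ip (cm l T) g h = ip (cm l T) (\<phi> F) h" if "h \<in> L2 (cm l T)" for h
      using e by (intro ip_cong_AE L2_measurable g expansion(1) that) auto
    then show "is_frechet_gradient (cyl l T) ?\<F> ?J F g"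
      using C by (intro is_frechet_gradient_of_quadratic_bound[OF g C(1)]) simp
  qed
qed

end
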